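(* Let $f=(f_1,\ldots,f_n)$ be an $n$-tuple of formal power series with the model property and let $M_Z=(M_{Z_1},\ldots,M_{Z_n})$ be the universal model associated with the noncommutative domain $\mathbb B_f$. The (joint) eigenvectors for $M_{Z_1}^*,\ldots,M_{Z_n}^*$ are precisely (up to nonzero scalar multiples) the noncommutative Poisson kernels $$\Gamma_\lambda:=\Big(1-\sum_{i=1}^n|f_i(\lambda)|^2\Big)^{1/2}\sum_{\alpha\in\mathbb F_n^+}[\overline{f(\lambda)}]_\alpha f_\alpha,\qquad \lambda=(\lambda_1,\ldots,\lambda_n)\in\mathbb B_f^<(\mathbb C).$$ They satisfy the equations $M_{Z_i}^*\Gamma_\lambda=\overline{\lambda}_i\Gamma_\lambda$, $i=1,\ldots,n$. If $\lambda\in\mathbb B_f^<(\mathbb C)$ and $\varphi(M_Z)$ is in $H^\infty(\mathbb B_f)$, then the map $$\Phi_\lambda:H^\infty(\mathbb B_f)\to\mathbb C,\qquad \Phi_\lambda(\varphi(M_Z)):=\varphi(\lambda),$$ is WOT-continuous and multiplicative, and $\varphi(\lambda)=\langle\varphi(M_Z)\Gamma_\lambda,\Gamma_\lambda\rangle$. Moreover, $\varphi(M_Z)^*\Gamma_\lambda=\overline{\varphi(\lambda)}\,\Gamma_\lambda$ and $\lambda\mapsto\varphi(\lambda)$ is a bounded holomorphic function on $\mathbb B_f^<(\mathbb C)\subset\mathbb C^n$.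
   Context: Notation. $\mathbb F_n^+$ is the free semigroup on $g_1,\ldots,g_n$ with identity $g_0$ and length $|\cdot|$. For an $n$-tuple $X$ of elements of a unital algebra, $X_\alpha=X_{i_1}\cdots X_{i_k}$ if $\alpha=g_{i_1}\cdots g_{i_k}$, $X_{g_0}=I$; $[f(X)]_\alpha$ is the corresponding product of $f_1(X),\ldots,f_n(X)$, and $[\overline{f(\lambda)}]_\alpha$ that of the complex conjugates $\overline{f_i(\lambda)}$. A tuple $X\in B(\mathcal H)^n$ is viewed as a row operator, so $\|X\|=\|\sum X_iX_i^*\|^{1/2}$; $[B(\mathcal H)^n]_\gamma=\{X:\|X\|<\gamma\}$. A free holomorphic function on $[B(\mathcal H)^n]_\gamma$ is a formal power series $\sum a_\alpha Z_\alpha$ in noncommuting indeterminates (complex coefficients) with radius of convergence $r$, $r^{-1}=\limsup_k(\sum_{|\alpha|=k}|a_\alpha|^2)^{1/2k}$, at least $\gamma$, identified with the map $X\mapsto\sum_k\sum_{|\alpha|=k}a_\alpha X_\alpha$ (norm convergence; $\mathcal H$ separable infinite-dimensional). $H^2_{\bf ball}$ is the Hilbert space of series with $\sum|a_\alpha|^2<\infty$ (the $Z_\alpha$ being orthonormal). Convergence sets. For an $n$-tuple $f$ of formal power series $f_j=\sum c^{(j)}_\alpha Z_\alpha$ and a Hilbert space $\mathcal H$: $\mathcal C_f^{SOT}(\mathcal H)$ is the set of $X\in B(\mathcal H)^n$ such that each series $f_j(X):=\sum_k\sum_{|\alpha|=k}c^{(j)}_\alpha X_\alpha$ is SOT-convergent;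 $\mathcal C_f^{rad}(\mathcal H)$ is the set of $X$ such that for some $\delta\in(0,1)$ these series converge in norm at $rX$ for all $r\in(\delta,1)$ and $f_j(X):=\text{SOT-}\lim_{r\to1}f_j(rX)$ exists for each $j$. Model property. $f=(f_1,\ldots,f_n)$ has the model property if one of the following holds. (A) $f$ is an $n$-tuple of noncommutative polynomials for which there is an $n$-tuple $g$ of noncommutative polynomials with $f\circ g=g\circ f=\mathrm{id}$. Then $\{f_\alpha\}$ is a linear basis of $\mathbb C[Z_1,\ldots,Z_n]$ and $\mathbb H^2(f)$ is the completion of $\mathbb C[Z_1,\ldots,Z_n]$ for the inner product $\langle f_\alpha,f_\beta\rangle=\delta_{\alpha\beta}$. (S) $f$ is an $n$-tuple of formal power series with $f(0)=0$, nonzero radius of convergence and $\det J_f(0)\neq0$ ($J_f(0)_{ij}$ is the coefficient of $Z_j$ in $f_i$); $\mathbb H^2(f)$ is the Hilbert space of formal power series $\sum a_\alpha f_\alpha$, $\sum|a_\alpha|^2<\infty$, with $\{f_\alpha\}$ orthonormal; $Z_1,\ldots,Z_n\in\mathbb H^2(f)$; left multiplication $M_{Z_i}$ by $Z_i$ is bounded on $\mathbb H^2(f)$; and $M_Z=(M_{Z_1},\ldots,M_{Z_n})$ belongs to $\mathcal C_f^{SOT}(\mathbb H^2(f))$ or $\mathcal C_f^{rad}(\mathbb H^2(f))$ with $f_j(M_Z)=M_{f_j}$ (left multiplication by $f_j$), $j=1,\ldots,n$. (F) $f$ is an $n$-tuple of free holomorphic functions on some $[B(\mathcal H)^n]_\gamma$,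 $\gamma>0$, with range in $[B(\mathcal H)^n]_1$, such that $G\circ f\not\equiv0$ for every nonzero free holomorphic $G$ on $[B(\mathcal H)^n]_1$; $\mathbb H^2(f)=\{G\circ f:G\in H^2_{\bf ball}\}$ with $\langle F\circ f,G\circ f\rangle=\langle F,G\rangle$; the coordinate functions $Z_1,\ldots,Z_n$ lie in $\mathbb H^2(f)$, left multiplications $M_{Z_i}$ by them are bounded on $\mathbb H^2(f)$, and $M_Z$ is in $\mathcal C_f^{SOT}(\mathbb H^2(f))$ or $\mathcal C_f^{rad}(\mathbb H^2(f))$ with $f_j(M_Z)=M_{f_j}$ for all $j$. In all cases $\{f_\alpha\}_{\alpha\in\mathbb F_n^+}$ is an orthonormal basis of $\mathbb H^2(f)$, and $M_Z$ is called the universal model. Writing $Z_i=\sum_\alpha a^{(i)}_\alpha f_\alpha$ in $\mathbb H^2(f)$, one has $M_{Z_i}f_\beta=\sum_\alpha a^{(i)}_\alpha f_{\alpha\beta}$, and $g_i:=\sum_\alpha a^{(i)}_\alpha Z_\alpha$ defines the inverse $g=(g_1,\ldots,g_n)$ of $f$ with respect to composition. Domain. $X\in B(\mathcal H)^n$ satisfies $g(f(X))=X$ if $X\in\mathcal C_f^{SOT}(\mathcal H)\cup\mathcal C_f^{rad}(\mathcal H)$ and either (for all $i$) $X_i=\sum_k\sum_{|\alpha|=k}a^{(i)}_\alpha[f(X)]_\alpha$ in the SOT, or (for all $i$) $X_i=\text{SOT-}\lim_{r\to1}\sum_k\sum_{|\alpha|=k}a^{(i)}_\alpha r^{|\alpha|}[f(X)]_\alpha$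 (automatic in case (A)). Then $\mathbb B_f^<(\mathcal H):=\{X\in B(\mathcal H)^n:\ g(f(X))=X,\ \|f(X)\|<1\}$; $\mathbb B_f^<(\mathbb C)\subset\mathbb C^n$ is the case $\mathcal H=\mathbb C$. Hardy algebra. $H^\infty(\mathbb B_f)$ is the WOT-closure in $B(\mathbb H^2(f))$ of all noncommutative polynomials in $M_{Z_1},\ldots,M_{Z_n}$ and the identity. Every element of it, written $\varphi(M_Z)$, has a unique representation $\varphi(M_Z)=\text{SOT-}\lim_{r\to1}\sum_{k}\sum_{|\alpha|=k}c_\alpha r^{|\alpha|}[f(M_Z)]_\alpha$ (norm-convergent series for $r<1$), where $\sum c_\alpha S_\alpha$ is the Fourier series of an element of the WOT-closed algebra generated by the left creation operators $S_1,\ldots,S_n$ on the full Fock space; for $\lambda\in\mathbb B_f^<(\mathbb C)$ one sets $\varphi(\lambda):=\sum_k\sum_{|\alpha|=k}c_\alpha[f(\lambda)]_\alpha$. *)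

theory Defs
  imports "HOL-Analysis.Analysis"
begin

section \<open>Complex Hilbert spaces\<close>

text \<open>
  The distribution only has real inner product spaces. The class below adds a complex structure
  and a complex inner product, linear in its first argument, whose real part is the given
  real inner product; norm and topology are those of \<^class>\<open>real_inner\<close>.
\<close>

class complex_hilbert_space = real_inner + complete_space +
  fixes scaleC :: "complex \<Rightarrow> 'a \<Rightarrow> 'a" (infixr "*\<^sub>C" 75)
    and cinner :: "'a \<Rightarrow> 'a \<Rightarrow> complex"
  assumes scaleC_add_right: "c *\<^sub>C (x + y) = c *\<^sub>C x + c *\<^sub>C y"
    and scaleC_add_left: "(c + d) *\<^sub>C x = c *\<^sub>C x + d *\<^sub>C x"
    and scaleC_scaleC: "c *\<^sub>C d *\<^sub>C x = (c * d) *\<^sub>C x"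
    and scaleR_scaleC: "r *\<^sub>R x = complex_of_real r *\<^sub>C x"
    and cinner_commute: "cinner x y = cnj (cinner y x)"
    and cinner_add_left: "cinner (x + y) z = cinner x z + cinner y z"
    and cinner_scaleC_left: "cinner (c *\<^sub>C x) y = c * cinner x y"
    and Re_cinner: "Re (cinner x y) = inner x y"

instantiation complex :: complex_hilbert_space
begin

definition scaleC_complex :: "complex \<Rightarrow> complex \<Rightarrow> complex" where
  "scaleC_complex c x = c * x"

definition cinner_complex :: "complex \<Rightarrow> complex \<Rightarrow> complex" where
  "cinner_complex x y = x * cnj y"

instance
  by standard
    (simp_all add: scaleC_complex_def cinner_complex_def inner_complex_def algebra_simps
      scaleR_conv_of_real)

end


section \<open>The Hilbert space of square summable families\<close>

definition square_summable :: "('i \<Rightarrow> complex) \<Rightarrow> bool" where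
  "square_summable x \<longleftrightarrow> (\<lambda>i. (cmod (x i))\<^sup>2) summable_on UNIV"

typedef 'i ell2 = "{x :: 'i \<Rightarrow> complex. square_summable x}"
  morphisms ell2_coeff Abs_ell2
  by (rule exI[of _ "\<lambda>_. 0"]) (simp add: square_summable_def)

lemma square_summable_coeff [simp]: "square_summable (ell2_coeff x)"
  using ell2_coeff[of x] by simp

lemma ell2_coeff_Abs [simp]: "square_summable x \<Longrightarrow> ell2_coeff (Abs_ell2 x) = x"
  by (simp add: Abs_ell2_inverse)

lemma ell2_eqI: "(\<And>i. ell2_coeff x i = ell2_coeff y i) \<Longrightarrow> x = y"
  by (metis ell2_coeff_inject ext)

lemma square_summable_prod:
  assumes "square_summable x" "square_summable y"
  shows "(\<lambda>i. x i * cnj (y i)) summable_on UNIV"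
proof (rule Infinite_Sum.abs_summable_summable, rule Infinite_Sum.abs_summable_on_comparison_test')
  show "(\<lambda>i. (cmod (x i))\<^sup>2 + (cmod (y i))\<^sup>2) summable_on UNIV"
    using assms unfolding square_summable_def by (rule summable_on_add)
  show "cmod (x i * cnj (y i)) \<le> (cmod (x i))\<^sup>2 + (cmod (y i))\<^sup>2" for i
  proof -
    have "0 \<le> (cmod (x i) - cmod (y i))\<^sup>2" by simp
    then have "2 * (cmod (x i) * cmod (y i)) \<le> (cmod (x i))\<^sup>2 + (cmod (y i))\<^sup>2"
      by (simp add: power2_diff)
    moreover have "0 \<le> cmod (x i) * cmod (y i)" by simp
    ultimately have "cmod (x i) * cmod (y i) \<le> (cmod (x i))\<^sup>2 + (cmod (y i))\<^sup>2" by linarith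
    then show ?thesis by (simp add: norm_mult)
  qed
qed

lemma square_summable_zero [simp]: "square_summable (\<lambda>_. 0)"
  by (simp add: square_summable_def)

lemma square_summable_add [simp]:
  assumes "square_summable x" "square_summable y"
  shows "square_summable (\<lambda>i. x i + y i)"
  unfolding square_summable_def
proof (rule summable_on_comparison_test)
  show "(\<lambda>i. 2 * ((cmod (x i))\<^sup>2 + (cmod (y i))\<^sup>2)) summable_on UNIV"
    using assms unfolding square_summable_def by (intro summable_on_cmult_right summable_on_add)
  show "(cmod (x i + y i))\<^sup>2 \<le> 2 * ((cmod (x i))\<^sup>2 + (cmod (y i))\<^sup>2)" for i
  proof -
    have "(cmod (x i + y i))\<^sup>2 \<le> (cmod (x i) + cmod (y i))\<^sup>2"
      by (simp add: norm_triangle_ineq power_mono)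
    also have "\<dots> \<le> 2 * ((cmod (x i))\<^sup>2 + (cmod (y i))\<^sup>2)"
      using zero_le_power2[of "cmod (x i) - cmod (y i)"]
      by (simp add: power2_eq_square algebra_simps)
    finally show ?thesis .
  qed
qed simp

lemma square_summable_cmult [simp]:
  assumes "square_summable x"
  shows "square_summable (\<lambda>i. c * x i)"
  using assms unfolding square_summable_def
  by (simp add: norm_mult power_mult_distrib summable_on_cmult_right)

lemma square_summable_uminus [simp]: "square_summable (\<lambda>i. - x i) = square_summable x"
  by (simp add: square_summable_def)

lemma square_summable_diff [simp]:
  assumes "square_summable x" "square_summable y"
  shows "square_summable (\<lambda>i. x i - y i)"
  using square_summable_add[of x "\<lambda>i. - y i"] assms by simp

lemma square_summable_scaleR [simp]:
  assumes "square_summable x"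
  shows "square_summable (\<lambda>i. r *\<^sub>R x i)"
  using square_summable_cmult[OF assms, of "of_real r"] by (simp add: scaleR_conv_of_real)

definition ell2_cinner :: "'i ell2 \<Rightarrow> 'i ell2 \<Rightarrow> complex" where
  "ell2_cinner x y = (\<Sum>\<^sub>\<infinity>i. ell2_coeff x i * cnj (ell2_coeff y i))"

instantiation ell2 :: (type) real_inner
begin

definition zero_ell2 :: "'a ell2" where "0 = Abs_ell2 (\<lambda>_. 0)"
definition plus_ell2 :: "'a ell2 \<Rightarrow> 'a ell2 \<Rightarrow> 'a ell2" where
  "x + y = Abs_ell2 (\<lambda>i. ell2_coeff x i + ell2_coeff y i)"
definition uminus_ell2 :: "'a ell2 \<Rightarrow> 'a ell2" where
  "- x = Abs_ell2 (\<lambda>i. - ell2_coeff x i)"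
definition minus_ell2 :: "'a ell2 \<Rightarrow> 'a ell2 \<Rightarrow> 'a ell2" where
  "x - y = Abs_ell2 (\<lambda>i. ell2_coeff x i - ell2_coeff y i)"
definition scaleR_ell2 :: "real \<Rightarrow> 'a ell2 \<Rightarrow> 'a ell2" where
  "r *\<^sub>R x = Abs_ell2 (\<lambda>i. r *\<^sub>R ell2_coeff x i)"
definition inner_ell2 :: "'a ell2 \<Rightarrow> 'a ell2 \<Rightarrow> real" where
  "inner (x :: 'a ell2) y = Re (ell2_cinner x y)"
definition norm_ell2 :: "'a ell2 \<Rightarrow> real" where
  "norm (x :: 'a ell2) = sqrt (inner x x)"
definition sgn_ell2 :: "'a ell2 \<Rightarrow> 'a ell2" where "sgn (x :: 'a ell2) = inverse (norm x) *\<^sub>R x"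
definition dist_ell2 :: "'a ell2 \<Rightarrow> 'a ell2 \<Rightarrow> real" where
  "dist (x :: 'a ell2) y = norm (x - y)"
definition uniformity_ell2 :: "('a ell2 \<times> 'a ell2) filter" where
  "uniformity_ell2 = (INF e\<in>{0<..}. principal {(x :: 'a ell2, y). dist x y < e})"
definition open_ell2 :: "'a ell2 set \<Rightarrow> bool" where
  "open_ell2 (U :: 'a ell2 set) \<longleftrightarrow> (\<forall>x\<in>U. \<forall>\<^sub>F (x', y) in uniformity. x' = x \<longrightarrow> y \<in> U)"

lemma ell2_coeff_simps [simp]:
  "ell2_coeff 0 i = 0"
  "ell2_coeff (x + y) i = ell2_coeff x i + ell2_coeff y i"
  "ell2_coeff (- x) i = - ell2_coeff x i"
  "ell2_coeff (x - y) i = ell2_coeff x i - ell2_coeff y i"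
  "ell2_coeff (r *\<^sub>R x) i = r *\<^sub>R ell2_coeff x i"
  by (simp_all add: zero_ell2_def plus_ell2_def uminus_ell2_def minus_ell2_def scaleR_ell2_def)

lemma ell2_inner_self: "inner x x = (\<Sum>\<^sub>\<infinity>i. (cmod (ell2_coeff x i))\<^sup>2)" for x :: "'a ell2"
proof -
  have "inner x x = (\<Sum>\<^sub>\<infinity>i. Re (ell2_coeff x i * cnj (ell2_coeff x i)))"
    unfolding inner_ell2_def ell2_cinner_def
    by (rule infsum_Re[symmetric]) (simp add: square_summable_prod)
  also have "\<dots> = (\<Sum>\<^sub>\<infinity>i. (cmod (ell2_coeff x i))\<^sup>2)"
    by (rule infsum_cong) (simp add: complex_mult_cnj cmod_power2)
  finally show ?thesis .
qed

lemma ell2_cinner_commute: "ell2_cinner x y = cnj (ell2_cinner y x)" for x y :: "'a ell2"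
  unfolding ell2_cinner_def infsum_cnj[symmetric] by (rule infsum_cong) simp

lemma ell2_cinner_add_left: "ell2_cinner (x + y) z = ell2_cinner x z + ell2_cinner y z"
  for x y z :: "'a ell2"
  unfolding ell2_cinner_def
  by (simp add: distrib_right infsum_add square_summable_prod)

instance
proof
  fix x y z :: "'a ell2" and r s :: real and U :: "'a ell2 set"
  show "x + y + z = x + (y + z)" "x + y = y + x" "0 + x = x" "- x + x = 0" "x - y = x + - y"
    by (rule ell2_eqI, simp)+
  show "r *\<^sub>R (x + y) = r *\<^sub>R x + r *\<^sub>R y" "(r + s) *\<^sub>R x = r *\<^sub>R x + s *\<^sub>R x"
    "r *\<^sub>R s *\<^sub>R x = (r * s) *\<^sub>R x" "1 *\<^sub>R x = x"
    by (rule ell2_eqI, simp add: algebra_simps)+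
  show "sgn x = inverse (norm x) *\<^sub>R x" by (rule sgn_ell2_def)
  show "dist x y = norm (x - y)" by (rule dist_ell2_def)
  show "uniformity = (INF e\<in>{0<..}. principal {(x :: 'a ell2, y). dist x y < e})"
    by (rule uniformity_ell2_def)
  show "open U = (\<forall>x\<in>U. \<forall>\<^sub>F (x', y) in uniformity. x' = x \<longrightarrow> y \<in> U)"
    by (rule open_ell2_def)
  show "inner x y = inner y x"
    unfolding inner_ell2_def by (subst ell2_cinner_commute) simp
  show "inner (x + y) z = inner x z + inner y z"
    by (simp add: inner_ell2_def ell2_cinner_add_left)
  have "ell2_cinner (r *\<^sub>R x) y = of_real r * ell2_cinner x y"
    unfolding ell2_cinner_def by (simp add: scaleR_conv_of_real mult.assoc infsum_cmult_right')
  then show "inner (r *\<^sub>R x) y = r * inner x y"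
    by (simp add: inner_ell2_def)
  show "0 \<le> inner x x"
    unfolding ell2_inner_self by (rule infsum_nonneg) simp
  show "inner x x = 0 \<longleftrightarrow> x = 0"
  proof
    assume "inner x x = 0"
    then have "(cmod (ell2_coeff x i))\<^sup>2 = 0" for i
      using square_summable_coeff[of x] unfolding ell2_inner_self square_summable_def
      by (intro nonneg_infsum_le_0D[of "\<lambda>i. (cmod (ell2_coeff x i))\<^sup>2" UNIV i]) simp_all
    then show "x = 0" by (intro ell2_eqI) simp
  qed (simp add: ell2_inner_self)
  show "norm x = sqrt (inner x x)" by (rule norm_ell2_def)
qed

end

lemma ell2_sum_le_norm:
  assumes "finite F"
  shows "(\<Sum>i\<in>F. (cmod (ell2_coeff x i))\<^sup>2) \<le> (norm x)\<^sup>2"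
proof -
  have "(\<Sum>i\<in>F. (cmod (ell2_coeff x i))\<^sup>2) \<le> (\<Sum>\<^sub>\<infinity>i. (cmod (ell2_coeff x i))\<^sup>2)"
    using assms square_summable_coeff[of x]
    by (intro finite_sum_le_infsum) (simp_all add: square_summable_def)
  then show ?thesis
    by (simp only: power2_norm_eq_inner ell2_inner_self)
qed

lemma ell2_coeff_le_norm: "cmod (ell2_coeff x i) \<le> norm x"
  using ell2_sum_le_norm[of "{i}" x] by (simp add: power2_le_iff_abs_le)

lemma ell2_norm_leI:
  assumes "0 \<le> B" "\<And>F. finite F \<Longrightarrow> (\<Sum>i\<in>F. (cmod (ell2_coeff x i))\<^sup>2) \<le> B\<^sup>2"
  shows "norm x \<le> B"
proof -
  have "inner x x \<le> B\<^sup>2"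
    unfolding ell2_inner_self using square_summable_coeff[of x]
    by (intro infsum_le_finite_sums assms(2)) (simp_all add: square_summable_def)
  then show ?thesis
    unfolding norm_eq_sqrt_inner using assms(1) by (simp add: real_le_lsqrt)
qed

instance ell2 :: (type) complete_space
proof
  fix X :: "nat \<Rightarrow> 'a ell2"
  assume X: "Cauchy X"
  have "Cauchy (\<lambda>n. ell2_coeff (X n) i)" for i
  proof (rule metric_CauchyI)
    fix e :: real assume "0 < e"
    then obtain N where N: "\<forall>m\<ge>N. \<forall>n\<ge>N. dist (X m) (X n) < e"
      using metric_CauchyD[OF X] by blast
    have "dist (ell2_coeff (X m) i) (ell2_coeff (X n) i) \<le> dist (X m) (X n)" for m n
      using ell2_coeff_le_norm[of "X m - X n" i] by (simp add: dist_norm)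
    with N show "\<exists>N. \<forall>m\<ge>N. \<forall>n\<ge>N. dist (ell2_coeff (X m) i) (ell2_coeff (X n) i) < e"
      by (meson le_less_trans)
  qed
  then have "\<forall>i. \<exists>l. (\<lambda>n. ell2_coeff (X n) i) \<longlonglongrightarrow> l"
    using Cauchy_convergent_iff convergent_def by blast
  then obtain l where l: "\<And>i. (\<lambda>n. ell2_coeff (X n) i) \<longlonglongrightarrow> l i"
    by metis
  have bound: "(\<Sum>i\<in>F. (cmod (ell2_coeff (X m) i - l i))\<^sup>2) \<le> e\<^sup>2"
    if "finite F" "0 \<le> e" "\<forall>n\<ge>N. dist (X m) (X n) \<le> e" for F m e and N :: nat
  proof (rule LIMSEQ_le_const2)
    show "(\<lambda>n. \<Sum>i\<in>F. (cmod (ell2_coeff (X m) i - ell2_coeff (X n) i))\<^sup>2)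
        \<longlonglongrightarrow> (\<Sum>i\<in>F. (cmod (ell2_coeff (X m) i - l i))\<^sup>2)"
      by (intro tendsto_intros l)
    have "(\<Sum>i\<in>F. (cmod (ell2_coeff (X m) i - ell2_coeff (X n) i))\<^sup>2) \<le> e\<^sup>2"
      if "n \<ge> N" for n
    proof -
      have "(\<Sum>i\<in>F. (cmod (ell2_coeff (X m) i - ell2_coeff (X n) i))\<^sup>2) \<le> (norm (X m - X n))\<^sup>2"
        using ell2_sum_le_norm[OF \<open>finite F\<close>, of "X m - X n"] by simp
      also have "\<dots> \<le> e\<^sup>2"
        using \<open>\<forall>n\<ge>N. dist (X m) (X n) \<le> e\<close> \<open>n \<ge> N\<close> by (intro power_mono) (simp_all add: dist_norm)
      finally show ?thesis .
    qed
    then show "\<exists>N. \<forall>n\<ge>N. (\<Sum>i\<in>F. (cmod (ell2_coeff (X m) i - ell2_coeff (X n) i))\<^sup>2) \<le> e\<^sup>2"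
      by blast
  qed
  obtain N1 where N1: "\<forall>m\<ge>N1. \<forall>n\<ge>N1. dist (X m) (X n) < 1"
    using metric_CauchyD[OF X, of 1] by auto
  have "(\<Sum>i\<in>F. (cmod (ell2_coeff (X N1) i - l i))\<^sup>2) \<le> 1\<^sup>2" if "finite F" for F
    using N1 by (intro bound[OF that, of 1 N1]) (auto intro: less_imp_le)
  then have "square_summable (\<lambda>i. ell2_coeff (X N1) i - l i)"
    unfolding square_summable_def
    by (intro nonneg_bdd_above_summable_on) (auto intro!: bdd_aboveI)
  from square_summable_diff[OF square_summable_coeff[of "X N1"] this]
  have sq: "square_summable l" by simp
  have "X \<longlonglongrightarrow> Abs_ell2 l"
  proof (rule metric_LIMSEQ_I)
    fix e :: real assume "0 < e"
    then obtain N where N: "\<forall>m\<ge>N. \<forall>n\<ge>N. dist (X m) (X n) < e / 2"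
      using metric_CauchyD[OF X, of "e / 2"] by auto
    have "dist (X m) (Abs_ell2 l) \<le> e / 2" if "m \<ge> N" for m
      unfolding dist_norm
    proof (rule ell2_norm_leI)
      fix F :: "'a set" assume "finite F"
      then have "(\<Sum>i\<in>F. (cmod (ell2_coeff (X m) i - l i))\<^sup>2) \<le> (e / 2)\<^sup>2"
        using N that \<open>0 < e\<close> by (intro bound[of F "e / 2" N]) (auto intro: less_imp_le)
      then show "(\<Sum>i\<in>F. (cmod (ell2_coeff (X m - Abs_ell2 l) i))\<^sup>2) \<le> (e / 2)\<^sup>2"
        using sq by simp
    qed (use \<open>0 < e\<close> in simp)
    moreover have "e / 2 < e" using \<open>0 < e\<close> by simp
    ultimately show "\<exists>N. \<forall>n\<ge>N. dist (X n) (Abs_ell2 l) < e"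
      by (meson le_less_trans)
  qed
  then show "convergent X" by (rule convergentI)
qed

instantiation ell2 :: (type) complex_hilbert_space
begin

definition scaleC_ell2 :: "complex \<Rightarrow> 'a ell2 \<Rightarrow> 'a ell2" where
  "c *\<^sub>C x = Abs_ell2 (\<lambda>i. c * ell2_coeff x i)"
definition cinner_ell2 :: "'a ell2 \<Rightarrow> 'a ell2 \<Rightarrow> complex" where
  "cinner x y = ell2_cinner x y"

lemma ell2_coeff_scaleC [simp]: "ell2_coeff (c *\<^sub>C x) i = c * ell2_coeff x i" for x :: "'a ell2"
  by (simp add: scaleC_ell2_def)

instance
proof
  fix x y z :: "'a ell2" and c d :: complex and r :: real
  show "c *\<^sub>C (x + y) = c *\<^sub>C x + c *\<^sub>C y" "(c + d) *\<^sub>C x = c *\<^sub>C x + d *\<^sub>C x"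
    "c *\<^sub>C d *\<^sub>C x = (c * d) *\<^sub>C x" "r *\<^sub>R x = complex_of_real r *\<^sub>C x"
    by (rule ell2_eqI, simp add: algebra_simps scaleR_conv_of_real)+
  show "cinner x y = cnj (cinner y x)"
    unfolding cinner_ell2_def by (rule ell2_cinner_commute)
  show "cinner (x + y) z = cinner x z + cinner y z"
    unfolding cinner_ell2_def by (rule ell2_cinner_add_left)
  show "cinner (c *\<^sub>C x) y = c * cinner x y"
    by (simp add: cinner_ell2_def ell2_cinner_def mult.assoc infsum_cmult_right')
  show "Re (cinner x y) = inner x y"
    by (simp add: cinner_ell2_def inner_ell2_def)
qed

end

definition ell2_basis :: "'i \<Rightarrow> 'i ell2" where
  "ell2_basis i = Abs_ell2 (\<lambda>j. if j = i then 1 else 0)"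


section \<open>Bounded operators\<close>

definition bounded_clinear :: "('h::complex_hilbert_space \<Rightarrow> 'h) \<Rightarrow> bool" where
  "bounded_clinear T \<longleftrightarrow> bounded_linear T \<and> (\<forall>c x. T (c *\<^sub>C x) = c *\<^sub>C T x)"

definition cadjoint :: "('h::complex_hilbert_space \<Rightarrow> 'h) \<Rightarrow> 'h \<Rightarrow> 'h" where
  "cadjoint T = (THE S. \<forall>x y. cinner (T x) y = cinner x (S y))"

definition bounded_tuple :: "('n \<Rightarrow> 'h::complex_hilbert_space \<Rightarrow> 'h) \<Rightarrow> bool" where
  "bounded_tuple X \<longleftrightarrow> (\<forall>i. bounded_clinear (X i))"

text \<open>The norm of the row operator \<open>(X\<^sub>i)\<^sub>i\<close>.\<close>

definition row_norm :: "('n::finite \<Rightarrow> 'h::complex_hilbert_space \<Rightarrow> 'h) \<Rightarrow> real" where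
  "row_norm X = sqrt (onorm (\<lambda>h. \<Sum>i\<in>UNIV. X i (cadjoint (X i) h)))"

definition op_ball :: "real \<Rightarrow> ('n::finite \<Rightarrow> 'h::complex_hilbert_space \<Rightarrow> 'h) set" where
  "op_ball \<gamma> = {X. bounded_tuple X \<and> row_norm X < \<gamma>}"

definition scale_tuple ::
    "real \<Rightarrow> ('n \<Rightarrow> 'h::complex_hilbert_space \<Rightarrow> 'h) \<Rightarrow> 'n \<Rightarrow> 'h \<Rightarrow> 'h" where
  "scale_tuple r X = (\<lambda>i h. r *\<^sub>R X i h)"

text \<open>The weak operator topology on the bounded operators: the coarsest topology making all
  matrix coefficients continuous.\<close>

definition wot :: "('h::complex_hilbert_space \<Rightarrow> 'h) topology" where
  "wot = pullback_topology {T. bounded_clinear T} (\<lambda>T (x, y). cinner (T x) y) euclidean"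


section \<open>Formal power series in noncommuting indeterminates\<close>

text \<open>The free semigroup is the set of lists over the finite index type, the identity being
  the empty list; a formal power series is its coefficient function.\<close>

type_synonym 'n ncps = "'n list \<Rightarrow> complex"

definition ncps_var :: "'n \<Rightarrow> 'n ncps" where
  "ncps_var i w = (if w = [i] then 1 else 0)"

definition ncps_one :: "'n ncps" where
  "ncps_one w = (if w = [] then 1 else 0)"

definition ncps_mult :: "'n ncps \<Rightarrow> 'n ncps \<Rightarrow> 'n ncps" where
  "ncps_mult p q w = (\<Sum>k\<le>length w. p (take k w) * q (drop k w))"

definition ncps_word :: "('n \<Rightarrow> 'n ncps) \<Rightarrow> 'n list \<Rightarrow> 'n ncps" where
  "ncps_word f \<alpha> = foldr (\<lambda>i q. ncps_mult (f i) q) \<alpha> ncps_one"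

text \<open>The series \<open>\<Sum> a\<^sub>\<alpha> f\<^sub>\<alpha>\<close>, formed coefficientwise. It is only used when \<open>a\<close> has finite support
  or \<open>f\<close> has no constant terms; each coefficient is then a finite sum.\<close>

definition ncps_compose :: "'n ncps \<Rightarrow> ('n \<Rightarrow> 'n ncps) \<Rightarrow> 'n ncps" where
  "ncps_compose a f w = (\<Sum>\<^sub>\<infinity>\<alpha>. a \<alpha> * ncps_word f \<alpha> w)"

definition nc_polynomial :: "'n ncps \<Rightarrow> bool" where
  "nc_polynomial p \<longleftrightarrow> finite {\<alpha>. p \<alpha> \<noteq> 0}"

text \<open>\<^const>\<open>conv_radius\<close> is the inverse of the limit superior of the \<open>k\<close>-th roots, so this is
  the radius with exponents \<open>1/2k\<close> on the sums of squares.\<close>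

definition ncps_radius :: "'n::finite ncps \<Rightarrow> ereal" where
  "ncps_radius c = conv_radius (\<lambda>k. sqrt (\<Sum>\<alpha> | length \<alpha> = k. (cmod (c \<alpha>))\<^sup>2))"

definition free_holomorphic :: "real \<Rightarrow> 'n::finite ncps \<Rightarrow> bool" where
  "free_holomorphic \<gamma> c \<longleftrightarrow> ereal \<gamma> \<le> ncps_radius c"


section \<open>Evaluation on operators and convergence sets\<close>

definition op_word :: "('n \<Rightarrow> 'h::complex_hilbert_space \<Rightarrow> 'h) \<Rightarrow> 'n list \<Rightarrow> 'h \<Rightarrow> 'h" where
  "op_word X \<alpha> = foldr (\<lambda>i T. X i \<circ> T) \<alpha> id"

definition hom_part ::
    "'n::finite ncps \<Rightarrow> ('n \<Rightarrow> 'h::complex_hilbert_space \<Rightarrow> 'h) \<Rightarrow> nat \<Rightarrow> 'h \<Rightarrow> 'h" where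
  "hom_part c X k h = (\<Sum>\<alpha> | length \<alpha> = k. c \<alpha> *\<^sub>C op_word X \<alpha> h)"

definition sot_convergent :: "'n::finite ncps \<Rightarrow> ('n \<Rightarrow> 'h::complex_hilbert_space \<Rightarrow> 'h) \<Rightarrow> bool" where
  "sot_convergent c X \<longleftrightarrow>
     (\<exists>T. bounded_clinear T \<and> (\<forall>h. (\<lambda>k. hom_part c X k h) sums T h))"

definition norm_convergent :: "'n::finite ncps \<Rightarrow> ('n \<Rightarrow> 'h::complex_hilbert_space \<Rightarrow> 'h) \<Rightarrow> bool" where
  "norm_convergent c X \<longleftrightarrow>
     (\<exists>T. bounded_clinear T \<and>
        (\<lambda>N. onorm (\<lambda>h. (\<Sum>k<N. hom_part c X k h) - T h)) \<longlonglongrightarrow> 0)"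

text \<open>The pointwise sum; it is the value of the series at \<open>X\<close> under both SOT and norm
  convergence.\<close>

definition ev_sum ::
    "'n::finite ncps \<Rightarrow> ('n \<Rightarrow> 'h::complex_hilbert_space \<Rightarrow> 'h) \<Rightarrow> 'h \<Rightarrow> 'h" where
  "ev_sum c X h = (\<Sum>k. hom_part c X k h)"

definition ev_rad ::
    "'n::finite ncps \<Rightarrow> ('n \<Rightarrow> 'h::complex_hilbert_space \<Rightarrow> 'h) \<Rightarrow> 'h \<Rightarrow> 'h" where
  "ev_rad c X h = Lim (at_left 1) (\<lambda>r. ev_sum c (scale_tuple r X) h)"

definition C_sot ::
    "('n \<Rightarrow> 'n::finite ncps) \<Rightarrow> ('n \<Rightarrow> 'h::complex_hilbert_space \<Rightarrow> 'h) set" where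
  "C_sot f = {X. bounded_tuple X \<and> (\<forall>j. sot_convergent (f j) X)}"

definition C_rad ::
    "('n \<Rightarrow> 'n::finite ncps) \<Rightarrow> ('n \<Rightarrow> 'h::complex_hilbert_space \<Rightarrow> 'h) set" where
  "C_rad f = {X. bounded_tuple X \<and>
     (\<exists>\<delta>\<in>{0<..<1}. \<forall>r\<in>{\<delta><..<1}. \<forall>j. norm_convergent (f j) (scale_tuple r X)) \<and>
     (\<forall>j. \<exists>T. bounded_clinear T \<and>
        (\<forall>h. ((\<lambda>r. ev_sum (f j) (scale_tuple r X) h) \<longlongrightarrow> T h) (at_left 1)))}"

text \<open>The tuple \<open>f(X)\<close> for \<open>X\<close> in the union of the two convergence sets; on the intersection
  both prescriptions agree by Abel's theorem.\<close>

definition tuple_eval ::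
    "('n \<Rightarrow> 'n::finite ncps) \<Rightarrow> ('n \<Rightarrow> 'h::complex_hilbert_space \<Rightarrow> 'h) \<Rightarrow> 'n \<Rightarrow> 'h \<Rightarrow> 'h" where
  "tuple_eval f X = (if X \<in> C_sot f then (\<lambda>j. ev_sum (f j) X) else (\<lambda>j. ev_rad (f j) X))"


section \<open>The model property, the universal model and the inverse of \<open>f\<close>\<close>

text \<open>
  In each of the three cases \<open>H\<^sup>2(f)\<close> is a Hilbert space with orthonormal basis \<open>(f\<^sub>\<alpha>)\<close>. It is
  given here by its coordinates: the vector \<open>x\<close> of type \<open>'n list ell2\<close> is the element
  \<open>\<Sum> x\<^sub>\<alpha> f\<^sub>\<alpha>\<close>, and \<open>ell2_basis \<alpha>\<close> is \<open>f\<^sub>\<alpha>\<close>. What that element is, and hence what multiplication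
  by a power series means, differs from case to case:
  \<^item> case A: a vector of finite support is the polynomial \<open>ncps_compose (ell2_coeff x) f\<close>, and
    these are dense in the completion;
  \<^item> case S: \<open>x\<close> is the formal power series \<open>ncps_compose (ell2_coeff x) f\<close>;
  \<^item> case F: \<open>x\<close> is the map \<open>X \<mapsto> G(f(X))\<close> on the operator ball of radius \<open>\<gamma>\<close>, where \<open>G\<close> is
    the power series with coefficients \<open>x\<close>; operators act on \<open>nat ell2\<close>, a separable infinite
    dimensional Hilbert space.
  The \<open>left_mult\<close> predicates say that \<open>T\<close> is bounded left multiplication by \<open>p\<close> on \<open>H\<^sup>2(f)\<close>.
  The predicates \<open>model_A f g M\<close> etc. say that \<open>f\<close> has the model property, that \<open>g i\<close> is the
  coordinate family of \<open>Z\<^sub>i\<close> in \<open>H\<^sup>2(f)\<close> (read as a power series: the inverse of \<open>f\<close>), and that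
  \<open>M\<close> is the universal model; \<open>g\<close> and \<open>M\<close> are determined by \<open>f\<close>.
\<close>

definition left_mult_A ::
    "('n \<Rightarrow> 'n ncps) \<Rightarrow> 'n ncps \<Rightarrow> ('n list ell2 \<Rightarrow> 'n list ell2) \<Rightarrow> bool" where
  "left_mult_A f p T \<longleftrightarrow> bounded_clinear T \<and>
     (\<forall>x. nc_polynomial (ell2_coeff x) \<longrightarrow>
        nc_polynomial (ell2_coeff (T x)) \<and>
        ncps_compose (ell2_coeff (T x)) f = ncps_mult p (ncps_compose (ell2_coeff x) f))"

definition left_mult_S ::
    "('n \<Rightarrow> 'n ncps) \<Rightarrow> 'n ncps \<Rightarrow> ('n list ell2 \<Rightarrow> 'n list ell2) \<Rightarrow> bool" where
  "left_mult_S f p T \<longleftrightarrow> bounded_clinear T \<and>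
     (\<forall>x. ncps_compose (ell2_coeff (T x)) f = ncps_mult p (ncps_compose (ell2_coeff x) f))"

definition ev_at :: "('n \<Rightarrow> 'n::finite ncps) \<Rightarrow> ('n \<Rightarrow> nat ell2 \<Rightarrow> nat ell2) \<Rightarrow>
    'n \<Rightarrow> nat ell2 \<Rightarrow> nat ell2" where
  "ev_at f X = (\<lambda>j. ev_sum (f j) X)"

definition left_mult_F ::
    "real \<Rightarrow> ('n \<Rightarrow> 'n::finite ncps) \<Rightarrow> 'n ncps \<Rightarrow> ('n list ell2 \<Rightarrow> 'n list ell2) \<Rightarrow> bool" where
  "left_mult_F \<gamma> f p T \<longleftrightarrow> bounded_clinear T \<and>
     (\<forall>x. \<forall>X\<in>op_ball \<gamma>.
        ev_sum (ell2_coeff (T x)) (ev_at f X) = ev_sum p X \<circ> ev_sum (ell2_coeff x) (ev_at f X))"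

definition model_A ::
    "('n::finite \<Rightarrow> 'n ncps) \<Rightarrow> ('n \<Rightarrow> 'n ncps) \<Rightarrow> ('n \<Rightarrow> 'n list ell2 \<Rightarrow> 'n list ell2) \<Rightarrow> bool" where
  "model_A f g M \<longleftrightarrow>
     (\<forall>i. nc_polynomial (f i)) \<and>
     (\<exists>k. (\<forall>i. nc_polynomial (k i)) \<and>
        (\<forall>i. ncps_compose (f i) k = ncps_var i) \<and> (\<forall>i. ncps_compose (k i) f = ncps_var i)) \<and>
     (\<forall>i. nc_polynomial (g i) \<and> ncps_compose (g i) f = ncps_var i) \<and>
     (\<forall>i. left_mult_A f (ncps_var i) (M i))"

definition model_S ::
    "('n::finite \<Rightarrow> 'n ncps) \<Rightarrow> ('n \<Rightarrow> 'n ncps) \<Rightarrow> ('n \<Rightarrow> 'n list ell2 \<Rightarrow> 'n list ell2) \<Rightarrow> bool" where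
  "model_S f g M \<longleftrightarrow>
     (\<forall>i. f i [] = 0) \<and>
     (\<forall>i. 0 < ncps_radius (f i)) \<and>
     det (\<chi> i j. f i [j]) \<noteq> 0 \<and>
     (\<forall>i. square_summable (g i) \<and> ncps_compose (g i) f = ncps_var i) \<and>
     (\<forall>i. left_mult_S f (ncps_var i) (M i)) \<and>
     (M \<in> C_sot f \<and> (\<forall>j. left_mult_S f (f j) (ev_sum (f j) M)) \<or>
      M \<in> C_rad f \<and> (\<forall>j. left_mult_S f (f j) (ev_rad (f j) M)))"

definition model_F ::
    "('n::finite \<Rightarrow> 'n ncps) \<Rightarrow> ('n \<Rightarrow> 'n ncps) \<Rightarrow> ('n \<Rightarrow> 'n list ell2 \<Rightarrow> 'n list ell2) \<Rightarrow> bool" where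
  "model_F f g M \<longleftrightarrow> (\<exists>\<gamma>>0.
     (\<forall>i. free_holomorphic \<gamma> (f i)) \<and>
     (\<forall>X\<in>op_ball \<gamma>. ev_at f X \<in> op_ball 1) \<and>
     (\<forall>G. free_holomorphic 1 G \<and> G \<noteq> (\<lambda>_. 0) \<longrightarrow>
        (\<exists>X\<in>op_ball \<gamma>. ev_sum G (ev_at f X) \<noteq> (\<lambda>_. 0))) \<and>
     (\<forall>i. square_summable (g i) \<and> (\<forall>X\<in>op_ball \<gamma>. ev_sum (g i) (ev_at f X) = X i)) \<and>
     (\<forall>i. left_mult_F \<gamma> f (ncps_var i) (M i)) \<and>
     (M \<in> C_sot f \<and> (\<forall>j. left_mult_F \<gamma> f (f j) (ev_sum (f j) M)) \<or>
      M \<in> C_rad f \<and> (\<forall>j. left_mult_F \<gamma> f (f j) (ev_rad (f j) M))))"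

definition model_property ::
    "('n::finite \<Rightarrow> 'n ncps) \<Rightarrow> ('n \<Rightarrow> 'n ncps) \<Rightarrow> ('n \<Rightarrow> 'n list ell2 \<Rightarrow> 'n list ell2) \<Rightarrow> bool" where
  "model_property f g M \<longleftrightarrow> model_A f g M \<or> model_S f g M \<or> model_F f g M"


section \<open>The noncommutative domain and its scalar part\<close>

definition nc_domain :: "('n \<Rightarrow> 'n::finite ncps) \<Rightarrow> ('n \<Rightarrow> 'n ncps) \<Rightarrow>
    ('n \<Rightarrow> 'h::complex_hilbert_space \<Rightarrow> 'h) set" where
  "nc_domain f g = {X \<in> C_sot f \<union> C_rad f.
     (tuple_eval f X \<in> C_sot g \<and> (\<forall>i. ev_sum (g i) (tuple_eval f X) = X i) \<or>
      tuple_eval f X \<in> C_rad g \<and> (\<forall>i. ev_rad (g i) (tuple_eval f X) = X i)) \<and>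
     row_norm (tuple_eval f X) < 1}"

text \<open>A point of \<open>\<complex>\<^sup>n\<close> is identified with the tuple of multiplication operators on \<open>\<complex>\<close>.\<close>

definition scalar_tuple :: "complex ^ 'n::finite \<Rightarrow> 'n \<Rightarrow> complex \<Rightarrow> complex" where
  "scalar_tuple z i w = z $ i * w"

definition scalar_domain ::
    "('n \<Rightarrow> 'n::finite ncps) \<Rightarrow> ('n \<Rightarrow> 'n ncps) \<Rightarrow> (complex ^ 'n) set" where
  "scalar_domain f g = {z. scalar_tuple z \<in> nc_domain f g}"

definition scalar_eval :: "('n \<Rightarrow> 'n::finite ncps) \<Rightarrow> complex ^ 'n \<Rightarrow> 'n \<Rightarrow> complex" where
  "scalar_eval f z i = tuple_eval f (scalar_tuple z) i 1"

definition poisson_kernel :: "('n \<Rightarrow> 'n::finite ncps) \<Rightarrow> complex ^ 'n \<Rightarrow> 'n list ell2" where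
  "poisson_kernel f z =
     sqrt (1 - (\<Sum>i\<in>UNIV. (cmod (scalar_eval f z i))\<^sup>2)) *\<^sub>R
       (\<Sum>\<^sub>\<infinity>\<alpha>. prod_list (map (\<lambda>i. cnj (scalar_eval f z i)) \<alpha>) *\<^sub>C ell2_basis \<alpha>)"


section \<open>The Hardy algebra\<close>

definition op_polynomials :: "('n \<Rightarrow> 'h::complex_hilbert_space \<Rightarrow> 'h) \<Rightarrow> ('h \<Rightarrow> 'h) set" where
  "op_polynomials X =
     {\<lambda>h. \<Sum>\<alpha>\<in>F. c \<alpha> *\<^sub>C op_word X \<alpha> h | F c. finite (F :: 'n list set)}"

definition hardy_algebra :: "('n \<Rightarrow> 'h::complex_hilbert_space \<Rightarrow> 'h) \<Rightarrow> ('h \<Rightarrow> 'h) set" where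
  "hardy_algebra X = wot closure_of op_polynomials X"

text \<open>The left creation operators on the full Fock space, with its standard basis indexed by
  words.\<close>

definition left_creation :: "'n \<Rightarrow> 'n list ell2 \<Rightarrow> 'n list ell2" where
  "left_creation j x =
     Abs_ell2 (\<lambda>\<alpha>. case \<alpha> of [] \<Rightarrow> 0 | i # \<beta> \<Rightarrow> if i = j then ell2_coeff x \<beta> else 0)"

text \<open>The coefficients \<open>c\<^sub>\<alpha>\<close> of the Fourier series \<open>\<Sum> c\<^sub>\<alpha> S\<^sub>\<alpha>\<close> of an operator \<open>A\<close> in the algebra
  \<open>hardy_algebra left_creation\<close>.\<close>

definition fourier_coeffs :: "('n list ell2 \<Rightarrow> 'n list ell2) \<Rightarrow> 'n ncps" where
  "fourier_coeffs A \<alpha> = cinner (A (ell2_basis [])) (ell2_basis \<alpha>)"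

definition hardy_representation :: "('n \<Rightarrow> 'n::finite ncps) \<Rightarrow>
    ('n \<Rightarrow> 'n list ell2 \<Rightarrow> 'n list ell2) \<Rightarrow> ('n list ell2 \<Rightarrow> 'n list ell2) \<Rightarrow> 'n ncps \<Rightarrow> bool" where
  "hardy_representation f M T c \<longleftrightarrow>
     (\<exists>A\<in>hardy_algebra left_creation. c = fourier_coeffs A) \<and>
     (\<forall>r\<in>{0<..<1}. norm_convergent c (scale_tuple r (tuple_eval f M))) \<and>
     (\<forall>h. ((\<lambda>r. ev_sum c (scale_tuple r (tuple_eval f M)) h) \<longlongrightarrow> T h) (at_left 1))"

text \<open>The scalar \<open>\<phi>(z)\<close> attached to the operator \<open>T = \<phi>(M\<^sub>Z)\<close>.\<close>

definition hardy_eval :: "('n \<Rightarrow> 'n::finite ncps) \<Rightarrow> ('n \<Rightarrow> 'n list ell2 \<Rightarrow> 'n list ell2) \<Rightarrow>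
    ('n list ell2 \<Rightarrow> 'n list ell2) \<Rightarrow> complex ^ 'n \<Rightarrow> complex" where
  "hardy_eval f M T z =
     (let c = (THE c. hardy_representation f M T c)
      in \<Sum>k. \<Sum>\<alpha> | length \<alpha> = k. c \<alpha> * prod_list (map (scalar_eval f z) \<alpha>))"


section \<open>Holomorphic functions on subsets of \<open>\<complex>\<^sup>n\<close>\<close>

text \<open>Complex differentiability at every point of an open set. Being holomorphic on \<open>S\<close> includes
  the openness of \<open>S\<close>.\<close>

definition holomorphic_several :: "(complex ^ 'n::finite \<Rightarrow> complex) \<Rightarrow> (complex ^ 'n) set \<Rightarrow> bool" where
  "holomorphic_several \<phi> S \<longleftrightarrow> open S \<and>
     (\<forall>z\<in>S. \<exists>D. (\<phi> has_derivative D) (at z) \<and> (\<forall>c v. D (c *s v) = c * D v))"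

end

theory Submission
  imports Defs
begin

text \<open>
  In the orthonormal basis \<open>(f\<^sub>\<alpha>)\<close> the operator \<open>M\<^sub>i\<close> is left convolution by \<open>g\<^sub>i\<close> and
  \<open>f\<^sub>j(M)\<close> is the left creation operator \<open>S\<^sub>j\<close>: in each of the three cases this follows from
  the injectivity of \<open>a \<mapsto> \<Sum> a\<^sub>\<alpha> f\<^sub>\<alpha>\<close>. The Szego kernels \<open>\<Sum> cnj(w\<^sub>\<alpha>) f\<^sub>\<alpha>\<close>, \<open>\<bar>w\<bar> < 1\<close>, reproduce
  the value at \<open>w\<close> multiplicatively, hence are eigenvectors of the adjoint of every left
  multiplier. Conversely, testing the series \<open>f\<^sub>j(M)\<close> against a joint eigenvector \<open>v\<close> with
  eigenvalues \<open>cnj(z\<^sub>i)\<close> shows that \<open>f(z)\<close> converges and that \<open>v\<close> is an eigenvector of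
  \<open>S\<^sub>j\<^sup>*\<close> with eigenvalue \<open>cnj(f\<^sub>j(z))\<close>, so \<open>v\<close> is a multiple of the Szego kernel at \<open>f(z)\<close> and
  \<open>z = g(f(z))\<close>. Thus the scalar domain is the injective image of the unit ball under the
  holomorphic map \<open>g\<close>, hence open by invariance of domain. The same uniqueness of eigenvectors,
  applied to a derivative of the Szego kernel, shows that the derivative of \<open>g\<close> is
  injective, so \<open>f = g\<^sup>-\<^sup>1\<close> and \<open>\<phi>(z) = \<langle>\<phi>(M) 1, szego (f(z))\<rangle>\<close> are holomorphic.
\<close>

section \<open>Operators on complex Hilbert spaces and on square summable families\<close>

section \<open>Complex inner products\<close>

text \<open>The detour through the inverse map has a reason: a point lies in the scalar domain
  because certain series converge at that one point, so neither openness of the domain nor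
  continuity of \<open>f\<close> on it can be read off. The \<open>g_i\<close>, by contrast, have
  square summable coefficients and converge on the whole unit ball, so regularity of
  \<open>f\<close> is obtained only from that of \<open>g\<close>. A second obstacle is that
  \<open>hardy_eval\<close> uses a coefficient family picked by \<open>THE\<close>: every operator
  in a WOT closure must first be shown to have exactly one such representation. For this the
  operators are viewed as bounded left convolutions. These form a WOT-closed set, and strong
  convergence of their dilations as r tends to 1 rests on a norm bound uniform in r. The three model
  cases are used only to establish the locale \<open>universal_model\<close>; all statements about
  eigenvectors, the domain and the Hardy algebra are proved in that locale.\<close>

lemma scaleC_zero_left [simp]: "0 *\<^sub>C x = 0"
  using scaleC_add_left[of 0 0 x] by simp

lemma scaleC_zero_right [simp]: "c *\<^sub>C 0 = 0"
  using scaleC_add_right[of c 0 0] by simp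

lemma scaleC_one [simp]: "1 *\<^sub>C x = x"
  using scaleR_scaleC[of 1 x] by simp

lemma scaleC_minus_right: "c *\<^sub>C (- x) = - (c *\<^sub>C x)"
  using scaleC_add_right[of c x "- x"] by (simp add: add_eq_0_iff)

lemma scaleC_diff_right: "c *\<^sub>C (x - y) = c *\<^sub>C x - c *\<^sub>C y"
  using scaleC_add_right[of c x "- y"] by (simp add: scaleC_minus_right)

lemma scaleC_diff_left: "(c - d) *\<^sub>C x = c *\<^sub>C x - d *\<^sub>C x"
  using scaleC_add_left[of "c - d" d x] by simp

lemma scaleC_sum_right: "c *\<^sub>C (\<Sum>i\<in>A. x i) = (\<Sum>i\<in>A. c *\<^sub>C x i)"
  by (induction A rule: infinite_finite_induct) (simp_all add: scaleC_add_right)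

lemma scaleC_complex [simp]: "c *\<^sub>C (z :: complex) = c * z"
  by (simp add: scaleC_complex_def)

lemma cinner_add_right: "cinner x (y + z) = cinner x y + cinner x z"
  by (metis cinner_add_left cinner_commute complex_cnj_add)

lemma cinner_scaleC_right: "cinner x (c *\<^sub>C y) = cnj c * cinner x y"
  by (metis cinner_commute cinner_scaleC_left complex_cnj_mult)

lemma cinner_scaleR_left: "cinner (r *\<^sub>R x) y = of_real r * cinner x y"
  by (simp add: scaleR_scaleC cinner_scaleC_left)

lemma cinner_scaleR_right: "cinner x (r *\<^sub>R y) = of_real r * cinner x y"
  by (simp add: scaleR_scaleC cinner_scaleC_right)

lemma cinner_zero_left [simp]: "cinner 0 y = 0"
  using cinner_add_left[of 0 0 y] by simp

lemma cinner_zero_right [simp]: "cinner x 0 = 0"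
  using cinner_add_right[of x 0 0] by simp

lemma cinner_diff_left: "cinner (x - y) z = cinner x z - cinner y z"
  using cinner_add_left[of "x - y" y z] by simp

lemma cinner_sum_left: "cinner (\<Sum>i\<in>A. x i) y = (\<Sum>i\<in>A. cinner (x i) y)"
  by (induction A rule: infinite_finite_induct) (simp_all add: cinner_add_left)

lemma cinner_sum_right: "cinner y (\<Sum>i\<in>A. x i) = (\<Sum>i\<in>A. cinner y (x i))"
  by (induction A rule: infinite_finite_induct) (simp_all add: cinner_add_right)

lemma cinner_self: "cinner x x = of_real ((norm x)\<^sup>2)"
proof (rule complex_eqI)
  show "Re (cinner x x) = Re (of_real ((norm x)\<^sup>2))"
    by (simp add: Re_cinner power2_norm_eq_inner)
  show "Im (cinner x x) = Im (of_real ((norm x)\<^sup>2))"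
    using arg_cong[OF cinner_commute[of x x], of Im] by simp
qed

lemma norm_scaleC: "norm (c *\<^sub>C x) = cmod c * norm x" for x :: "'a::complex_hilbert_space"
proof -
  have "complex_of_real ((norm (c *\<^sub>C x))\<^sup>2) = of_real ((cmod c * norm x)\<^sup>2)"
    unfolding cinner_self[symmetric] cinner_scaleC_left cinner_scaleC_right
    using complex_norm_square[of c]
    by (simp add: cinner_self power_mult_distrib mult.commute mult.left_commute)
  then have "(norm (c *\<^sub>C x))\<^sup>2 = (cmod c * norm x)\<^sup>2" by (simp only: of_real_eq_iff)
  then show ?thesis by (simp add: power2_eq_iff_nonneg)
qed

text \<open>Rotating \<open>x\<close> by the phase of the inner product makes the latter real and
  nonnegative, which leaves the real Cauchy-Schwarz inequality. If the inner product is zero, then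
  \<open>sgn\<close> and hence \<open>c\<close> are zero.\<close>

lemma cinner_norm_ineq: "cmod (cinner x y) \<le> norm x * norm y"
proof -
  define c where "c = cnj (sgn (cinner x y))"
  have "of_real (cmod (cinner x y)) = cinner (c *\<^sub>C x) y"
    unfolding c_def cinner_scaleC_left
    by (cases "cinner x y = 0") (simp_all add: sgn_eq divide_simps mult.commute flip: complex_norm_square power2_eq_square)
  then have "cmod (cinner x y) = inner (c *\<^sub>C x) y"
    by (metis Re_cinner Re_complex_of_real)
  also have "\<dots> \<le> norm (c *\<^sub>C x) * norm y" by (rule norm_cauchy_schwarz)
  also have "\<dots> \<le> norm x * norm y"
    by (intro mult_right_mono) (simp_all add: norm_scaleC c_def norm_sgn)
  finally show ?thesis .
qed

lemma bounded_linear_cinner_left: "bounded_linear (\<lambda>x. cinner x y)"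
  by (rule bounded_linear_intro[where K = "norm y"])
    (simp_all add: cinner_add_left cinner_scaleR_left scaleR_conv_of_real cinner_norm_ineq)

lemma bounded_linear_cinner_right: "bounded_linear (cinner x)"
  by (rule bounded_linear_intro[where K = "norm x"])
    (simp_all add: cinner_add_right cinner_scaleR_right scaleR_conv_of_real cinner_norm_ineq
      mult.commute[of "norm _" "norm x"])

lemmas tendsto_cinner_left = bounded_linear.tendsto[OF bounded_linear_cinner_left]
  and sums_cinner_left = bounded_linear.sums[OF bounded_linear_cinner_left]

lemma bounded_linear_scaleC: "bounded_linear (\<lambda>x :: 'a::complex_hilbert_space. c *\<^sub>C x)"
  by (rule bounded_linear_intro[where K = "cmod c"])
    (simp_all add: scaleC_add_right scaleR_scaleC scaleC_scaleC norm_scaleC mult.commute)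

lemma cinner_eqI:
  assumes "\<And>z. cinner x z = cinner y z"
  shows "x = y"
proof -
  have "cinner (x - y) (x - y) = 0" using assms[of "x - y"] by (simp add: cinner_diff_left)
  then show ?thesis by (simp add: cinner_self)
qed

lemma cinner_eqI_right:
  assumes "\<And>z. cinner z x = cinner z y"
  shows "x = y"
  by (rule cinner_eqI) (metis assms cinner_commute)


section \<open>Bounded operators and adjoints\<close>

lemma bounded_clinearI:
  assumes "\<And>x y. T (x + y) = T x + T y" "\<And>c x. T (c *\<^sub>C x) = c *\<^sub>C T x"
    "\<And>x. norm (T x) \<le> K * norm x"
  shows "bounded_clinear T"
  unfolding bounded_clinear_def
  by (intro conjI bounded_linear_intro[where K = K])
    (use assms in \<open>simp_all add: scaleR_scaleC mult.commute\<close>)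

lemma bounded_clinear_linear: "bounded_clinear T \<Longrightarrow> bounded_linear T"
  by (simp add: bounded_clinear_def)

lemma bounded_clinear_scaleC: "bounded_clinear T \<Longrightarrow> T (c *\<^sub>C x) = c *\<^sub>C T x"
  by (simp add: bounded_clinear_def)

lemmas bounded_clinear_add = linear_add[OF bounded_linear.linear[OF bounded_clinear_linear]]
  and bounded_clinear_diff = linear_diff[OF bounded_linear.linear[OF bounded_clinear_linear]]
  and bounded_clinear_sum = linear_sum[OF bounded_linear.linear[OF bounded_clinear_linear]]
  and bounded_clinear_0 = linear_0[OF bounded_linear.linear[OF bounded_clinear_linear]]
  and bounded_clinear_onorm = onorm[OF bounded_clinear_linear]

lemma bounded_clinear_id: "bounded_clinear id"
  by (rule bounded_clinearI[where K = 1]) simp_all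

lemma bounded_clinear_compose:
  "bounded_clinear S \<Longrightarrow> bounded_clinear T \<Longrightarrow> bounded_clinear (S \<circ> T)"
  unfolding bounded_clinear_def by (simp add: bounded_linear_compose o_def)

lemma bounded_clinear_zero: "bounded_clinear (\<lambda>_. 0)"
  by (rule bounded_clinearI[where K = 0]) simp_all

lemma bounded_clinear_plus:
  "bounded_clinear S \<Longrightarrow> bounded_clinear T \<Longrightarrow> bounded_clinear (\<lambda>h. S h + T h)"
  unfolding bounded_clinear_def by (simp add: bounded_linear_add scaleC_add_right)

lemma bounded_clinear_minus:
  "bounded_clinear S \<Longrightarrow> bounded_clinear T \<Longrightarrow> bounded_clinear (\<lambda>h. S h - T h)"
  unfolding bounded_clinear_def by (simp add: bounded_linear_sub scaleC_diff_right)

lemma bounded_clinear_cmult: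
  "bounded_clinear T \<Longrightarrow> bounded_clinear (\<lambda>h. c *\<^sub>C T h)"
  unfolding bounded_clinear_def
  by (simp add: bounded_linear_compose[OF bounded_linear_scaleC] scaleC_scaleC mult.commute)

lemma bounded_clinear_setsum:
  assumes "\<And>i. i \<in> A \<Longrightarrow> bounded_clinear (T i)"
  shows "bounded_clinear (\<lambda>h. \<Sum>i\<in>A. T i h)"
  using assms
  by (induction A rule: infinite_finite_induct)
    (simp_all add: bounded_clinear_zero bounded_clinear_plus)

lemma bounded_clinear_op_word: "bounded_tuple X \<Longrightarrow> bounded_clinear (op_word X \<alpha>)"
  by (induction \<alpha>)
    (simp_all add: op_word_def bounded_clinear_id bounded_clinear_compose bounded_tuple_def)

lemma bounded_clinear_hom_part: "bounded_tuple X \<Longrightarrow> bounded_clinear (hom_part c X k)"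
  unfolding hom_part_def
  by (intro bounded_clinear_setsum bounded_clinear_cmult bounded_clinear_op_word)

lemma op_word_Nil [simp]: "op_word X [] = id"
  and op_word_Cons [simp]: "op_word X (i # \<alpha>) = X i \<circ> op_word X \<alpha>"
  by (simp_all add: op_word_def)

lemma op_word_append: "op_word X (\<alpha> @ \<beta>) = op_word X \<alpha> \<circ> op_word X \<beta>"
  by (induction \<alpha>) (simp_all add: o_assoc)

lemma cadjoint_eqI:
  assumes "\<And>x y. cinner (T x) y = cinner x (S y)"
  shows "cadjoint T = S"
  unfolding cadjoint_def
proof (rule the_equality)
  show "R = S" if "\<forall>x y. cinner (T x) y = cinner x (R y)" for R
    by (rule ext, rule cinner_eqI_right) (use assms that in metis)
qed (use assms in blast)


section \<open>Square summable families\<close>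

lemma square_summableI_bound:
  assumes "\<And>F. finite F \<Longrightarrow> (\<Sum>i\<in>F. (cmod (x i))\<^sup>2) \<le> B"
  shows "square_summable x"
  unfolding square_summable_def
  by (intro nonneg_bdd_above_summable_on) (use assms in \<open>auto intro!: bdd_aboveI\<close>)

lemma square_summable_finite_support:
  assumes "finite {i. x i \<noteq> 0}"
  shows "square_summable x"
  unfolding square_summable_def
  using summable_on_cong_neutral[of "{i. x i \<noteq> 0}" UNIV "\<lambda>i. (cmod (x i))\<^sup>2" "\<lambda>i. (cmod (x i))\<^sup>2"]
    summable_on_finite[OF assms] by auto

lemma ell2_coeff_basis: "ell2_coeff (ell2_basis i) j = (if j = i then 1 else 0)"
  unfolding ell2_basis_def
  by (subst ell2_coeff_Abs) (auto intro!: square_summable_finite_support)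

lemma ell2_coeff_sum: "ell2_coeff (\<Sum>i\<in>A. x i) j = (\<Sum>i\<in>A. ell2_coeff (x i) j)"
  by (induction A rule: infinite_finite_induct) simp_all

lemma cinner_ell2_eq: "cinner x y = (\<Sum>\<^sub>\<infinity>i. ell2_coeff x i * cnj (ell2_coeff y i))"
  by (simp add: cinner_ell2_def ell2_cinner_def)

lemma has_sum_cinner_ell2:
  "((\<lambda>i. ell2_coeff x i * cnj (ell2_coeff y i)) has_sum cinner x y) UNIV"
  unfolding cinner_ell2_eq by (intro has_sum_infsum square_summable_prod) simp_all

lemma cinner_basis_right: "cinner x (ell2_basis i) = ell2_coeff x i"
  unfolding cinner_ell2_eq
  by (rule infsumI, rule has_sum_finite_neutralI[of "{i}"]) (auto simp: ell2_coeff_basis)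

lemma cinner_basis_left: "cinner (ell2_basis i) x = cnj (ell2_coeff x i)"
  by (metis cinner_basis_right cinner_commute)

lemma bounded_linear_ell2_coeff: "bounded_linear (\<lambda>x. ell2_coeff x i)"
  using bounded_linear_cinner_left[of "ell2_basis i"] by (simp add: cinner_basis_right)

lemmas tendsto_ell2_coeff = bounded_linear.tendsto[OF bounded_linear_ell2_coeff]
  and sums_ell2_coeff = bounded_linear.sums[OF bounded_linear_ell2_coeff]

lemma norm_ell2_basis [simp]: "norm (ell2_basis i) = 1"
proof -
  have "complex_of_real ((norm (ell2_basis i))\<^sup>2) = of_real 1"
    unfolding cinner_self[symmetric] by (simp add: cinner_basis_right ell2_coeff_basis)
  then have "(norm (ell2_basis i))\<^sup>2 = 1" by (simp only: of_real_eq_iff)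
  then show ?thesis by (metis norm_ge_zero power2_eq_1_iff abs_of_nonneg abs_minus_cancel abs_one)
qed

lemma has_sum_norm_ell2: "((\<lambda>i. (cmod (ell2_coeff x i))\<^sup>2) has_sum (norm x)\<^sup>2) UNIV"
  using square_summable_coeff[of x]
  by (auto simp: power2_norm_eq_inner ell2_inner_self square_summable_def intro!: has_sum_infsum)

text \<open>The squared distance from \<open>x\<close> to the partial sum over \<open>F\<close> is
  the squared norm of \<open>x\<close> minus the squares of the coefficients in \<open>F\<close>, so
  convergence of the squares gives convergence in norm.\<close>

lemma ell2_has_sum: "((\<lambda>i. ell2_coeff x i *\<^sub>C ell2_basis i) has_sum x) UNIV"
  unfolding has_sum_def
proof (rule Lim_null[THEN iffD2], rule tendsto_norm_zero_cancel)
  let ?P = "\<lambda>F. \<Sum>i\<in>F. ell2_coeff x i *\<^sub>C ell2_basis i"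
  have coeff: "ell2_coeff (?P F) i = (if i \<in> F then ell2_coeff x i else 0)" if "finite F" for F i
    using that by (simp add: ell2_coeff_sum ell2_coeff_basis if_distrib cong: if_cong)
  have norm: "norm (?P F - x) = sqrt ((norm x)\<^sup>2 - (\<Sum>i\<in>F. (cmod (ell2_coeff x i))\<^sup>2))"
    if F: "finite F" for F
  proof -
    have "((\<lambda>i. (cmod (ell2_coeff x i))\<^sup>2 - (if i \<in> F then (cmod (ell2_coeff x i))\<^sup>2 else 0))
        has_sum (norm x)\<^sup>2 - (\<Sum>i\<in>F. (cmod (ell2_coeff x i))\<^sup>2)) UNIV"
      unfolding diff_conv_add_uminus
      by (intro has_sum_add has_sum_norm_ell2 has_sum_uminus[THEN iffD2])
        (use F in \<open>auto intro!: has_sum_finite_neutralI\<close>)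
    also have "(\<lambda>i. (cmod (ell2_coeff x i))\<^sup>2 - (if i \<in> F then (cmod (ell2_coeff x i))\<^sup>2 else 0))
        = (\<lambda>i. (cmod (ell2_coeff (?P F - x) i))\<^sup>2)"
      using F by (auto simp: coeff)
    finally have "(norm x)\<^sup>2 - (\<Sum>i\<in>F. (cmod (ell2_coeff x i))\<^sup>2) = (norm (?P F - x))\<^sup>2"
      using has_sum_norm_ell2 has_sum_unique by blast
    then show ?thesis by simp
  qed
  have "((\<lambda>F. sqrt ((norm x)\<^sup>2 - (\<Sum>i\<in>F. (cmod (ell2_coeff x i))\<^sup>2))) \<longlongrightarrow>
      sqrt ((norm x)\<^sup>2 - (norm x)\<^sup>2)) (finite_subsets_at_top UNIV)"
    using has_sum_norm_ell2[of x] unfolding has_sum_def by (intro tendsto_intros)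
  then have "((\<lambda>F. sqrt ((norm x)\<^sup>2 - (\<Sum>i\<in>F. (cmod (ell2_coeff x i))\<^sup>2))) \<longlongrightarrow> 0)
      (finite_subsets_at_top UNIV)" by simp
  then show "((\<lambda>F. norm (?P F - x)) \<longlongrightarrow> 0) (finite_subsets_at_top UNIV)"
    by (rule Lim_transform_eventually)
      (auto intro!: eventually_finite_subsets_at_top_weakI simp: norm)
qed

lemma ell2_linear_has_sum:
  fixes T :: "'i ell2 \<Rightarrow> 'b::complex_hilbert_space"
  assumes "bounded_linear T" "\<And>c x. T (c *\<^sub>C x) = c *\<^sub>C T x"
  shows "((\<lambda>i. ell2_coeff x i *\<^sub>C T (ell2_basis i)) has_sum T x) UNIV"
  using has_sum_bounded_linear[OF assms(1) ell2_has_sum, of x] by (simp add: o_def assms(2))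

lemma ell2_linear_eqI:
  fixes S T :: "'i ell2 \<Rightarrow> 'b::complex_hilbert_space"
  assumes "bounded_linear S" "\<And>c x. S (c *\<^sub>C x) = c *\<^sub>C S x"
    and "bounded_linear T" "\<And>c x. T (c *\<^sub>C x) = c *\<^sub>C T x"
    and "\<And>i. S (ell2_basis i) = T (ell2_basis i)"
  shows "S x = T x"
  using ell2_linear_has_sum[OF assms(1,2), of x] ell2_linear_has_sum[OF assms(3,4), of x]
  by (simp add: assms(5) has_sum_unique)

lemma ell2_clinear_eqI:
  fixes S T :: "'i ell2 \<Rightarrow> 'i ell2"
  assumes "bounded_clinear S" "bounded_clinear T"
    and "\<And>i. S (ell2_basis i) = T (ell2_basis i)"
  shows "S = T"
  by (rule ext, rule ell2_linear_eqI)
    (use assms in \<open>auto simp: bounded_clinear_def\<close>)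

lemma ell2_finite_approx:
  assumes "0 < e"
  obtains F where "finite F" "norm (x - (\<Sum>i\<in>F. ell2_coeff x i *\<^sub>C ell2_basis i)) < e"
proof -
  have "\<forall>\<^sub>F F in finite_subsets_at_top UNIV.
      dist (\<Sum>i\<in>F. ell2_coeff x i *\<^sub>C ell2_basis i) x < e"
    using ell2_has_sum[of x] assms unfolding has_sum_def tendsto_iff by blast
  then obtain F where "finite F" "dist (\<Sum>i\<in>F. ell2_coeff x i *\<^sub>C ell2_basis i) x < e"
    unfolding eventually_finite_subsets_at_top by blast
  then show ?thesis using that by (simp add: dist_norm norm_minus_commute)
qed

text \<open>A three-epsilon argument: the uniform bound carries convergence from the dense span of
  the basis to every vector. It serves for dilations as r tends to 1.\<close>

lemma bounded_clinear_tendsto_basis: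
  fixes L :: "'r \<Rightarrow> 'i ell2 \<Rightarrow> 'i ell2"
  assumes L: "\<forall>\<^sub>F r in F. bounded_clinear (L r)" "bounded_clinear T"
    and bound: "\<forall>\<^sub>F r in F. \<forall>x. norm (L r x) \<le> C * norm x"
    and basis: "\<And>i. ((\<lambda>r. L r (ell2_basis i)) \<longlongrightarrow> T (ell2_basis i)) F"
  shows "((\<lambda>r. L r x) \<longlongrightarrow> T x) F"
proof (rule tendstoI)
  fix e :: real assume "0 < e"
  \<comment> \<open>\<open>D\<close> has to dominate both the operators \<open>L r\<close> and the
    limit \<open>T\<close>; the summand 1 makes it positive, so that the approximation error can be
    chosen as \<open>e / (3 * D)\<close>.\<close>
  define D where "D = \<bar>C\<bar> + onorm T + 1"
  have D: "0 < D" "C \<le> D" "onorm T \<le> D"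
    using onorm_pos_le[OF bounded_clinear_linear[OF L(2)]] by (auto simp: D_def)
  from \<open>0 < e\<close> D obtain I where I: "finite I"
    "norm (x - (\<Sum>i\<in>I. ell2_coeff x i *\<^sub>C ell2_basis i)) < e / (3 * D)"
    by (rule_tac ell2_finite_approx[of "e / (3 * D)" x]) auto
  define y where "y = (\<Sum>i\<in>I. ell2_coeff x i *\<^sub>C ell2_basis i)"
  have y: "D * norm (x - y) \<le> e / 3" using I(2) D by (simp add: y_def field_simps)
  have sum: "A y = (\<Sum>i\<in>I. ell2_coeff x i *\<^sub>C A (ell2_basis i))" if "bounded_clinear A"
    for A :: "'i ell2 \<Rightarrow> 'i ell2"
    unfolding y_def by (simp add: bounded_clinear_sum[OF that] bounded_clinear_scaleC[OF that])
  have "((\<lambda>r. \<Sum>i\<in>I. ell2_coeff x i *\<^sub>C L r (ell2_basis i)) \<longlongrightarrow> T y) F"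
    unfolding sum[OF L(2)]
    by (intro tendsto_sum bounded_linear.tendsto[OF bounded_linear_scaleC] basis)
  moreover have "\<forall>\<^sub>F r in F. (\<Sum>i\<in>I. ell2_coeff x i *\<^sub>C L r (ell2_basis i)) = L r y"
    using L(1) by eventually_elim (rule sum[symmetric])
  ultimately have "((\<lambda>r. L r y) \<longlongrightarrow> T y) F" by (rule Lim_transform_eventually)
  then have "\<forall>\<^sub>F r in F. dist (L r y) (T y) < e / 3" using tendstoD[of _ _ _ "e / 3"] \<open>0 < e\<close> by simp
  with bound L(1) show "\<forall>\<^sub>F r in F. dist (L r x) (T x) < e"
  proof eventually_elim
    case (elim r)
    have "norm (L r (x - y)) \<le> D * norm (x - y)"
      using elim D by (meson mult_right_mono norm_ge_zero order_trans)
    moreover have "norm (T (x - y)) \<le> D * norm (x - y)"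
      using bounded_clinear_onorm[OF L(2), of "x - y"] D
      by (meson mult_right_mono norm_ge_zero order_trans)
    moreover have "L r x - T x = L r (x - y) + (L r y - T y) - T (x - y)"
      using elim by (simp add: bounded_clinear_diff L(2))
    then have "norm (L r x - T x) \<le> norm (L r (x - y)) + norm (L r y - T y) + norm (T (x - y))"
  using norm_triangle_ineq4[of "L r (x - y) + (L r y - T y)" "T (x - y)"]
        norm_triangle_ineq[of "L r (x - y)" "L r y - T y"] by simp
    ultimately show ?case using elim y by (simp add: dist_norm)
  qed
qed

lemma cmod_cinner_le_onorm:
  assumes "bounded_clinear T"
  shows "cmod (cinner (T x) y) \<le> onorm T * norm x * norm y"
  using cinner_norm_ineq[of "T x" y] mult_right_mono[OF bounded_clinear_onorm[OF assms, of x]]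
  by (meson norm_ge_zero order_trans)

text \<open>\<open>cadjoint\<close> is a definite description, so this identity needs an adjoint to
  exist. Testing on basis vectors forces the coordinates of the candidate; the work is to show that
  they are square summable.\<close>

lemma cinner_cadjoint:
  fixes T :: "'i ell2 \<Rightarrow> 'i ell2"
  assumes T: "bounded_clinear T"
  shows "cinner (T x) y = cinner x (cadjoint T y)"
proof -
  define z where "z y i = cinner y (T (ell2_basis i))" for y i
  have z: "square_summable (z y)" for y
  proof (rule square_summableI_bound)
    fix F :: "'i set" assume F: "finite F"
    \<comment> \<open>With \<open>u\<close> the truncated candidate, the inner product of
      \<open>y\<close> with \<open>T u\<close> is \<open>s\<close>, and so is the squared norm of
      \<open>u\<close>. Hence \<open>s\<close> is at most \<open>norm y * onorm T\<close> times its
      own square root, a bound independent of \<open>F\<close>.\<close>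
    define s where "s = (\<Sum>i\<in>F. (cmod (z y i))\<^sup>2)"
    define u where "u = (\<Sum>i\<in>F. z y i *\<^sub>C ell2_basis i)"
    have s0: "0 \<le> s" by (simp add: s_def sum_nonneg)
    have "cinner y (T u) = of_real s"
      unfolding u_def s_def bounded_clinear_sum[OF T] cinner_sum_right bounded_clinear_scaleC[OF T]
        cinner_scaleC_right
      by (simp add: z_def mult.commute complex_norm_square flip: of_real_power)
    then have "s = cmod (cinner y (T u))" using s0 by simp
    also have "\<dots> \<le> norm y * (onorm T * norm u)"
      using cinner_norm_ineq[of y "T u"] mult_left_mono[OF bounded_clinear_onorm[OF T, of u]]
      by (meson norm_ge_zero order_trans)
    finally have 1: "s \<le> norm y * onorm T * norm u" by (simp add: mult.assoc)
    have "cinner u u = (\<Sum>i\<in>F. cinner u (z y i *\<^sub>C ell2_basis i))"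
      unfolding u_def by (rule cinner_sum_right)
    also have "\<dots> = (\<Sum>i\<in>F. of_real ((cmod (z y i))\<^sup>2))"
      using F by (intro sum.cong refl)
        (auto simp: cinner_scaleC_right cinner_basis_right u_def ell2_coeff_sum ell2_coeff_basis
          if_distrib mult.commute complex_norm_square cong: if_cong simp flip: of_real_power)
    finally have "(norm u)\<^sup>2 = s"
      unfolding cinner_self s_def by (metis of_real_eq_iff of_real_sum)
    then have "norm u = sqrt s" by (metis norm_ge_zero real_sqrt_abs real_sqrt_unique)
    with 1 s0 have "s \<le> norm y * onorm T * sqrt s" by simp
    then have "sqrt s * sqrt s \<le> (norm y * onorm T) * sqrt s" using s0 by simp
    moreover have "0 \<le> norm y * onorm T"
      by (intro mult_nonneg_nonneg onorm_pos_le bounded_clinear_linear T) simp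
    ultimately have "sqrt s \<le> norm y * onorm T"
      using s0 mult_right_le_imp_le[of "sqrt s" "sqrt s" "norm y * onorm T"] by (cases "s = 0") auto
    then show "s \<le> (norm y * onorm T)\<^sup>2" using s0 by (simp add: sqrt_le_D)
  qed
  have "cinner (T x) y = cinner x (Abs_ell2 (z y))" for x y
  proof -
    have "((\<lambda>i. ell2_coeff x i *\<^sub>C cinner (T (ell2_basis i)) y) has_sum cinner (T x) y) UNIV"
      by (rule ell2_linear_has_sum)
        (use T in \<open>simp_all add: bounded_linear_compose[OF bounded_linear_cinner_left]
          bounded_clinear_def cinner_scaleC_left\<close>)
    also have "(\<lambda>i. ell2_coeff x i *\<^sub>C cinner (T (ell2_basis i)) y)
        = (\<lambda>i. ell2_coeff x i * cnj (ell2_coeff (Abs_ell2 (z y)) i))"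
      by (simp add: z z_def flip: cinner_commute)
    finally show ?thesis using has_sum_cinner_ell2 has_sum_unique by blast
  qed
  then show ?thesis by (subst cadjoint_eqI[of T "\<lambda>y. Abs_ell2 (z y)"]) auto
qed

lemma bounded_clinear_cadjoint:
  fixes T :: "'i ell2 \<Rightarrow> 'i ell2"
  assumes T: "bounded_clinear T"
  shows "bounded_clinear (cadjoint T)"
proof (rule bounded_clinearI)
  show "cadjoint T (x + y) = cadjoint T x + cadjoint T y" for x y
    by (rule cinner_eqI_right) (simp add: cinner_add_right flip: cinner_cadjoint[OF T])
  show "cadjoint T (c *\<^sub>C x) = c *\<^sub>C cadjoint T x" for c x
    by (rule cinner_eqI_right) (simp add: cinner_scaleC_right flip: cinner_cadjoint[OF T])
  fix x
  have "(norm (cadjoint T x))\<^sup>2 = cmod (cinner (cadjoint T x) (cadjoint T x))"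
    by (simp add: cinner_self norm_power)
  also have "\<dots> = cmod (cinner (T (cadjoint T x)) x)" by (simp add: cinner_cadjoint[OF T])
  also have "\<dots> \<le> (onorm T * norm (cadjoint T x)) * norm x"
    by (rule cmod_cinner_le_onorm[OF T])
  finally have "norm (cadjoint T x) * norm (cadjoint T x) \<le> onorm T * norm x * norm (cadjoint T x)"
    by (simp add: power2_eq_square ac_simps)
  then show "norm (cadjoint T x) \<le> onorm T * norm x"
    using onorm_pos_le[OF bounded_clinear_linear[OF T]]
    by (cases "norm (cadjoint T x) = 0") (auto dest!: mult_right_le_imp_le)
qed

text \<open>Duality: pairing the sum with itself moves each \<open>X i\<close> to the other side,
  and Cauchy-Schwarz leaves the sum of the squared norms of the adjoint images of \<open>y\<close>.
  This sum is a quadratic form of the operator whose norm defines \<open>row_norm\<close>.\<close>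

lemma row_norm_bound:
  fixes X :: "'n::finite \<Rightarrow> 'i ell2 \<Rightarrow> 'i ell2"
  assumes X: "bounded_tuple X"
  shows "norm (\<Sum>i\<in>UNIV. X i (h i)) \<le> row_norm X * sqrt (\<Sum>i\<in>UNIV. (norm (h i))\<^sup>2)"
proof -
  define A where "A y = (\<Sum>i\<in>UNIV. X i (cadjoint (X i) y))" for y
  have Xi: "bounded_clinear (X i)" for i using X by (simp add: bounded_tuple_def)
  have A: "bounded_clinear A"
    unfolding A_def by (intro bounded_clinear_setsum
        bounded_clinear_compose[OF Xi bounded_clinear_cadjoint[OF Xi], unfolded o_def])
  have rn: "row_norm X = sqrt (onorm A)" by (simp add: row_norm_def A_def[abs_def])
  define y where "y = (\<Sum>i\<in>UNIV. X i (h i))"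
  have "of_real (\<Sum>i\<in>UNIV. (norm (cadjoint (X i) y))\<^sup>2) = cinner (A y) y"
    by (simp add: A_def cinner_sum_left cinner_cadjoint[OF Xi] cinner_self)
  then have "cmod (cinner (A y) y) = \<bar>\<Sum>i\<in>UNIV. (norm (cadjoint (X i) y))\<^sup>2\<bar>"
    by (metis norm_of_real)
  then have "(\<Sum>i\<in>UNIV. (norm (cadjoint (X i) y))\<^sup>2) = cmod (cinner (A y) y)"
    by (simp add: sum_nonneg)
  also have "\<dots> \<le> onorm A * norm y * norm y"
    by (rule cmod_cinner_le_onorm[OF A])
  finally have 1: "(\<Sum>i\<in>UNIV. (norm (cadjoint (X i) y))\<^sup>2) \<le> onorm A * (norm y)\<^sup>2"
    by (simp add: power2_eq_square)
  have "(norm y)\<^sup>2 = cmod (cinner (\<Sum>i\<in>UNIV. X i (h i)) y)"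
    by (simp add: cinner_self norm_power flip: y_def)
  also have "\<dots> = cmod (\<Sum>i\<in>UNIV. cinner (h i) (cadjoint (X i) y))"
    by (simp add: cinner_sum_left cinner_cadjoint[OF Xi])
  also have "\<dots> \<le> (\<Sum>i\<in>UNIV. norm (h i) * norm (cadjoint (X i) y))"
    by (intro sum_norm_le cinner_norm_ineq)
  also have "\<dots> \<le> L2_set (\<lambda>i. norm (h i)) UNIV * L2_set (\<lambda>i. norm (cadjoint (X i) y)) UNIV"
    using L2_set_mult_ineq[of "\<lambda>i. norm (h i)" "\<lambda>i. norm (cadjoint (X i) y)" UNIV] by simp
  also have "\<dots> \<le> sqrt (\<Sum>i\<in>UNIV. (norm (h i))\<^sup>2) * (row_norm X * norm y)"
    unfolding L2_set_def rn
    using real_sqrt_le_mono[OF 1] by (intro mult_left_mono) (auto simp: real_sqrt_mult intro: sum_nonneg)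
  finally have "norm y * norm y \<le> row_norm X * sqrt (\<Sum>i\<in>UNIV. (norm (h i))\<^sup>2) * norm y"
    by (simp add: power2_eq_square ac_simps)
  moreover have "0 \<le> row_norm X * sqrt (\<Sum>i\<in>UNIV. (norm (h i))\<^sup>2)"
    unfolding rn using onorm_pos_le[OF bounded_clinear_linear[OF A]] by (simp add: sum_nonneg)
  ultimately show ?thesis
    unfolding y_def[symmetric] by (cases "norm y = 0") (auto dest!: mult_right_le_imp_le)
qed


subclass (in complex_hilbert_space) banach ..

section \<open>Noncommutative power series and their evaluation on operator tuples\<close>

section \<open>Words and noncommutative power series\<close>

lemma finite_words [simp]: "finite {\<alpha> :: 'n::finite list. length \<alpha> = k}"
  using finite_lists_length_eq[of "UNIV :: 'n set" k] by simp

lemma sum_words_Suc: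
  "(\<Sum>\<alpha> :: 'n::finite list | length \<alpha> = Suc k. F \<alpha>) =
    (\<Sum>i\<in>UNIV. \<Sum>\<alpha> | length \<alpha> = k. F (i # \<alpha>))"
  unfolding sum.cartesian_product
  by (rule sum.reindex_bij_witness[of _ "\<lambda>(i, \<alpha>). i # \<alpha>" "\<lambda>\<alpha>. (hd \<alpha>, tl \<alpha>)"])
    (auto simp: length_Suc_conv)

lemma sum_words_prod_list:
  fixes a :: "'n::finite \<Rightarrow> 'a::comm_semiring_1"
  shows "(\<Sum>\<alpha> | length \<alpha> = k. prod_list (map a \<alpha>)) = (\<Sum>i\<in>UNIV. a i) ^ k"
proof (induction k)
  case (Suc k)
  then show ?case by (simp add: sum_words_Suc sum_distrib_right flip: sum_distrib_left)
qed simp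

lemma sum_words_less:
  "(\<Sum>k<N. \<Sum>\<alpha> :: 'n::finite list | length \<alpha> = k. F \<alpha>) = sum F {\<alpha>. length \<alpha> < N}"
proof -
  have "{\<alpha> :: 'n list. length \<alpha> < N} = (\<Union>k\<in>{..<N}. {\<alpha>. length \<alpha> = k})" by auto
  then show ?thesis by (subst sum.UNION_disjoint[symmetric]) auto
qed

lemma finite_words_less [simp]: "finite {\<alpha> :: 'n::finite list. length \<alpha> < N}"
proof -
  have "{\<alpha> :: 'n list. length \<alpha> < N} = (\<Union>k\<in>{..<N}. {\<alpha>. length \<alpha> = k})" by auto
  then show ?thesis by simp
qed

lemma finite_words_subset:
  assumes "finite (F :: 'n list set)"
  obtains N where "F \<subseteq> {\<alpha>. length \<alpha> < N}"
proof
  show "F \<subseteq> {\<alpha>. length \<alpha> < Suc (Max (length ` F))}"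
    using assms by (auto simp: less_Suc_eq_le)
qed

lemma has_sum_words_sums:
  fixes F :: "'n::finite list \<Rightarrow> 'a::{comm_monoid_add,topological_space}"
  assumes "(F has_sum s) UNIV"
  shows "(\<lambda>k. \<Sum>\<alpha> | length \<alpha> = k. F \<alpha>) sums s"
  unfolding sums_def sum_words_less
proof (rule filterlim_compose[OF assms[unfolded has_sum_def]])
  show "filterlim (\<lambda>N. {\<alpha> :: 'n list. length \<alpha> < N}) (finite_subsets_at_top UNIV) sequentially"
    unfolding filterlim_finite_subsets_at_top
  proof (intro allI impI)
    fix X :: "'n list set" assume "finite X \<and> X \<subseteq> UNIV"
    then obtain N where "X \<subseteq> {\<alpha>. length \<alpha> < N}" using finite_words_subset by blast
    then show "\<forall>\<^sub>F N in sequentially. finite {\<alpha> :: 'n list. length \<alpha> < N} \<and>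
        X \<subseteq> {\<alpha>. length \<alpha> < N} \<and> {\<alpha>. length \<alpha> < N} \<subseteq> (UNIV :: 'n list set)"
      unfolding eventually_sequentially by (intro exI[of _ N]) fastforce
  qed
qed

lemma ncps_mult_Nil [simp]: "ncps_mult p q [] = p [] * q []"
  by (simp add: fun_eq_iff ncps_mult_def)

text \<open>The cut before the first letter gives the first summand; every other cut gives a cut of
  \<open>w\<close> for the left quotient of \<open>p\<close> by \<open>a\<close>. This turns the
  ring laws into inductions on the word, with \<open>p\<close> arbitrary.\<close>

lemma ncps_mult_Cons:
  "ncps_mult p q (a # w) = p [] * q (a # w) + ncps_mult (\<lambda>u. p (a # u)) q w"
  by (simp add: ncps_mult_def sum.atMost_Suc_shift del: sum.atMost_Suc)

lemma ncps_mult_add_left: "ncps_mult (\<lambda>u. p u + q u) r = (\<lambda>w. ncps_mult p r w + ncps_mult q r w)"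
  by (simp add: fun_eq_iff ncps_mult_def distrib_right sum.distrib)

lemma ncps_mult_cmult_left: "ncps_mult (\<lambda>u. c * p u) r = (\<lambda>w. c * ncps_mult p r w)"
  by (simp add: fun_eq_iff ncps_mult_def sum_distrib_left mult.assoc)

lemma ncps_mult_sum_left:
  "ncps_mult (\<lambda>u. \<Sum>i\<in>A. p i u) r = (\<lambda>w. \<Sum>i\<in>A. ncps_mult (p i) r w)"
  unfolding ncps_mult_def sum_distrib_right by (rule ext, rule sum.swap)

lemma ncps_mult_cmult_right: "ncps_mult r (\<lambda>u. c * p u) = (\<lambda>w. c * ncps_mult r p w)"
  by (simp add: fun_eq_iff ncps_mult_def sum_distrib_left mult.left_commute)

lemma ncps_mult_zero_left [simp]: "ncps_mult (\<lambda>_. 0) r = (\<lambda>_. 0)"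
  by (simp add: fun_eq_iff ncps_mult_def)

lemma ncps_mult_assoc: "ncps_mult (ncps_mult p q) r = ncps_mult p (ncps_mult q r)"
proof
  show "ncps_mult (ncps_mult p q) r w = ncps_mult p (ncps_mult q r) w" for w
    by (induction w arbitrary: p)
      (simp_all add: ncps_mult_Cons ncps_mult_add_left ncps_mult_cmult_left algebra_simps)
qed

lemma ncps_mult_one_left [simp]: "ncps_mult ncps_one q = q"
proof
  show "ncps_mult ncps_one q w = q w" for w
    by (cases w) (simp_all add: ncps_mult_Cons ncps_one_def)
qed

lemma ncps_mult_one_right [simp]: "ncps_mult p ncps_one = p"
proof
  show "ncps_mult p ncps_one w = p w" for w
    by (induction w arbitrary: p) (simp_all add: ncps_mult_Cons ncps_one_def)
qed

lemma ncps_mult_var_left: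
  "ncps_mult (ncps_var j) q w = (case w of [] \<Rightarrow> 0 | i # u \<Rightarrow> if i = j then q u else 0)"
proof (cases w)
  case (Cons i u)
  have "(\<lambda>u. ncps_var j (i # u)) = (if i = j then ncps_one else (\<lambda>_. 0))"
    by (auto simp: ncps_var_def ncps_one_def)
  then show ?thesis using Cons by (simp add: ncps_mult_Cons ncps_var_def)
qed (simp add: ncps_var_def)

lemma ell2_coeff_basis_Nil: "ell2_coeff (ell2_basis []) = ncps_one"
  by (auto simp: ell2_coeff_basis ncps_one_def)

lemma ell2_coeff_basis_Cons:
  "ell2_coeff (ell2_basis (j # \<beta>)) = ncps_mult (ncps_var j) (ell2_coeff (ell2_basis \<beta>))"
  by (auto simp: ell2_coeff_basis ncps_mult_var_left split: list.splits)

text \<open>Right multiplication by a word only relocates coefficients along the injection that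
  appends it. This lemma and the next one turn sums over all words into sums reindexed along that
  injection.\<close>

lemma ncps_mult_basis_append: "ncps_mult c (ell2_coeff (ell2_basis \<beta>)) (\<alpha> @ \<beta>) = c \<alpha>"
proof (induction \<alpha> arbitrary: c)
  case Nil
  \<comment> \<open>At the word \<open>\<beta>\<close> itself only the cut at 0 survives, since
    every other suffix is shorter than \<open>\<beta>\<close>.\<close>
  have "ncps_mult c (ell2_coeff (ell2_basis \<beta>)) \<beta>
      = (\<Sum>k\<le>length \<beta>. if k = 0 then c [] else 0)"
    unfolding ncps_mult_def
    by (intro sum.cong refl) (auto simp: ell2_coeff_basis dest: arg_cong[of _ _ length])
  then show ?case by simp
next
  case (Cons a \<alpha>)
  have "length (a # \<alpha> @ \<beta>) \<noteq> length \<beta>" by simp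
  then have "a # \<alpha> @ \<beta> \<noteq> \<beta>" by metis
  then show ?case using Cons by (simp add: ncps_mult_Cons ell2_coeff_basis)
qed

lemma ncps_mult_basis_not_append:
  assumes "w \<notin> range (\<lambda>\<alpha>. \<alpha> @ \<beta>)"
  shows "ncps_mult c (ell2_coeff (ell2_basis \<beta>)) w = 0"
  unfolding ncps_mult_def
proof (intro sum.neutral ballI)
  fix k assume "k \<in> {..length w}"
  have "drop k w \<noteq> \<beta>" using assms by (metis append_take_drop_id rangeI)
  then show "c (take k w) * ell2_coeff (ell2_basis \<beta>) (drop k w) = 0"
    by (simp add: ell2_coeff_basis)
qed


section \<open>Evaluation of power series on tuples of operators\<close>

text \<open>Abel's theorem by summation by parts: the deviation from \<open>s\<close> is
  \<open>1 - r\<close> times a power series in the remainders. Early remainders are merely bounded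
  and lose against \<open>1 - r\<close>; late ones are small, and \<open>1 - r\<close> cancels their
  geometric sum.\<close>

lemma Abel_limit:
  fixes a :: "nat \<Rightarrow> 'a::banach"
  assumes "a sums s"
  shows "((\<lambda>r. \<Sum>k. r ^ k *\<^sub>R a k) \<longlongrightarrow> s) (at_left 1)"
proof (rule tendstoI)
  fix e :: real assume e: "0 < e"
  define b where "b n = (\<Sum>k<n. a k) - s" for n
  have b0: "b \<longlonglongrightarrow> 0" unfolding b_def using assms by (simp add: sums_def LIM_zero_iff)
  then obtain B where B: "0 < B" "\<And>n. norm (b n) \<le> B"
    using convergent_imp_Bseq[of b] unfolding convergent_def Bseq_def by blast
  obtain N where N: "\<And>n. N \<le> n \<Longrightarrow> norm (b n) < e / 2"
    using b0 e unfolding LIMSEQ_iff by (metis diff_zero half_gt_zero)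
  have est: "dist (\<Sum>k. r ^ k *\<^sub>R a k) s \<le> (1 - r) * (N * B) + e / 2" if r: "0 < r" "r < 1" for r
  proof -
    have bd: "norm (r ^ k *\<^sub>R b (Suc k)) \<le> (if k < N then B else 0) + e / 2 * r ^ k" for k
    proof -
      have "r ^ k * norm (b (Suc k)) \<le> r ^ k * ((if k < N then B else 0) + e / 2)"
        using N[of "Suc k"] B e r by (intro mult_left_mono) (auto simp: less_imp_le add_increasing2)
      also have "\<dots> \<le> (if k < N then B else 0) + e / 2 * r ^ k"
        using r B by (auto simp: algebra_simps mult_left_le_one_le power_le_one)
      finally show ?thesis using r by simp
    qed
    have sB: "(\<lambda>k. (if k < N then B else 0) + e / 2 * r ^ k) sums (N * B + e / 2 * (1 / (1 - r)))"
      using r by (intro sums_add sums_mult geometric_sums)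
        (use sums_If_finite_set[of "{..<N}" "\<lambda>_. B"] in simp_all)
    have sn: "summable (\<lambda>k. norm (r ^ k *\<^sub>R b (Suc k)))"
      by (rule summable_comparison_test'[OF sums_summable[OF sB], of 0]) (simp only: real_norm_def abs_norm_cancel bd)
    \<comment> \<open>Summation by parts; the boundary term at 0 supplies the limit because
      \<open>b 0 = - s\<close>.\<close>
    have eq: "(\<Sum>k<n. r ^ k *\<^sub>R a k) =
        (\<Sum>k<n. (1 - r) *\<^sub>R (r ^ k *\<^sub>R b (Suc k))) + r ^ n *\<^sub>R b n - b 0" for n
    proof (induction n)
      case (Suc n)
      have "b (Suc n) = b n + a n" by (simp add: b_def)
      then show ?case using Suc by (simp add: algebra_simps)
    qed simp
    have lim: "(\<lambda>n. \<Sum>k<n. (1 - r) *\<^sub>R (r ^ k *\<^sub>R b (Suc k))) \<longlonglongrightarrow>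
        (1 - r) *\<^sub>R (\<Sum>k. r ^ k *\<^sub>R b (Suc k))"
      using sums_scaleR_right[OF summable_sums[OF summable_norm_cancel[OF sn]]]
      unfolding sums_def .
    have "(\<lambda>n. (\<Sum>k<n. (1 - r) *\<^sub>R (r ^ k *\<^sub>R b (Suc k))) + r ^ n *\<^sub>R b n - b 0) \<longlonglongrightarrow>
        (1 - r) *\<^sub>R (\<Sum>k. r ^ k *\<^sub>R b (Suc k)) + 0 *\<^sub>R 0 - b 0"
      by (intro tendsto_diff tendsto_add tendsto_scaleR lim tendsto_const b0 LIMSEQ_power_zero)
        (use r in simp)
    then have "(\<lambda>k. r ^ k *\<^sub>R a k) sums ((1 - r) *\<^sub>R (\<Sum>k. r ^ k *\<^sub>R b (Suc k)) + s)"
      unfolding sums_def eq by (simp add: b_def)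
    then have "dist (\<Sum>k. r ^ k *\<^sub>R a k) s = (1 - r) * norm (\<Sum>k. r ^ k *\<^sub>R b (Suc k))"
      using r by (simp add: sums_unique[symmetric] dist_norm)
    also have "\<dots> \<le> (1 - r) * (N * B + e / 2 * (1 / (1 - r)))"
    proof (rule mult_left_mono)
      have "norm (\<Sum>k. r ^ k *\<^sub>R b (Suc k)) \<le> (\<Sum>k. norm (r ^ k *\<^sub>R b (Suc k)))"
        by (rule summable_norm[OF sn])
      also have "\<dots> \<le> (\<Sum>k. (if k < N then B else 0) + e / 2 * r ^ k)"
        by (rule suminf_le[OF bd sn sums_summable[OF sB]])
      finally show "norm (\<Sum>k. r ^ k *\<^sub>R b (Suc k)) \<le> N * B + e / 2 * (1 / (1 - r))"
        using sums_unique[OF sB] by simp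
    qed (use r in simp)
    also have "\<dots> = (1 - r) * (N * B) + e / 2" using r by (simp add: field_simps)
    finally show ?thesis .
  qed
  have "((\<lambda>r. (1 - r) * (N * B) + e / 2) \<longlongrightarrow> (1 - 1) * (N * B) + e / 2) (at_left 1)"
    by (intro tendsto_intros)
  then have "\<forall>\<^sub>F r in at_left 1. (1 - r) * (N * B) + e / 2 < e"
    by (rule order_tendstoD(2)) (use e in simp)
  moreover have "\<forall>\<^sub>F r :: real in at_left 1. 0 < r \<and> r < 1"
    by (rule eventually_at_leftI[of 0]) auto
  ultimately show "\<forall>\<^sub>F r in at_left 1. dist (\<Sum>k. r ^ k *\<^sub>R a k) s < e"
    by eventually_elim (use est in fastforce)
qed

lemma bounded_tuple_scale: "bounded_tuple X \<Longrightarrow> bounded_tuple (scale_tuple r X)"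
  unfolding bounded_tuple_def scale_tuple_def scaleR_scaleC
  by (intro allI bounded_clinear_cmult) blast

lemma op_word_scale_tuple:
  assumes "bounded_tuple X"
  shows "op_word (scale_tuple r X) \<alpha> h = r ^ length \<alpha> *\<^sub>R op_word X \<alpha> h"
  by (induction \<alpha>)
    (use assms in \<open>simp_all add: scale_tuple_def bounded_tuple_def bounded_clinear_def linear_simps\<close>)

lemma hom_part_scale_tuple:
  assumes "bounded_tuple X"
  shows "hom_part c (scale_tuple r X) k h = r ^ k *\<^sub>R hom_part c X k h"
  by (simp add: hom_part_def op_word_scale_tuple[OF assms] scaleR_scaleC
      scaleC_sum_right scaleC_scaleC mult.commute)

lemma ev_sum_scale_tuple_tendsto:
  assumes "bounded_tuple X" "(\<lambda>k. hom_part c X k h) sums s"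
  shows "((\<lambda>r. ev_sum c (scale_tuple r X) h) \<longlongrightarrow> s) (at_left 1)"
  unfolding ev_sum_def hom_part_scale_tuple[OF assms(1)] by (rule Abel_limit[OF assms(2)])

lemma sot_convergent_sums:
  "sot_convergent c X \<Longrightarrow> (\<lambda>k. hom_part c X k h) sums ev_sum c X h"
  unfolding sot_convergent_def ev_sum_def by (metis sums_summable summable_sums)

lemma sot_convergent_bounded: "sot_convergent c X \<Longrightarrow> bounded_clinear (ev_sum c X)"
proof -
  assume "sot_convergent c X"
  then obtain T where "bounded_clinear T" "\<And>h. (\<lambda>k. hom_part c X k h) sums T h"
    unfolding sot_convergent_def by blast
  then have "ev_sum c X = T" by (intro ext) (simp add: ev_sum_def sums_unique[symmetric])
  then show ?thesis by (simp add: \<open>bounded_clinear T\<close>)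
qed

lemma bounded_linear_remainder:
  assumes "bounded_tuple X" "bounded_clinear T"
  shows "bounded_linear (\<lambda>h. (\<Sum>k<N. hom_part c X k h) - T h)"
proof (rule bounded_clinear_linear, rule bounded_clinear_minus[OF _ assms(2)])
  show "bounded_clinear (\<lambda>h. \<Sum>k<N. hom_part c X k h)"
    by (rule bounded_clinear_setsum) (rule bounded_clinear_hom_part[OF assms(1)])
qed

lemma norm_convergent_imp_sot:
  assumes X: "bounded_tuple X" and c: "norm_convergent c X"
  shows "sot_convergent c X"
proof -
  obtain T where T: "bounded_clinear T"
    "(\<lambda>N. onorm (\<lambda>h. (\<Sum>k<N. hom_part c X k h) - T h)) \<longlonglongrightarrow> 0"
    using c unfolding norm_convergent_def by blast
  have "(\<lambda>N. \<Sum>k<N. hom_part c X k h) \<longlonglongrightarrow> T h" for h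
  proof (rule LIM_zero_cancel, rule tendsto_norm_zero_cancel, rule tendsto_sandwich[OF _ _ tendsto_const])
    show "(\<lambda>N. onorm (\<lambda>h. (\<Sum>k<N. hom_part c X k h) - T h) * norm h) \<longlonglongrightarrow> 0"
      using tendsto_mult_right[OF T(2), of "norm h"] by simp
    show "\<forall>\<^sub>F N in sequentially. norm ((\<Sum>k<N. hom_part c X k h) - T h) \<le>
        onorm (\<lambda>h. (\<Sum>k<N. hom_part c X k h) - T h) * norm h"
      by (intro always_eventually allI onorm bounded_linear_remainder X T)
  qed simp
  then show ?thesis unfolding sot_convergent_def sums_def using T(1) by blast
qed

text \<open>The Weierstrass test in operator norm. The tail estimate serves twice: at
  \<open>N = 0\<close> it bounds the limit operator, and for growing \<open>N\<close> it gives norm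
  convergence.\<close>

lemma norm_convergent_geometric:
  fixes X :: "'n::finite \<Rightarrow> 'h::complex_hilbert_space \<Rightarrow> 'h"
  assumes X: "bounded_tuple X" and \<rho>: "0 \<le> \<rho>" "\<rho> < 1" "0 \<le> B"
    and bound: "\<And>k h. norm (hom_part c X k h) \<le> B * \<rho> ^ k * norm h"
  shows "norm_convergent c X"
proof -
  define T where "T h = (\<Sum>k. hom_part c X k h)" for h
  have geo: "summable (\<lambda>k. B * \<rho> ^ k * norm h)" for h :: 'h
    using \<rho> by (intro summable_mult2 summable_mult summable_geometric) simp
  have sn: "summable (\<lambda>k. norm (hom_part c X k h))" for h
    by (rule summable_comparison_test'[OF geo[of h], of 0]) (simp only: real_norm_def abs_norm_cancel bound)
  have s: "(\<lambda>k. hom_part c X k h) sums T h" for h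
    unfolding T_def by (rule summable_sums[OF summable_norm_cancel[OF sn]])
  have tail: "norm (T h - (\<Sum>k<N. hom_part c X k h)) \<le> (\<rho> ^ N * (B / (1 - \<rho>))) * norm h" for h N
  proof -
    have "T h - (\<Sum>k<N. hom_part c X k h) = (\<Sum>k. hom_part c X (k + N) h)"
      unfolding T_def by (subst suminf_minus_initial_segment[OF sums_summable[OF s]]) simp
    also have "norm \<dots> \<le> (\<Sum>k. norm (hom_part c X (k + N) h))"
      by (rule summable_norm) (use sn in \<open>simp add: summable_iff_shift[of "\<lambda>k. norm (hom_part c X k h)"]\<close>)
    also have "\<dots> \<le> (\<Sum>k. \<rho> ^ N * (B * \<rho> ^ k * norm h))"
    proof (rule suminf_le)
      show "norm (hom_part c X (k + N) h) \<le> \<rho> ^ N * (B * \<rho> ^ k * norm h)" for k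
        using bound[of "k + N" h] by (simp add: power_add ac_simps)
      show "summable (\<lambda>k. norm (hom_part c X (k + N) h))"
        using sn by (simp add: summable_iff_shift[of "\<lambda>k. norm (hom_part c X k h)"])
    qed (rule summable_mult[OF geo])
    also have "\<dots> = (\<rho> ^ N * (B / (1 - \<rho>))) * norm h"
      using \<rho> sums_mult[OF sums_mult2[OF sums_mult[OF geometric_sums[of \<rho>], of B], of "norm h"], of "\<rho> ^ N"]
      by (simp add: sums_unique[symmetric])
    finally show ?thesis .
  qed
  have T: "bounded_clinear T"
  proof (rule bounded_clinearI)
    show "T (x + y) = T x + T y" for x y
      using sums_add[OF s[of x] s[of y]] s[of "x + y"]
      by (simp add: bounded_clinear_add[OF bounded_clinear_hom_part[OF X]] sums_unique2)
    show "T (a *\<^sub>C x) = a *\<^sub>C T x" for a x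
      using bounded_linear.sums[OF bounded_linear_scaleC s[of x], of a] s[of "a *\<^sub>C x"]
      by (simp add: bounded_clinear_scaleC[OF bounded_clinear_hom_part[OF X]] sums_unique2)
    show "norm (T x) \<le> (B / (1 - \<rho>)) * norm x" for x using tail[of x 0] by simp
  qed
  have "(\<lambda>N. onorm (\<lambda>h. (\<Sum>k<N. hom_part c X k h) - T h)) \<longlonglongrightarrow> 0"
  proof (rule tendsto_sandwich[OF _ _ tendsto_const])
    show "(\<lambda>N. \<rho> ^ N * (B / (1 - \<rho>))) \<longlonglongrightarrow> 0"
      using tendsto_mult_right[OF LIMSEQ_power_zero[of \<rho>], of "B / (1 - \<rho>)"] \<rho> by simp
    show "\<forall>\<^sub>F N in sequentially. 0 \<le> onorm (\<lambda>h. (\<Sum>k<N. hom_part c X k h) - T h)"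
      using onorm_pos_le[OF bounded_linear_remainder[OF X T]] by simp
    show "\<forall>\<^sub>F N in sequentially. onorm (\<lambda>h. (\<Sum>k<N. hom_part c X k h) - T h) \<le> \<rho> ^ N * (B / (1 - \<rho>))"
    proof (rule always_eventually, rule allI, rule onorm_bound)
      show "0 \<le> \<rho> ^ N * (B / (1 - \<rho>))" for N using \<rho> by simp
      show "norm ((\<Sum>k<N. hom_part c X k h) - T h) \<le> \<rho> ^ N * (B / (1 - \<rho>)) * norm h" for N h
        using tail[of h N] by (simp add: norm_minus_commute)
    qed
  qed
  with T show ?thesis unfolding norm_convergent_def by blast
qed

text \<open>The row operator has norm at most \<open>\<rho>\<close>, expressed on vectors and
  without adjoints, so that the bound iterates over words and rescales directly.\<close>

definition row_bounded :: "real \<Rightarrow> ('n::finite \<Rightarrow> 'h::complex_hilbert_space \<Rightarrow> 'h) \<Rightarrow> bool" where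
  "row_bounded \<rho> X \<longleftrightarrow> bounded_tuple X \<and> 0 \<le> \<rho> \<and>
     (\<forall>h. norm (\<Sum>i\<in>UNIV. X i (h i)) \<le> \<rho> * sqrt (\<Sum>i\<in>UNIV. (norm (h i))\<^sup>2))"

text \<open>The row of all words of length \<open>k\<close> is the \<open>k\<close>-fold iterate of
  the row \<open>X\<close>: splitting off the first letter applies the bound once to the outer row
  and the induction hypothesis to each entry. This is why square summable coefficients suffice for
  convergence on strict row contractions.\<close>

lemma norm_op_word_sum_le:
  assumes X: "row_bounded \<rho> X"
  shows "norm (\<Sum>\<alpha> | length \<alpha> = k. op_word X \<alpha> (h \<alpha>)) \<le>
    \<rho> ^ k * sqrt (\<Sum>\<alpha> | length \<alpha> = k. (norm (h \<alpha>))\<^sup>2)"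
proof (induction k arbitrary: h)
  case (Suc k)
  have Xi: "bounded_clinear (X i)" for i using X by (simp add: row_bounded_def bounded_tuple_def)
  have \<rho>: "0 \<le> \<rho>" using X by (simp add: row_bounded_def)
  have "(\<Sum>\<alpha> | length \<alpha> = Suc k. op_word X \<alpha> (h \<alpha>)) =
      (\<Sum>i\<in>UNIV. X i (\<Sum>\<alpha> | length \<alpha> = k. op_word X \<alpha> (h (i # \<alpha>))))"
    by (simp add: sum_words_Suc bounded_clinear_sum[OF Xi])
  also have "norm \<dots> \<le> \<rho> * sqrt (\<Sum>i\<in>UNIV. (norm (\<Sum>\<alpha> | length \<alpha> = k. op_word X \<alpha> (h (i # \<alpha>))))\<^sup>2)"
    using X by (simp add: row_bounded_def)
  also have "\<dots> \<le> \<rho> * sqrt (\<Sum>i\<in>UNIV. (\<rho> ^ k * sqrt (\<Sum>\<alpha> | length \<alpha> = k. (norm (h (i # \<alpha>)))\<^sup>2))\<^sup>2)"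
    by (intro mult_left_mono real_sqrt_le_mono sum_mono power_mono Suc \<rho> norm_ge_zero)
  also have "\<dots> = \<rho> * sqrt ((\<rho> ^ k)\<^sup>2 * (\<Sum>i\<in>UNIV. \<Sum>\<alpha> | length \<alpha> = k. (norm (h (i # \<alpha>)))\<^sup>2))"
    by (simp add: power_mult_distrib sum_nonneg sum_distrib_left)
  also have "\<dots> = \<rho> ^ Suc k * sqrt (\<Sum>\<alpha> | length \<alpha> = Suc k. (norm (h \<alpha>))\<^sup>2)"
    using \<rho> by (simp add: sum_words_Suc real_sqrt_mult)
  finally show ?case .
qed simp

lemma norm_hom_part_le:
  assumes X: "row_bounded \<rho> X"
  shows "norm (hom_part (ell2_coeff x) X k h) \<le> norm x * \<rho> ^ k * norm h"
proof -
  have op: "bounded_clinear (op_word X \<alpha>)" for \<alpha>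
    using X by (intro bounded_clinear_op_word) (simp add: row_bounded_def)
  have \<rho>: "0 \<le> \<rho>" using X by (simp add: row_bounded_def)
  have "norm (hom_part (ell2_coeff x) X k h)
      = norm (\<Sum>\<alpha> | length \<alpha> = k. op_word X \<alpha> (ell2_coeff x \<alpha> *\<^sub>C h))"
    by (simp add: hom_part_def bounded_clinear_scaleC[OF op])
  also have "\<dots> \<le> \<rho> ^ k * sqrt (\<Sum>\<alpha> | length \<alpha> = k. (norm (ell2_coeff x \<alpha> *\<^sub>C h))\<^sup>2)"
    by (rule norm_op_word_sum_le[OF X])
  also have "\<dots> = \<rho> ^ k * (sqrt (\<Sum>\<alpha> | length \<alpha> = k. (cmod (ell2_coeff x \<alpha>))\<^sup>2) * norm h)"
    by (simp add: norm_scaleC power_mult_distrib real_sqrt_mult flip: sum_distrib_right)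
  also have "\<dots> \<le> \<rho> ^ k * (norm x * norm h)"
    using ell2_sum_le_norm[of "{\<alpha>. length \<alpha> = k}" x] \<rho>
    by (intro mult_left_mono mult_right_mono real_le_lsqrt) auto
  finally show ?thesis by (simp add: ac_simps)
qed

lemma norm_convergent_row_bounded:
  assumes "row_bounded \<rho> X" "\<rho> < 1"
  shows "norm_convergent (ell2_coeff x) X"
  using assms norm_hom_part_le[OF assms(1)]
  by (intro norm_convergent_geometric[where \<rho> = \<rho> and B = "norm x"]) (auto simp: row_bounded_def)

lemma row_bounded_scale_tuple:
  assumes "row_bounded \<rho> X" "0 \<le> r"
  shows "row_bounded (r * \<rho>) (scale_tuple r X)"
  using assms unfolding row_bounded_def
  by (auto simp: bounded_tuple_scale simp flip: scaleR_sum_right)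
    (auto simp: scale_tuple_def mult.assoc simp flip: scaleR_sum_right intro!: mult_left_mono)

lemma row_bounded_row_norm:
  fixes X :: "'n::finite \<Rightarrow> 'i ell2 \<Rightarrow> 'i ell2"
  assumes X: "bounded_tuple X"
  shows "row_bounded (row_norm X) X"
proof -
  \<comment> \<open>The bound at a tuple of unit vectors has a positive square root on the right,
    which forces the row norm to be nonnegative.\<close>
  have "0 \<le> row_norm X * sqrt (\<Sum>i\<in>(UNIV :: 'n set). (norm (ell2_basis undefined :: 'i ell2))\<^sup>2)"
    by (rule order_trans[OF norm_ge_zero row_norm_bound[OF X]])
  then have "0 \<le> row_norm X" by (simp add: zero_le_mult_iff)
  then show ?thesis using X row_norm_bound[OF X] by (simp add: row_bounded_def)
qed


section \<open>The algebra of left multipliers, its dilations and the weak operator topology\<close>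

section \<open>Left multipliers of the Fock space\<close>

text \<open>The noncommutative analytic Toeplitz algebra described by symbols:
  \<open>hardy_algebra_left_multiplier\<close> and \<open>left_multiplier_in_hardy_algebra\<close>
  together identify these operators with the WOT closure of the polynomials in the creation
  operators.\<close>

definition left_multiplier :: "'n ncps \<Rightarrow> ('n list ell2 \<Rightarrow> 'n list ell2) \<Rightarrow> bool" where
  "left_multiplier c T \<longleftrightarrow>
     bounded_clinear T \<and> (\<forall>x. ell2_coeff (T x) = ncps_mult c (ell2_coeff x))"

text \<open>The image of the vacuum vector recovers the symbol, which is therefore square summable
  and determined by the operator.\<close>

lemma left_multiplier_coeff: "left_multiplier c T \<Longrightarrow> c = ell2_coeff (T (ell2_basis []))"
  by (simp add: left_multiplier_def ell2_coeff_basis_Nil)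

lemma left_multiplier_bounded: "left_multiplier c T \<Longrightarrow> bounded_clinear T"
  by (simp add: left_multiplier_def)

lemma left_multiplier_unique:
  assumes "left_multiplier c S" "left_multiplier c T"
  shows "S = T"
  using assms by (intro ext ell2_eqI) (simp add: left_multiplier_def)

text \<open>At a fixed word, convolution is a finite sum, so both sides are continuous linear
  functionals of \<open>x\<close> and agree everywhere once they agree on the basis.\<close>

lemma left_multiplierI_basis:
  assumes T: "bounded_clinear T"
    and basis: "\<And>\<beta>. ell2_coeff (T (ell2_basis \<beta>)) = ncps_mult c (ell2_coeff (ell2_basis \<beta>))"
  shows "left_multiplier c T"
  unfolding left_multiplier_def
proof (intro conjI allI ext T)
  fix x w
  show "ell2_coeff (T x) w = ncps_mult c (ell2_coeff x) w"
  proof (rule ell2_linear_eqI[where S = "\<lambda>x. ell2_coeff (T x) w"])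
    show "bounded_linear (\<lambda>x. ell2_coeff (T x) w)"
      using T by (intro bounded_linear_compose[OF bounded_linear_ell2_coeff])
        (simp add: bounded_clinear_def)
    show "bounded_linear (\<lambda>x. ncps_mult c (ell2_coeff x) w)"
      unfolding ncps_mult_def
      by (intro bounded_linear_sum bounded_linear_const_mult bounded_linear_ell2_coeff)
  qed (use T basis in \<open>simp_all add: bounded_clinear_def ncps_mult_def sum_distrib_left
      mult.left_commute\<close>)
qed

lemma left_multiplier_id: "left_multiplier ncps_one id"
  by (simp add: left_multiplier_def bounded_clinear_id)

lemma left_multiplier_compose:
  assumes "left_multiplier c S" "left_multiplier d T"
  shows "left_multiplier (ncps_mult c d) (S \<circ> T)"
  using assms by (simp add: left_multiplier_def bounded_clinear_compose ncps_mult_assoc)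

lemma left_multiplier_cmult:
  assumes "left_multiplier c T"
  shows "left_multiplier (\<lambda>w. a * c w) (\<lambda>h. a *\<^sub>C T h)"
  using assms by (simp add: left_multiplier_def bounded_clinear_cmult ncps_mult_cmult_left fun_eq_iff)

lemma left_multiplier_sum:
  assumes "\<And>i. i \<in> A \<Longrightarrow> left_multiplier (c i) (T i)"
  shows "left_multiplier (\<lambda>w. \<Sum>i\<in>A. c i w) (\<lambda>h. \<Sum>i\<in>A. T i h)"
  using assms
  by (simp add: left_multiplier_def bounded_clinear_setsum ncps_mult_sum_left fun_eq_iff
      ell2_coeff_sum)

lemma left_multiplier_op_word:
  assumes "\<And>i. left_multiplier (c i) (M i)"
  shows "left_multiplier (ncps_word c \<alpha>) (op_word M \<alpha>)"
proof (induction \<alpha>)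
  case Nil
  then show ?case using left_multiplier_id by (simp add: ncps_word_def id_def)
next
  case (Cons i \<alpha>)
  then show ?case
    using left_multiplier_compose[OF assms Cons.IH] by (simp add: ncps_word_def o_def)
qed

text \<open>Appending a fixed word is injective on words, so right multiplication by it is
  isometric. This reduces convergence on an arbitrary basis vector to convergence on the
  vacuum.\<close>

lemma norm_right_shift:
  assumes "ell2_coeff y = ncps_mult (ell2_coeff x) (ell2_coeff (ell2_basis \<beta>))"
  shows "norm y = norm x"
proof -
  have "((\<lambda>w. (cmod (ell2_coeff y w))\<^sup>2) has_sum (norm x)\<^sup>2) (range (\<lambda>\<alpha>. \<alpha> @ \<beta>))"
    using has_sum_norm_ell2[of x]
    by (subst has_sum_reindex) (simp_all add: inj_on_def o_def assms ncps_mult_basis_append)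
  then have "((\<lambda>w. (cmod (ell2_coeff y w))\<^sup>2) has_sum (norm x)\<^sup>2) UNIV"
    by (rule has_sum_cong_neutral[THEN iffD1, rotated -1])
      (auto simp: assms ncps_mult_basis_not_append)
  then have "(norm y)\<^sup>2 = (norm x)\<^sup>2" using has_sum_norm_ell2 has_sum_unique by blast
  then show ?thesis by (simp add: power2_eq_iff_nonneg)
qed


section \<open>Left creation operators\<close>

lemma sum_words_Cons_vimage:
  fixes F :: "'n::finite list set" and a :: "'n list \<Rightarrow> real"
  assumes "finite F" "a [] = 0"
  shows "sum a F = (\<Sum>i\<in>UNIV. \<Sum>\<beta>\<in>(#) i -` F. a (i # \<beta>))"
proof -
  have fin: "finite ((#) i -` F)" for i :: 'n
    using assms(1) by (rule finite_vimageI) simp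
  have "sum a F = sum a (F - {[]})"
    using assms by (intro sum.mono_neutral_right) auto
  also have "\<dots> = (\<Sum>(i, \<beta>)\<in>Sigma UNIV (\<lambda>i. (#) i -` F). a (i # \<beta>))"
    by (rule sum.reindex_bij_witness[of _ "\<lambda>(i, \<beta>). i # \<beta>" "\<lambda>w. (hd w, tl w)"]) auto
  also have "\<dots> = (\<Sum>i\<in>UNIV. \<Sum>\<beta>\<in>(#) i -` F. a (i # \<beta>))"
    by (rule sum.Sigma[symmetric]) (use fin in auto)
  finally show ?thesis .
qed

text \<open>Images under different creation operators are supported on words with different first
  letters, hence are orthogonal. The estimate is over finite sets and for a bare family
  \<open>y\<close>, so that it can also prove square summability.\<close>

lemma sum_creation_le:
  fixes h :: "'n::finite \<Rightarrow> 'n list ell2"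
  assumes "finite F" "\<And>i \<beta>. y (i # \<beta>) = ell2_coeff (h i) \<beta>" "y [] = 0"
  shows "(\<Sum>w\<in>F. (cmod (y w))\<^sup>2) \<le> (\<Sum>i\<in>UNIV. (norm (h i))\<^sup>2)"
proof -
  have "finite ((#) i -` F)" for i :: 'n
    using assms(1) by (rule finite_vimageI) simp
  then show ?thesis
    using assms by (subst sum_words_Cons_vimage) (auto intro!: sum_mono ell2_sum_le_norm)
qed

lemma ell2_coeff_left_creation:
  fixes j :: "'n::finite"
  shows "ell2_coeff (left_creation j x) = ncps_mult (ncps_var j) (ell2_coeff x)"
proof -
  let ?y = "\<lambda>\<alpha>. case \<alpha> of [] \<Rightarrow> 0 | i # \<beta> \<Rightarrow> if i = j then ell2_coeff x \<beta> else 0"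
  have "square_summable ?y"
    by (rule square_summableI_bound, rule sum_creation_le[where h = "\<lambda>i. if i = j then x else 0"])
      auto
  then show ?thesis by (auto simp: left_creation_def ncps_mult_var_left fun_eq_iff)
qed

lemma norm_sum_left_creation_le:
  fixes h :: "'n::finite \<Rightarrow> 'n list ell2"
  shows "norm (\<Sum>i\<in>UNIV. left_creation i (h i)) \<le> sqrt (\<Sum>i\<in>UNIV. (norm (h i))\<^sup>2)"
proof (rule ell2_norm_leI)
  fix F :: "'n list set" assume F: "finite F"
  show "(\<Sum>w\<in>F. (cmod (ell2_coeff (\<Sum>i\<in>UNIV. left_creation i (h i)) w))\<^sup>2)
      \<le> (sqrt (\<Sum>i\<in>UNIV. (norm (h i))\<^sup>2))\<^sup>2"
    using sum_creation_le[OF F, of "ell2_coeff (\<Sum>i\<in>UNIV. left_creation i (h i))" h]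
    by (simp add: ell2_coeff_sum ell2_coeff_left_creation ncps_mult_var_left ncps_var_def sum_nonneg)
qed (simp add: sum_nonneg)

lemma left_multiplier_creation:
  fixes j :: "'n::finite"
  shows "left_multiplier (ncps_var j) (left_creation j)"
proof -
  have "bounded_clinear (left_creation j)"
  proof (rule bounded_clinearI)
    have 0: "left_creation i 0 = 0" for i :: 'n
      by (rule ell2_eqI) (simp add: ell2_coeff_left_creation ncps_mult_def)
    show "norm (left_creation j x) \<le> 1 * norm x" for x
      using norm_sum_left_creation_le[of "\<lambda>i. if i = j then x else 0"]
      by (simp add: if_distrib[of "left_creation _"] if_distrib[of norm] if_distrib[of "\<lambda>x. x\<^sup>2"]
          0 cong: if_cong)
  qed (rule ell2_eqI; simp add: ell2_coeff_left_creation ncps_mult_def distrib_left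
      sum.distrib sum_distrib_left mult.left_commute)+
  then show ?thesis by (simp add: left_multiplier_def ell2_coeff_left_creation)
qed

lemma left_creation_basis: "left_creation j (ell2_basis \<beta>) = ell2_basis (j # \<beta>)"
  for j :: "'n::finite"
  by (rule ell2_eqI) (simp add: ell2_coeff_left_creation ell2_coeff_basis_Cons)

lemma bounded_tuple_left_creation: "bounded_tuple (left_creation :: 'n::finite \<Rightarrow> _)"
  using left_multiplier_creation by (auto simp: bounded_tuple_def left_multiplier_def)

lemma row_bounded_left_creation: "row_bounded 1 (left_creation :: 'n::finite \<Rightarrow> _)"
  by (simp add: row_bounded_def bounded_tuple_left_creation norm_sum_left_creation_le)

lemma ncps_word_var: "ncps_word ncps_var \<alpha> = ell2_coeff (ell2_basis \<alpha>)"
  by (induction \<alpha>) (simp_all add: ncps_word_def ell2_coeff_basis_Nil ell2_coeff_basis_Cons)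

lemma left_multiplier_hom_part_creation:
  fixes c :: "'n::finite ncps"
  shows "left_multiplier (\<lambda>w. if length w = k then c w else 0) (hom_part c left_creation k)"
proof -
  have "left_multiplier (\<lambda>w. \<Sum>\<alpha> | length \<alpha> = k. c \<alpha> * ncps_word ncps_var \<alpha> w)
      (\<lambda>h. \<Sum>\<alpha> | length \<alpha> = k. c \<alpha> *\<^sub>C op_word left_creation \<alpha> h)"
    by (intro left_multiplier_sum left_multiplier_cmult left_multiplier_op_word
        left_multiplier_creation)
  also have "(\<lambda>w. \<Sum>\<alpha> | length \<alpha> = k. c \<alpha> * ncps_word ncps_var \<alpha> w)
      = (\<lambda>w. if length w = k then c w else 0)"
    by (simp add: ncps_word_var ell2_coeff_basis if_distrib fun_eq_iff cong: if_cong)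
  finally show ?thesis by (simp add: hom_part_def[abs_def])
qed

lemma left_multiplier_dilation:
  fixes t :: "'n::finite list ell2"
  assumes r: "0 \<le> r" "r < 1"
  shows "norm_convergent (ell2_coeff t) (scale_tuple r left_creation)"
    and "left_multiplier (\<lambda>\<alpha>. of_real (r ^ length \<alpha>) * ell2_coeff t \<alpha>)
      (ev_sum (ell2_coeff t) (scale_tuple r left_creation))"
proof -
  have rb: "row_bounded (r * 1) (scale_tuple r (left_creation :: 'n \<Rightarrow> _))"
    using r by (intro row_bounded_scale_tuple row_bounded_left_creation) simp
  then show nc: "norm_convergent (ell2_coeff t) (scale_tuple r left_creation)"
    by (rule norm_convergent_row_bounded) (use r in simp)
  have bt: "bounded_tuple (scale_tuple r (left_creation :: 'n \<Rightarrow> _))"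
    using rb by (simp add: row_bounded_def)
  note sot = norm_convergent_imp_sot[OF bt nc]
  have "ell2_coeff (ev_sum (ell2_coeff t) (scale_tuple r left_creation) x) w =
      ncps_mult (\<lambda>\<alpha>. of_real (r ^ length \<alpha>) * ell2_coeff t \<alpha>) (ell2_coeff x) w" for x w
  proof -
    \<comment> \<open>At a fixed word \<open>w\<close> the homogeneous part of degree
      \<open>k\<close> meets only the prefix of length \<open>k\<close>, so the series of
      coefficients is finite.\<close>
    let ?a = "\<lambda>k. if k \<in> {..length w} then of_real (r ^ k) * ell2_coeff t (take k w) * ell2_coeff x (drop k w) else 0"
    have "(\<lambda>k. ell2_coeff (hom_part (ell2_coeff t) (scale_tuple r left_creation) k x) w) sums
        ell2_coeff (ev_sum (ell2_coeff t) (scale_tuple r left_creation) x) w"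
      by (rule sums_ell2_coeff[OF sot_convergent_sums[OF sot]])
    also have "(\<lambda>k. ell2_coeff (hom_part (ell2_coeff t) (scale_tuple r left_creation) k x) w) = ?a"
    proof
      fix k
      have "ell2_coeff (hom_part (ell2_coeff t) left_creation k x) w =
          (\<Sum>j\<le>length w. (if length (take j w) = k then ell2_coeff t (take j w) else 0) * ell2_coeff x (drop j w))"
        using left_multiplier_hom_part_creation[of k "ell2_coeff t"]
        by (simp add: left_multiplier_def ncps_mult_def)
      also have "\<dots> = (\<Sum>j\<le>length w. if j = k then ell2_coeff t (take k w) * ell2_coeff x (drop k w) else 0)"
        by (intro sum.cong refl) auto
      finally show "ell2_coeff (hom_part (ell2_coeff t) (scale_tuple r left_creation) k x) w = ?a k"
        by (simp add: hom_part_scale_tuple[OF bounded_tuple_left_creation] scaleR_conv_of_real)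
    qed
    finally have "?a sums ell2_coeff (ev_sum (ell2_coeff t) (scale_tuple r left_creation) x) w" .
    moreover have "?a sums (\<Sum>k\<le>length w. of_real (r ^ k) * ell2_coeff t (take k w) * ell2_coeff x (drop k w))"
      by (rule sums_If_finite_set) simp
    ultimately show ?thesis by (simp add: sums_unique2 ncps_mult_def)
  qed
  then show "left_multiplier (\<lambda>\<alpha>. of_real (r ^ length \<alpha>) * ell2_coeff t \<alpha>)
      (ev_sum (ell2_coeff t) (scale_tuple r left_creation))"
    using sot_convergent_bounded[OF sot] by (auto simp: left_multiplier_def)
qed


section \<open>Dilations of left multipliers\<close>

text \<open>These weights factor the positive definite kernel \<open>r\<^bsup>|m - n|\<^esup>\<close> as
  \<open>\<Sum>\<^sub>k v\<^sub>k(m) v\<^sub>k(n)\<close>; the factorisation replaces the Poisson integral in the proof that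
  dilation does not increase the norm of a multiplier.\<close>

definition dilation_weight :: "real \<Rightarrow> nat \<Rightarrow> nat \<Rightarrow> real" where
  "dilation_weight r k m =
     (if k = 0 then r ^ m else if k \<le> m then sqrt (1 - r\<^sup>2) * r ^ (m - k) else 0)"

text \<open>Raising \<open>n\<close> by one shifts \<open>k\<close> by one with the weights
  unchanged, except for the old summand at \<open>k = 0\<close>: it splits into \<open>r^2\<close>
  times itself, the new summand at 0, and \<open>1 - r^2\<close> times itself, the new summand at
  1.\<close>

lemma sum_dilation_weight:
  assumes r: "0 \<le> r" "r \<le> 1" and "n \<le> N"
  shows "(\<Sum>k\<le>N. dilation_weight r k (n + j) * dilation_weight r k n) = r ^ j"
proof -
  have r2: "r\<^sup>2 \<le> 1" using r by (simp add: power_le_one)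
  have if_sum: "(\<Sum>k\<le>n. if k = 0 then a else F k) = (\<Sum>k\<le>n. F k) + (a - F 0)"
    for a :: real and F and n :: nat by (induction n) simp_all
  have "(\<Sum>k\<le>n. dilation_weight r k (n + j) * dilation_weight r k n) = r ^ j"
  proof (induction n)
    case (Suc n)
    have "(\<Sum>k\<le>Suc n. dilation_weight r k (Suc n + j) * dilation_weight r k (Suc n)) =
        r ^ (Suc n + j) * r ^ Suc n +
        (\<Sum>k\<le>n. if k = 0 then (1 - r\<^sup>2) * (r ^ (n + j) * r ^ n)
          else dilation_weight r k (n + j) * dilation_weight r k n)"
      using r2 unfolding sum.atMost_Suc_shift
      by (intro arg_cong2[of _ _ _ _ "(+)"] sum.cong)
        (auto simp: dilation_weight_def)
    also have "\<dots> = r ^ j"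
      unfolding if_sum Suc by (simp add: dilation_weight_def algebra_simps power2_eq_square)
    finally show ?case .
  qed (simp add: dilation_weight_def)
  moreover have "(\<Sum>k\<le>n. dilation_weight r k (n + j) * dilation_weight r k n) =
      (\<Sum>k\<le>N. dilation_weight r k (n + j) * dilation_weight r k n)"
    using \<open>n \<le> N\<close> by (intro sum.mono_neutral_left) (auto simp: dilation_weight_def)
  ultimately show ?thesis by simp
qed

lemma sum_dilation_weight_square_le:
  assumes r: "0 \<le> r" "r \<le> 1"
  shows "(\<Sum>k\<le>N. (dilation_weight r k m)\<^sup>2) \<le> 1"
proof -
  have "(\<Sum>k\<le>N. (dilation_weight r k m)\<^sup>2) \<le> (\<Sum>k\<le>max m N. (dilation_weight r k m)\<^sup>2)"
    by (rule sum_mono2) auto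
  also have "\<dots> = 1"
    using sum_dilation_weight[OF r, of m "max m N" 0] by (simp add: power2_eq_square)
  finally show ?thesis .
qed

lemma dilation_weight_square_le:
  assumes "0 \<le> r" "r \<le> 1"
  shows "(dilation_weight r k m)\<^sup>2 \<le> 1"
proof -
  have "(dilation_weight r k m)\<^sup>2 \<le> (\<Sum>k\<le>k. (dilation_weight r k m)\<^sup>2)"
    by (rule member_le_sum) auto
  also have "\<dots> \<le> 1" by (rule sum_dilation_weight_square_le[OF assms])
  finally show ?thesis .
qed

text \<open>Diagonal factors of the dilation of a multiplier. For \<open>k = 0\<close> this is
  itself the dilation of a vector, multiplying the coefficient at a word by \<open>r\<close> to its
  length.\<close>

definition weight_op :: "real \<Rightarrow> nat \<Rightarrow> 'n list ell2 \<Rightarrow> 'n list ell2" where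
  "weight_op r k x = Abs_ell2 (\<lambda>\<alpha>. of_real (dilation_weight r k (length \<alpha>)) * ell2_coeff x \<alpha>)"

lemma ell2_coeff_weight_op:
  assumes r: "0 \<le> r" "r \<le> 1"
  shows "ell2_coeff (weight_op r k x) \<alpha> = of_real (dilation_weight r k (length \<alpha>)) * ell2_coeff x \<alpha>"
proof -
  have "square_summable (\<lambda>\<alpha>. of_real (dilation_weight r k (length \<alpha>)) * ell2_coeff x \<alpha>)"
  proof (rule square_summableI_bound)
    fix F :: "'a list set" assume F: "finite F"
    have "(\<Sum>\<alpha>\<in>F. (cmod (of_real (dilation_weight r k (length \<alpha>)) * ell2_coeff x \<alpha>))\<^sup>2)
        \<le> (\<Sum>\<alpha>\<in>F. (cmod (ell2_coeff x \<alpha>))\<^sup>2)"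
      using dilation_weight_square_le[OF r]
      by (intro sum_mono) (simp add: norm_mult power_mult_distrib mult_left_le_one_le)
    also have "\<dots> \<le> (norm x)\<^sup>2" by (rule ell2_sum_le_norm[OF F])
    finally show "(\<Sum>\<alpha>\<in>F. (cmod (of_real (dilation_weight r k (length \<alpha>)) * ell2_coeff x \<alpha>))\<^sup>2)
        \<le> (norm x)\<^sup>2" .
  qed
  then show ?thesis by (simp add: weight_op_def)
qed

lemma sum_norm_weight_op_le:
  assumes r: "0 \<le> r" "r \<le> 1"
  shows "(\<Sum>k\<le>N. (norm (weight_op r k x))\<^sup>2) \<le> (norm x)\<^sup>2"
proof -
  have "((\<lambda>\<alpha>. \<Sum>k\<le>N. (cmod (ell2_coeff (weight_op r k x) \<alpha>))\<^sup>2) has_sum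
      (\<Sum>k\<le>N. (norm (weight_op r k x))\<^sup>2)) UNIV"
    by (induction N) (simp_all add: has_sum_norm_ell2 has_sum_add)
  moreover have "(\<Sum>k\<le>N. (cmod (ell2_coeff (weight_op r k x) \<alpha>))\<^sup>2) \<le> (cmod (ell2_coeff x \<alpha>))\<^sup>2" for \<alpha>
    using sum_dilation_weight_square_le[OF r, of "length \<alpha>" N]
    by (simp add: ell2_coeff_weight_op[OF r] norm_mult power_mult_distrib mult_left_le_one_le sum_nonneg
        flip: sum_distrib_right)
  ultimately show ?thesis using has_sum_norm_ell2[of x] has_sum_mono by blast
qed

text \<open>With D_k the operator \<open>weight_op r k\<close>, \<open>A\<close> is the sum of the
  products D_k T D_k: an entry of \<open>T\<close> between words whose lengths differ by j is
  multiplied by r^j. As the squares of the D_k sum to at most the identity, Cauchy-Schwarz in k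
  bounds \<open>A\<close> by the norm of \<open>T\<close>.\<close>

lemma norm_dilation_le:
  assumes T: "left_multiplier c T" and r: "0 \<le> r" "r \<le> 1"
    and A: "left_multiplier (\<lambda>\<alpha>. of_real (r ^ length \<alpha>) * c \<alpha>) A"
  shows "norm (A x) \<le> onorm T * norm (x :: 'n::finite list ell2)"
proof (rule ell2_norm_leI)
  have T': "bounded_clinear T" using T by (rule left_multiplier_bounded)
  show pos: "0 \<le> onorm T * norm x"
    by (intro mult_nonneg_nonneg onorm_pos_le bounded_clinear_linear T') simp
  fix F :: "'n list set" assume F: "finite F"
  then obtain N where N: "F \<subseteq> {\<alpha>. length \<alpha> < N}" using finite_words_subset by blast
  \<comment> \<open>The weights with \<open>k\<close> above the length of \<open>w\<close> vanish
    and \<open>N\<close> exceeds all lengths in \<open>F\<close>, so the sum up to \<open>N\<close>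
    is already exact.\<close>
  have eq: "ell2_coeff (A x) w =
      (\<Sum>k\<le>N. of_real (dilation_weight r k (length w)) * ell2_coeff (T (weight_op r k x)) w)"
    if w: "w \<in> F" for w
  proof -
    have w': "length w \<le> N" using w N by auto
    have "(\<Sum>k\<le>N. of_real (dilation_weight r k (length w)) * ell2_coeff (T (weight_op r k x)) w)
        = (\<Sum>k\<le>N. \<Sum>j\<le>length w. of_real (dilation_weight r k (length w) * dilation_weight r k (length w - j))
            * (c (take j w) * ell2_coeff x (drop j w)))"
      using T by (simp add: left_multiplier_def ncps_mult_def ell2_coeff_weight_op[OF r]
          sum_distrib_left ac_simps)
    also have "\<dots> = (\<Sum>j\<le>length w. of_real (\<Sum>k\<le>N. dilation_weight r k (length w - j + j) * dilation_weight r k (length w - j))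
            * (c (take j w) * ell2_coeff x (drop j w)))"
      by (subst sum.swap) (simp add: sum_distrib_right)
    also have "\<dots> = (\<Sum>j\<le>length w. of_real (r ^ j) * c (take j w) * ell2_coeff x (drop j w))"
      using w' by (intro sum.cong refl) (simp only: sum_dilation_weight[OF r] le_diff_conv trans_le_add1 mult.assoc)
    also have "\<dots> = ell2_coeff (A x) w"
      using A by (simp add: left_multiplier_def ncps_mult_def)
    finally show ?thesis by simp
  qed
  have le: "(cmod (ell2_coeff (A x) w))\<^sup>2 \<le> (\<Sum>k\<le>N. (cmod (ell2_coeff (T (weight_op r k x)) w))\<^sup>2)"
    if w: "w \<in> F" for w
  proof -
    have "cmod (ell2_coeff (A x) w) \<le>
        (\<Sum>k\<le>N. \<bar>dilation_weight r k (length w)\<bar> * \<bar>cmod (ell2_coeff (T (weight_op r k x)) w)\<bar>)"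
      unfolding eq[OF w] by (rule order_trans[OF norm_sum]) (simp add: norm_mult)
    also have "\<dots> \<le> L2_set (\<lambda>k. dilation_weight r k (length w)) {..N} *
        L2_set (\<lambda>k. cmod (ell2_coeff (T (weight_op r k x)) w)) {..N}"
      by (rule L2_set_mult_ineq)
    also have "\<dots> \<le> 1 * L2_set (\<lambda>k. cmod (ell2_coeff (T (weight_op r k x)) w)) {..N}"
      using sum_dilation_weight_square_le[OF r, of "length w" N]
      by (intro mult_right_mono) (simp_all add: L2_set_def sum_nonneg)
    finally show ?thesis by (simp add: L2_set_def real_le_rsqrt sqrt_ge_absD)
  qed
  have "(\<Sum>w\<in>F. (cmod (ell2_coeff (A x) w))\<^sup>2) \<le>
      (\<Sum>w\<in>F. \<Sum>k\<le>N. (cmod (ell2_coeff (T (weight_op r k x)) w))\<^sup>2)"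
    by (rule sum_mono) (rule le)
  also have "\<dots> = (\<Sum>k\<le>N. \<Sum>w\<in>F. (cmod (ell2_coeff (T (weight_op r k x)) w))\<^sup>2)"
    by (rule sum.swap)
  also have "\<dots> \<le> (\<Sum>k\<le>N. (norm (T (weight_op r k x)))\<^sup>2)"
    by (intro sum_mono ell2_sum_le_norm F)
  also have "\<dots> \<le> (\<Sum>k\<le>N. (onorm T * norm (weight_op r k x))\<^sup>2)"
    by (intro sum_mono power_mono bounded_clinear_onorm T') simp
  also have "\<dots> = (onorm T)\<^sup>2 * (\<Sum>k\<le>N. (norm (weight_op r k x))\<^sup>2)"
    by (simp add: power_mult_distrib sum_distrib_left)
  also have "\<dots> \<le> (onorm T)\<^sup>2 * (norm x)\<^sup>2"
    by (intro mult_left_mono sum_norm_weight_op_le r) simp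
  finally show "(\<Sum>w\<in>F. (cmod (ell2_coeff (A x) w))\<^sup>2) \<le> (onorm T * norm x)\<^sup>2"
    by (simp add: power_mult_distrib)
qed

lemma eventually_dilation_range: "\<forall>\<^sub>F r :: real in at_left 1. 0 \<le> r \<and> r < 1"
  by (rule eventually_at_leftI[of 0]) auto

lemma weight_op_0_tendsto: "((\<lambda>r. weight_op r 0 x) \<longlongrightarrow> x) (at_left 1)"
proof (rule bounded_clinear_tendsto_basis[where T = "\<lambda>x. x" and C = 1])
  have bound: "norm (weight_op r 0 x) \<le> norm x" if "0 \<le> r" "r < 1" for r and x :: "'a list ell2"
    using sum_norm_weight_op_le[of r x 0] that by (simp add: power2_le_iff_abs_le)
  have bc: "bounded_clinear (weight_op r 0 :: 'a list ell2 \<Rightarrow> _)" if "0 \<le> r" "r < 1" for r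
    using that bound[OF that]
    by (intro bounded_clinearI[where K = 1] ell2_eqI)
      (simp_all add: ell2_coeff_weight_op algebra_simps)
  show "\<forall>\<^sub>F r in at_left 1. bounded_clinear (weight_op r 0 :: 'a list ell2 \<Rightarrow> _)"
    using eventually_dilation_range by eventually_elim (use bc in blast)
  show "\<forall>\<^sub>F r in at_left 1. \<forall>x :: 'a list ell2. norm (weight_op r 0 x) \<le> 1 * norm x"
    using eventually_dilation_range by eventually_elim (use bound in simp)
  show "bounded_clinear (\<lambda>x. x)" using bounded_clinear_id by (simp add: id_def)
  fix \<beta> :: "'a list"
  have "((\<lambda>r. r ^ length \<beta> *\<^sub>R ell2_basis \<beta>) \<longlongrightarrow> 1 ^ length \<beta> *\<^sub>R ell2_basis \<beta>) (at_left 1)"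
    by (intro tendsto_intros)
  moreover have "\<forall>\<^sub>F r in at_left 1. r ^ length \<beta> *\<^sub>R ell2_basis \<beta> = weight_op r 0 (ell2_basis \<beta>)"
    using eventually_dilation_range
    by eventually_elim
      (auto intro!: ell2_eqI simp: ell2_coeff_weight_op dilation_weight_def ell2_coeff_basis
        scaleR_conv_of_real)
  ultimately show "((\<lambda>r. weight_op r 0 (ell2_basis \<beta>)) \<longlongrightarrow> ell2_basis \<beta>) (at_left 1)"
    by (auto elim: Lim_transform_eventually)
qed

text \<open>The dilations are bounded by the norm of \<open>T\<close> uniformly in r, so basis
  vectors suffice. There the error is a right shift of the error at the vacuum, which is the error
  of dilating the symbol in the sequence space.\<close>

lemma dilation_tendsto:
  fixes T :: "'n::finite list ell2 \<Rightarrow> 'n list ell2"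
  assumes T: "left_multiplier c T"
  shows "((\<lambda>r. ev_sum c (scale_tuple r left_creation) x) \<longlongrightarrow> T x) (at_left 1)"
proof -
  define t where "t = T (ell2_basis [])"
  have c: "c = ell2_coeff t" unfolding t_def by (rule left_multiplier_coeff[OF T])
  define A where "A r = ev_sum c (scale_tuple r left_creation)" for r
  have A: "left_multiplier (\<lambda>\<alpha>. of_real (r ^ length \<alpha>) * c \<alpha>) (A r)" if "0 \<le> r" "r < 1" for r
    unfolding A_def c by (rule left_multiplier_dilation[OF that])
  have "((\<lambda>r. A r x) \<longlongrightarrow> T x) (at_left 1)"
  proof (rule bounded_clinear_tendsto_basis[where L = A and C = "onorm T"])
    show "\<forall>\<^sub>F r in at_left 1. bounded_clinear (A r)"
      using eventually_dilation_range by eventually_elim (use A left_multiplier_bounded in blast)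
    show "bounded_clinear T" by (rule left_multiplier_bounded[OF T])
    show "\<forall>\<^sub>F r in at_left 1. \<forall>x. norm (A r x) \<le> onorm T * norm x"
      using eventually_dilation_range
      by eventually_elim (use norm_dilation_le[OF T _ _ A] in auto)
    fix \<beta> :: "'n list"
    have eq: "norm (A r (ell2_basis \<beta>) - T (ell2_basis \<beta>)) = norm (weight_op r 0 t - t)"
      if r: "0 \<le> r" "r < 1" for r
    proof (rule norm_right_shift[of _ _ \<beta>])
      have 1: "ell2_coeff (weight_op r 0 t) = (\<lambda>\<alpha>. of_real (r ^ length \<alpha>) * c \<alpha>)"
        using r by (auto simp: ell2_coeff_weight_op dilation_weight_def c)
      have 2: "ell2_coeff (weight_op r 0 t - t) =
          (\<lambda>\<alpha>. of_real (r ^ length \<alpha>) * c \<alpha> + (- 1) * c \<alpha>)"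
        by (rule ext) (simp add: 1, simp add: c)
      show "ell2_coeff (A r (ell2_basis \<beta>) - T (ell2_basis \<beta>)) =
          ncps_mult (ell2_coeff (weight_op r 0 t - t)) (ell2_coeff (ell2_basis \<beta>))"
        unfolding 2 ncps_mult_add_left ncps_mult_cmult_left[of "-1" c]
        using A[OF r] T by (auto simp: left_multiplier_def)
    qed
    have "((\<lambda>r. norm (weight_op r 0 t - t)) \<longlongrightarrow> 0) (at_left 1)"
      using weight_op_0_tendsto[of t] by (intro tendsto_norm_zero LIM_zero)
    moreover have "\<forall>\<^sub>F r in at_left 1. norm (weight_op r 0 t - t) = norm (A r (ell2_basis \<beta>) - T (ell2_basis \<beta>))"
      using eventually_dilation_range by eventually_elim (use eq in simp)
    ultimately have "((\<lambda>r. norm (A r (ell2_basis \<beta>) - T (ell2_basis \<beta>))) \<longlongrightarrow> 0) (at_left 1)"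
      by (rule Lim_transform_eventually)
    then show "((\<lambda>r. A r (ell2_basis \<beta>)) \<longlongrightarrow> T (ell2_basis \<beta>)) (at_left 1)"
      by (rule LIM_zero_cancel[OF tendsto_norm_zero_cancel])
  qed
  then show ?thesis by (simp add: A_def)
qed


section \<open>The weak operator topology and the Hardy algebra\<close>

lemma topspace_wot: "topspace wot = {T. bounded_clinear T}"
  by (auto simp: wot_def topspace_pullback_topology)

lemma continuous_map_wot_cinner: "continuous_map wot euclidean (\<lambda>T. cinner (T x) y)"
proof -
  have "continuous_map euclidean euclidean (\<lambda>\<Phi> :: 'a \<times> 'a \<Rightarrow> complex. \<Phi> (x, y))"
    using continuous_on_product_coordinates[of "(x, y)"] by simp
  from continuous_map_pullback[OF this, of "{T. bounded_clinear T}" "\<lambda>T (x, y). cinner (T x) y"]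
  show ?thesis by (simp add: wot_def o_def)
qed

text \<open>Strong convergence implies weak operator convergence. The filter is general because it
  serves both partial sums and dilations as r tends to 1; boundedness is asked eventually since
  \<open>wot\<close> lives on bounded operators only.\<close>

lemma limitin_wotI:
  assumes "bounded_clinear T" "\<forall>\<^sub>F r in F. bounded_clinear (L r)"
    and lim: "\<And>x. ((\<lambda>r. L r x) \<longlongrightarrow> T x) F"
  shows "limitin wot L T F"
  unfolding limitin_def
proof (intro conjI allI impI)
  show "T \<in> topspace wot" using assms(1) by (simp add: topspace_wot)
  fix U assume U: "openin wot U \<and> T \<in> U"
  let ?m = "\<lambda>T (x, y). cinner (T x) y"
  obtain W where W: "open W" "U = ?m -` W \<inter> {T. bounded_clinear T}"
    using U by (auto simp: wot_def openin_pullback_topology)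
  have "limitin (product_topology (\<lambda>_. euclidean) UNIV) (\<lambda>r. ?m (L r)) (?m T) F"
    unfolding limitin_componentwise using tendsto_cinner_left[OF lim] by auto
  then have "((\<lambda>r. ?m (L r)) \<longlongrightarrow> ?m T) F" by (simp add: euclidean_product_topology)
  then have "\<forall>\<^sub>F r in F. ?m (L r) \<in> W" using W U by (auto simp: tendsto_def)
  with assms(2) show "\<forall>\<^sub>F r in F. L r \<in> U" by eventually_elim (simp add: W)
qed

text \<open>With the symbol read off the vacuum, being a multiplier is a family of equations, one
  for each vector and word, between finite linear combinations of matrix coefficients. The set is
  thus an intersection of zero sets of WOT-continuous functions.\<close>

lemma closedin_wot_left_multipliers: "closedin wot {T. \<exists>c. left_multiplier c T}"
proof -
  define D where "D x w T = cinner (T x) (ell2_basis w) -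
      (\<Sum>k\<le>length w. cinner (T (ell2_basis [])) (ell2_basis (take k w)) * ell2_coeff x (drop k w))"
    for x w and T :: "'a list ell2 \<Rightarrow> 'a list ell2"
  have mult: "continuous_map wot euclidean (\<lambda>T. cinner (T x) y * a)" for x y :: "'a list ell2" and a
    using continuous_map_compose[OF continuous_map_wot_cinner[of x y], of euclidean "\<lambda>z. z * a"]
    by (simp add: o_def continuous_on_mult_right)
  have "closedin wot {T \<in> topspace wot. D x w T \<in> {0}}" for x w
    unfolding D_def
    by (intro closedin_continuous_map_preimage[where Y = euclidean] continuous_map_diff
        continuous_map_sum mult continuous_map_wot_cinner) auto
  then have "closedin wot (\<Inter>x. \<Inter>w. {T \<in> topspace wot. D x w T \<in> {0}})"
    by (intro closedin_Inter) auto
  also have "(\<Inter>x. \<Inter>w. {T \<in> topspace wot. D x w T \<in> {0}}) = {T. \<exists>c. left_multiplier c T}"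
  proof -
    have "T \<in> (\<Inter>x. \<Inter>w. {T \<in> topspace wot. D x w T \<in> {0}}) \<longleftrightarrow>
        left_multiplier (ell2_coeff (T (ell2_basis []))) T" for T
      by (auto simp: D_def topspace_wot cinner_basis_right left_multiplier_def ncps_mult_def fun_eq_iff)
    then show ?thesis using left_multiplier_coeff by blast
  qed
  finally show ?thesis .
qed

lemma hardy_algebra_left_multiplier:
  fixes M :: "'n \<Rightarrow> 'n list ell2 \<Rightarrow> 'n list ell2"
  assumes "\<And>i. left_multiplier (c i) (M i)" "T \<in> hardy_algebra M"
  obtains d where "left_multiplier d T"
proof -
  have "op_polynomials M \<subseteq> {T. \<exists>c. left_multiplier c T}"
  proof
    fix T assume "T \<in> op_polynomials M"
    then obtain F a where T: "T = (\<lambda>h. \<Sum>\<alpha>\<in>F. a \<alpha> *\<^sub>C op_word M \<alpha> h)"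
      by (auto simp: op_polynomials_def)
    have "left_multiplier (\<lambda>w. \<Sum>\<alpha>\<in>F. a \<alpha> * ncps_word c \<alpha> w) T"
      unfolding T by (intro left_multiplier_sum left_multiplier_cmult left_multiplier_op_word assms)
    then show "T \<in> {T. \<exists>c. left_multiplier c T}" by blast
  qed
  from closure_of_minimal[OF this closedin_wot_left_multipliers] assms(2) that
  show ?thesis by (auto simp: hardy_algebra_def)
qed

text \<open>Two successive limits: for r < 1 a dilation is the limit of its partial sums, which are
  polynomials, and \<open>T\<close> is the strong limit of its dilations. The WOT closure absorbs
  both.\<close>

lemma left_multiplier_in_hardy_algebra:
  fixes T :: "'n::finite list ell2 \<Rightarrow> 'n list ell2"
  assumes T: "left_multiplier c T"
  shows "T \<in> hardy_algebra left_creation"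
proof -
  let ?S = "left_creation :: 'n \<Rightarrow> _"
  define t where "t = T (ell2_basis [])"
  have c: "c = ell2_coeff t" unfolding t_def by (rule left_multiplier_coeff[OF T])
  have dil: "ev_sum c (scale_tuple r ?S) \<in> hardy_algebra ?S"
    "bounded_clinear (ev_sum c (scale_tuple r ?S))" if r: "0 \<le> r" "r < 1" for r
  proof -
    have bt: "bounded_tuple (scale_tuple r ?S)"
      by (rule bounded_tuple_scale[OF bounded_tuple_left_creation])
    have sot: "sot_convergent c (scale_tuple r ?S)"
      unfolding c by (rule norm_convergent_imp_sot[OF bt left_multiplier_dilation(1)[OF r]])
    show bc: "bounded_clinear (ev_sum c (scale_tuple r ?S))" by (rule sot_convergent_bounded[OF sot])
    have poly: "(\<lambda>h. \<Sum>k<N. hom_part c (scale_tuple r ?S) k h) \<in> op_polynomials ?S" for N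
    proof -
      have "(\<Sum>k<N. hom_part c (scale_tuple r ?S) k h) =
          (\<Sum>\<alpha>\<in>{\<alpha>. length \<alpha> < N}. (c \<alpha> * of_real (r ^ length \<alpha>)) *\<^sub>C op_word ?S \<alpha> h)" for h
        unfolding hom_part_def sum_words_less[symmetric]
        by (intro sum.cong refl)
          (simp add: op_word_scale_tuple[OF bounded_tuple_left_creation] scaleR_scaleC scaleC_scaleC)
      then show ?thesis unfolding op_polynomials_def
        by (auto intro!: exI[of _ "{\<alpha>. length \<alpha> < N}"] exI[of _ "\<lambda>\<alpha>. c \<alpha> * of_real (r ^ length \<alpha>)"])
    qed
    have bcN: "bounded_clinear (\<lambda>h. \<Sum>k<N. hom_part c (scale_tuple r ?S) k h)" for N
      by (rule bounded_clinear_setsum) (rule bounded_clinear_hom_part[OF bt])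
    have "limitin wot (\<lambda>N h. \<Sum>k<N. hom_part c (scale_tuple r ?S) k h)
        (ev_sum c (scale_tuple r ?S)) sequentially"
      using sot_convergent_sums[OF sot]
      by (intro limitin_wotI bc always_eventually allI bcN) (simp add: sums_def)
    moreover have "topspace wot \<inter> op_polynomials ?S \<subseteq> hardy_algebra ?S"
      unfolding hardy_algebra_def by (rule closure_of_subset_Int)
    then have "(\<lambda>h. \<Sum>k<N. hom_part c (scale_tuple r ?S) k h) \<in> hardy_algebra ?S" for N
      using poly bcN by (auto simp: topspace_wot)
    ultimately show "ev_sum c (scale_tuple r ?S) \<in> hardy_algebra ?S"
      by (intro limitin_closedin[of wot _ _ sequentially]) (auto simp: hardy_algebra_def)
  qed
  have "limitin wot (\<lambda>r. ev_sum c (scale_tuple r ?S)) T (at_left 1)"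
  proof (rule limitin_wotI)
    show "\<forall>\<^sub>F r in at_left 1. bounded_clinear (ev_sum c (scale_tuple r ?S))"
      using eventually_dilation_range by eventually_elim (use dil in blast)
  qed (rule left_multiplier_bounded[OF T] dilation_tendsto[OF T])+
  moreover have "\<forall>\<^sub>F r in at_left 1. ev_sum c (scale_tuple r ?S) \<in> hardy_algebra ?S"
    using eventually_dilation_range by eventually_elim (use dil in blast)
  ultimately show ?thesis
    by (intro limitin_closedin[of wot _ _ "at_left (1 :: real)"]) (auto simp: hardy_algebra_def)
qed

text \<open>This makes the \<open>THE\<close> in \<open>hardy_eval\<close> meaningful. For
  uniqueness, the coefficient at a word of the dilated operator applied to the vacuum is
  \<open>r^length \<alpha> * d \<alpha>\<close>; it tends to \<open>d \<alpha>\<close> and also to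
  \<open>c \<alpha>\<close>.\<close>

lemma hardy_representation_left_multiplier_iff:
  fixes M :: "'n::finite \<Rightarrow> 'n list ell2 \<Rightarrow> 'n list ell2"
  assumes eval: "tuple_eval f M = left_creation" and T: "left_multiplier c T"
  shows "hardy_representation f M T d \<longleftrightarrow> d = c"
proof
  assume d: "hardy_representation f M T d"
  then obtain A where "d = fourier_coeffs A" by (auto simp: hardy_representation_def)
  then have d_coeff: "d = ell2_coeff (A (ell2_basis []))"
    by (auto simp: fourier_coeffs_def cinner_basis_right)
  have "d \<alpha> = c \<alpha>" for \<alpha>
  proof (rule tendsto_unique[where F = "at_left (1 :: real)"])
    have "((\<lambda>r. ell2_coeff (ev_sum d (scale_tuple r left_creation) (ell2_basis [])) \<alpha>)
        \<longlongrightarrow> ell2_coeff (T (ell2_basis [])) \<alpha>) (at_left 1)"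
      using d unfolding hardy_representation_def eval by (intro tendsto_ell2_coeff) blast
    moreover have "\<forall>\<^sub>F r in at_left 1.
        ell2_coeff (ev_sum d (scale_tuple r left_creation) (ell2_basis [])) \<alpha> =
        of_real (r ^ length \<alpha>) * d \<alpha>"
      using eventually_dilation_range
    proof eventually_elim
      case (elim r)
      then show ?case
        using left_multiplier_coeff[OF left_multiplier_dilation(2)[of r "A (ell2_basis [])"]]
        by (simp add: d_coeff[symmetric]) (metis of_real_power)
    qed
    ultimately show "((\<lambda>r. of_real (r ^ length \<alpha>) * d \<alpha>) \<longlongrightarrow> c \<alpha>) (at_left 1)"
      using left_multiplier_coeff[OF T] by (auto elim: Lim_transform_eventually)
    have "((\<lambda>r. of_real (r ^ length \<alpha>) * d \<alpha>) \<longlongrightarrow> of_real (1 ^ length \<alpha>) * d \<alpha>) (at_left 1)"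
      by (intro tendsto_intros)
    then show "((\<lambda>r. of_real (r ^ length \<alpha>) * d \<alpha>) \<longlongrightarrow> d \<alpha>) (at_left 1)" by simp
  qed simp
  then show "d = c" by blast
next
  assume "d = c"
  moreover have "c = fourier_coeffs T"
    using left_multiplier_coeff[OF T] by (auto simp: fourier_coeffs_def cinner_basis_right)
  moreover have "norm_convergent c (scale_tuple r left_creation)" if "r \<in> {0<..<1}" for r
    using left_multiplier_dilation(1)[of r "T (ell2_basis [])"] that left_multiplier_coeff[OF T] by simp
  ultimately show "hardy_representation f M T d"
    unfolding hardy_representation_def eval
    using left_multiplier_in_hardy_algebra[OF T] dilation_tendsto[OF T] by blast
qed


section \<open>Szego kernels and joint eigenvectors of the adjoints\<close>

section \<open>The Szego kernel\<close>

text \<open>The conjugates compensate those in the second argument of \<open>cinner\<close>, so that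
  pairing with this vector evaluates a series at \<open>w\<close>. Outside the open unit ball the
  family is not square summable and \<open>Abs_ell2\<close> gives no meaningful value.\<close>

definition szego :: "('n \<Rightarrow> complex) \<Rightarrow> 'n list ell2" where
  "szego w = Abs_ell2 (\<lambda>\<alpha>. prod_list (map (\<lambda>i. cnj (w i)) \<alpha>))"

lemma cnj_prod_list: "cnj (prod_list xs) = prod_list (map cnj xs)"
  by (induction xs) simp_all

lemma cmod_prod_list_power2: "(cmod (prod_list (map w \<alpha>)))\<^sup>2 = prod_list (map (\<lambda>i. (cmod (w i))\<^sup>2) \<alpha>)"
  by (induction \<alpha>) (simp_all add: norm_mult power_mult_distrib)

lemma sum_words_cmod_power2:
  fixes w :: "'n::finite \<Rightarrow> complex"
  shows "(\<Sum>\<alpha> | length \<alpha> = k. (cmod (prod_list (map w \<alpha>)))\<^sup>2) = (\<Sum>i\<in>UNIV. (cmod (w i))\<^sup>2) ^ k"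
  by (simp add: cmod_prod_list_power2 sum_words_prod_list)

text \<open>The words of length k contribute the k-th power of one number, so this is the criterion
  for a geometric series. The forward direction later forces \<open>f(z)\<close> into the open
  ball.\<close>

lemma square_summable_words_iff:
  fixes w :: "'n::finite \<Rightarrow> complex"
  shows "square_summable (\<lambda>\<alpha>. prod_list (map w \<alpha>)) \<longleftrightarrow> (\<Sum>i\<in>UNIV. (cmod (w i))\<^sup>2) < 1"
proof
  let ?s = "\<Sum>i\<in>UNIV. (cmod (w i))\<^sup>2"
  have s0: "0 \<le> ?s" by (simp add: sum_nonneg)
  {
    assume "square_summable (\<lambda>\<alpha>. prod_list (map w \<alpha>))"
    then have "summable (\<lambda>k. ?s ^ k)"
      unfolding square_summable_def
      using has_sum_words_sums[OF has_sum_infsum, of "\<lambda>\<alpha>. (cmod (prod_list (map w \<alpha>)))\<^sup>2"]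
      by (simp add: sum_words_cmod_power2 sums_iff)
    then show "?s < 1" using s0 by (simp add: summable_geometric_iff)
  next
    assume s1: "?s < 1"
    show "square_summable (\<lambda>\<alpha>. prod_list (map w \<alpha>))"
    proof (rule square_summableI_bound)
      fix F :: "'n list set" assume "finite F"
      then obtain N where N: "F \<subseteq> {\<alpha>. length \<alpha> < N}" using finite_words_subset by blast
      then have "(\<Sum>\<alpha>\<in>F. (cmod (prod_list (map w \<alpha>)))\<^sup>2) \<le>
          (\<Sum>\<alpha>\<in>{\<alpha>. length \<alpha> < N}. (cmod (prod_list (map w \<alpha>)))\<^sup>2)"
        by (intro sum_mono2) auto
      also have "\<dots> = (\<Sum>k<N. ?s ^ k)"
        by (simp add: sum_words_cmod_power2 flip: sum_words_less)
      also have "\<dots> \<le> (\<Sum>k. ?s ^ k)"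
        using s0 s1 by (intro sum_le_suminf summable_geometric) auto
      finally show "(\<Sum>\<alpha>\<in>F. (cmod (prod_list (map w \<alpha>)))\<^sup>2) \<le> (\<Sum>k. ?s ^ k)" .
    qed
  }
qed

locale ball_point =
  fixes w :: "'n::finite \<Rightarrow> complex"
  assumes in_ball: "(\<Sum>i\<in>UNIV. (cmod (w i))\<^sup>2) < 1"
begin

lemma ell2_coeff_szego: "ell2_coeff (szego w) \<alpha> = cnj (prod_list (map w \<alpha>))"
proof -
  have "square_summable (\<lambda>\<alpha>. prod_list (map (\<lambda>i. cnj (w i)) \<alpha>))"
    using in_ball by (subst square_summable_words_iff) simp
  then show ?thesis by (simp add: szego_def cnj_prod_list o_def)
qed

lemma norm_szego: "(norm (szego w))\<^sup>2 = 1 / (1 - (\<Sum>i\<in>UNIV. (cmod (w i))\<^sup>2))"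
proof -
  have "(\<lambda>k. \<Sum>\<alpha> | length \<alpha> = k. (cmod (ell2_coeff (szego w) \<alpha>))\<^sup>2) sums (norm (szego w))\<^sup>2"
    by (rule has_sum_words_sums[OF has_sum_norm_ell2])
  then have "(\<lambda>k. (\<Sum>i\<in>UNIV. (cmod (w i))\<^sup>2) ^ k) sums (norm (szego w))\<^sup>2"
    by (simp add: ell2_coeff_szego sum_words_cmod_power2)
  moreover have "(\<lambda>k. (\<Sum>i\<in>UNIV. (cmod (w i))\<^sup>2) ^ k) sums (1 / (1 - (\<Sum>i\<in>UNIV. (cmod (w i))\<^sup>2)))"
    using in_ball by (intro geometric_sums) (simp add: sum_nonneg)
  ultimately show ?thesis by (rule sums_unique2)
qed

lemma szego_has_sum:
  "((\<lambda>\<alpha>. prod_list (map (\<lambda>i. cnj (w i)) \<alpha>) *\<^sub>C ell2_basis \<alpha>) has_sum szego w) UNIV"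
  using ell2_has_sum[of "szego w"] by (simp add: ell2_coeff_szego cnj_prod_list o_def)

lemma cinner_szego_sums:
  "(\<lambda>k. \<Sum>\<alpha> | length \<alpha> = k. ell2_coeff x \<alpha> * prod_list (map w \<alpha>)) sums cinner x (szego w)"
  using has_sum_words_sums[OF has_sum_cinner_ell2[of x "szego w"]] by (simp add: ell2_coeff_szego)

lemma cinner_left_multiplier_szego:
  assumes T: "left_multiplier (ell2_coeff t) T"
  shows "cinner (T x) (szego w) = cinner t (szego w) * cinner x (szego w)"
proof (rule ell2_linear_eqI[where S = "\<lambda>x. cinner (T x) (szego w)"])
  have T': "bounded_clinear T" by (rule left_multiplier_bounded[OF T])
  show "bounded_linear (\<lambda>x. cinner (T x) (szego w))"
    by (rule bounded_linear_compose[OF bounded_linear_cinner_left bounded_clinear_linear[OF T']])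
  show "cinner (T (c *\<^sub>C x)) (szego w) = c *\<^sub>C cinner (T x) (szego w)" for c x
    by (simp add: bounded_clinear_scaleC[OF T'] cinner_scaleC_left)
  show "bounded_linear (\<lambda>x. cinner t (szego w) * cinner x (szego w))"
    by (intro bounded_linear_const_mult bounded_linear_cinner_left)
  show "cinner t (szego w) * cinner (c *\<^sub>C x) (szego w) =
      c *\<^sub>C (cinner t (szego w) * cinner x (szego w))" for c x
    by (simp add: cinner_scaleC_left)
  fix \<beta>
  have "((\<lambda>\<alpha>. ell2_coeff t \<alpha> * prod_list (map w \<alpha>) * prod_list (map w \<beta>)) has_sum
      cinner t (szego w) * prod_list (map w \<beta>)) UNIV"
    using has_sum_cmult_left[OF has_sum_cinner_ell2[of t "szego w"]] by (simp add: ell2_coeff_szego)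
  also have "(\<lambda>\<alpha>. ell2_coeff t \<alpha> * prod_list (map w \<alpha>) * prod_list (map w \<beta>)) =
      (\<lambda>\<gamma>. ell2_coeff (T (ell2_basis \<beta>)) \<gamma> * cnj (ell2_coeff (szego w) \<gamma>)) \<circ> (\<lambda>\<alpha>. \<alpha> @ \<beta>)"
    using T by (auto simp: left_multiplier_def ncps_mult_basis_append ell2_coeff_szego)
  finally have "((\<lambda>\<gamma>. ell2_coeff (T (ell2_basis \<beta>)) \<gamma> * cnj (ell2_coeff (szego w) \<gamma>)) has_sum
      cinner t (szego w) * prod_list (map w \<beta>)) (range (\<lambda>\<alpha>. \<alpha> @ \<beta>))"
    by (subst has_sum_reindex) (simp_all add: inj_on_def o_def)
  then have "((\<lambda>\<gamma>. ell2_coeff (T (ell2_basis \<beta>)) \<gamma> * cnj (ell2_coeff (szego w) \<gamma>)) has_sum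
      cinner t (szego w) * prod_list (map w \<beta>)) UNIV"
    by (rule has_sum_cong_neutral[THEN iffD1, rotated -1])
      (use T in \<open>auto simp: left_multiplier_def ncps_mult_basis_not_append\<close>)
  from has_sum_unique[OF this has_sum_cinner_ell2]
  show "cinner (T (ell2_basis \<beta>)) (szego w) = cinner t (szego w) * cinner (ell2_basis \<beta>) (szego w)"
    by (simp add: cinner_basis_left ell2_coeff_szego)
qed

lemma szego_eigenvector:
  assumes T: "left_multiplier (ell2_coeff t) T"
  shows "cadjoint T (szego w) = cnj (cinner t (szego w)) *\<^sub>C szego w"
proof (rule cinner_eqI_right)
  show "cinner x (cadjoint T (szego w)) = cinner x (cnj (cinner t (szego w)) *\<^sub>C szego w)" for x
    using cinner_left_multiplier_szego[OF T, of x] left_multiplier_bounded[OF T]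
    by (simp add: cinner_cadjoint cinner_scaleC_right)
qed

end


section \<open>Scalar tuples\<close>

text \<open>The variant of \<open>scalar_tuple\<close> for plain functions, the type in which
  \<open>scalar_eval f z\<close> and rescaled points appear.\<close>

definition mult_tuple :: "('n \<Rightarrow> complex) \<Rightarrow> 'n \<Rightarrow> complex \<Rightarrow> complex" where
  "mult_tuple w i h = w i * h"

definition poly_part :: "'n::finite ncps \<Rightarrow> ('n \<Rightarrow> complex) \<Rightarrow> nat \<Rightarrow> complex" where
  "poly_part c w k = (\<Sum>\<alpha> | length \<alpha> = k. c \<alpha> * prod_list (map w \<alpha>))"

lemma scalar_tuple_eq: "scalar_tuple z = mult_tuple (($) z)"
  by (simp add: fun_eq_iff scalar_tuple_def mult_tuple_def)

lemma bounded_clinear_mult: "bounded_clinear (\<lambda>h :: complex. a * h)"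
  by (rule bounded_clinearI[where K = "cmod a"]) (simp_all add: distrib_left norm_mult)

lemma bounded_clinear_complex_eq: "bounded_clinear T \<Longrightarrow> T = (\<lambda>h :: complex. T 1 * h)"
proof
  show "T h = T 1 * h" if "bounded_clinear T" for h
    using bounded_clinear_scaleC[OF that, of h 1] by (simp add: mult.commute[of "T 1"])
qed

lemma mult_tuple_simp: "mult_tuple w i = (\<lambda>h. w i * h)"
  by (simp add: fun_eq_iff mult_tuple_def)

lemma bounded_tuple_mult_tuple: "bounded_tuple (mult_tuple w)"
  by (simp add: bounded_tuple_def mult_tuple_simp bounded_clinear_mult)

lemma scale_mult_tuple: "scale_tuple r (mult_tuple w) = mult_tuple (\<lambda>i. of_real r * w i)"
  by (simp add: fun_eq_iff scale_tuple_def mult_tuple_def scaleR_conv_of_real)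

lemma op_word_mult_tuple: "op_word (mult_tuple w) \<alpha> h = prod_list (map w \<alpha>) * h"
  by (induction \<alpha>) (simp_all add: mult_tuple_def)

lemma hom_part_mult_tuple: "hom_part c (mult_tuple w) k h = poly_part c w k * h"
  by (simp add: hom_part_def poly_part_def op_word_mult_tuple sum_distrib_right mult.assoc)

lemma ev_sum_mult_tuple:
  assumes "poly_part c w sums s"
  shows "ev_sum c (mult_tuple w) = (\<lambda>h. s * h)" "sot_convergent c (mult_tuple w)"
proof -
  have "(\<lambda>k. hom_part c (mult_tuple w) k h) sums (s * h)" for h
    unfolding hom_part_mult_tuple by (rule sums_mult2[OF assms])
  then show "ev_sum c (mult_tuple w) = (\<lambda>h. s * h)" "sot_convergent c (mult_tuple w)"
    unfolding ev_sum_def sot_convergent_def using bounded_clinear_mult[of s]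
    by (auto simp: sums_unique[symmetric])
qed

lemma row_norm_mult_tuple: "row_norm (mult_tuple w) = sqrt (\<Sum>i\<in>UNIV. (cmod (w i))\<^sup>2)"
  for w :: "'n::finite \<Rightarrow> complex"
proof -
  let ?s = "\<Sum>i\<in>UNIV. (cmod (w i))\<^sup>2"
  have adj: "cadjoint (mult_tuple w i) = (\<lambda>h. cnj (w i) * h)" for i
    by (rule cadjoint_eqI) (simp add: mult_tuple_def cinner_complex_def)
  have eq: "(\<lambda>h. \<Sum>i\<in>UNIV. mult_tuple w i (cadjoint (mult_tuple w i) h)) = (\<lambda>h. of_real ?s * h)"
    by (simp add: fun_eq_iff adj mult_tuple_def sum_distrib_right complex_norm_square
        flip: mult.assoc del: of_real_power)
  have "onorm (\<lambda>h. complex_of_real ?s * h) = ?s"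
  proof (rule antisym)
    show "onorm (\<lambda>h. complex_of_real ?s * h) \<le> ?s"
      by (rule onorm_bound) (simp_all add: norm_mult sum_nonneg del: of_real_sum)
    show "?s \<le> onorm (\<lambda>h. complex_of_real ?s * h)"
      using bounded_clinear_onorm[OF bounded_clinear_mult, of "of_real ?s" 1]
      by (simp add: sum_nonneg del: of_real_sum)
  qed
  then show ?thesis unfolding row_norm_def eq by simp
qed

lemma ev_rad_eq:
  assumes "\<And>h. ((\<lambda>r. ev_sum c (scale_tuple r X) h) \<longlongrightarrow> T h) (at_left 1)"
  shows "ev_rad c X = T"
  unfolding ev_rad_def using assms by (intro ext tendsto_Lim) simp_all

text \<open>By Abel's theorem the two evaluation rules agree wherever the undilated series
  converges, so the case distinction in \<open>tuple_eval\<close> is harmless.\<close>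

lemma ev_rad_eq_ev_sum:
  assumes "bounded_tuple X" "sot_convergent c X"
  shows "ev_rad c X = ev_sum c X"
  by (rule ev_rad_eq) (rule ev_sum_scale_tuple_tendsto[OF assms(1) sot_convergent_sums[OF assms(2)]])

lemma C_rad_tendsto:
  assumes "X \<in> C_rad f"
  shows "bounded_clinear (ev_rad (f j) X)"
    and "((\<lambda>r. ev_sum (f j) (scale_tuple r X) h) \<longlongrightarrow> ev_rad (f j) X h) (at_left 1)"
proof -
  obtain T where T: "bounded_clinear T"
    "\<And>h. ((\<lambda>r. ev_sum (f j) (scale_tuple r X) h) \<longlongrightarrow> T h) (at_left 1)"
    using assms unfolding C_rad_def by blast
  have "ev_rad (f j) X = T" by (rule ev_rad_eq) (rule T(2))
  with T show "bounded_clinear (ev_rad (f j) X)"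
    "((\<lambda>r. ev_sum (f j) (scale_tuple r X) h) \<longlongrightarrow> ev_rad (f j) X h) (at_left 1)"
    by simp_all
qed

text \<open>A bounded complex linear map on the complex numbers is multiplication by its value at 1,
  so evaluation at a scalar point gives a scalar point again.\<close>

lemma tuple_eval_mult_tuple:
  assumes "mult_tuple z \<in> C_sot f \<union> C_rad f"
  shows "tuple_eval f (mult_tuple z) = mult_tuple (\<lambda>j. tuple_eval f (mult_tuple z) j 1)"
proof -
  have "bounded_clinear (tuple_eval f (mult_tuple z) j)" for j
    using assms sot_convergent_bounded C_rad_tendsto(1)[of "mult_tuple z" f]
    by (auto simp: tuple_eval_def C_sot_def)
  from bounded_clinear_complex_eq[OF this] show ?thesis
    by (intro ext) (simp add: mult_tuple_def)
qed

lemma (in ball_point) szego_poly_part_sums: "poly_part (ell2_coeff x) w sums cinner x (szego w)"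
  using cinner_szego_sums by (simp add: poly_part_def[abs_def])

lemma (in ball_point) ev_sum_mult_tuple_ell2:
  "ev_sum (ell2_coeff x) (mult_tuple w) = (\<lambda>h. cinner x (szego w) * h)"
  "sot_convergent (ell2_coeff x) (mult_tuple w)"
  using ev_sum_mult_tuple[OF szego_poly_part_sums] by auto


section \<open>Joint eigenvectors and convergence at the joint eigenvalue\<close>

text \<open>The weak form of \<open>v\<close> being an eigenvector of each adjoint with eigenvalue
  the conjugate of \<open>z i\<close>. Free of adjoints, it passes to words, sums and limits term by
  term.\<close>

locale joint_eigenvector =
  fixes M :: "'n::finite \<Rightarrow> 'h::complex_hilbert_space \<Rightarrow> 'h" and v :: 'h and z :: "'n \<Rightarrow> complex"
  assumes bounded: "bounded_tuple M"
    and nonzero: "v \<noteq> 0"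
    and eigen: "cinner (M i x) v = z i * cinner x v"
begin

lemma cinner_op_word: "cinner (op_word M \<alpha> x) v = prod_list (map z \<alpha>) * cinner x v"
  by (induction \<alpha>) (simp_all add: eigen)

lemma cinner_hom_part: "cinner (hom_part c M k x) v = poly_part c z k * cinner x v"
  by (simp add: hom_part_def poly_part_def cinner_sum_left cinner_scaleC_left cinner_op_word
      sum_distrib_right mult.assoc)

lemma cinner_v_v: "cinner v v \<noteq> 0"
  using nonzero by (simp add: cinner_self)

lemma sums_transfer:
  assumes "(\<lambda>k. hom_part c M k v) sums y"
  shows "poly_part c z sums (cinner y v / cinner v v)"
  using sums_divide[OF sums_cinner_left[OF assms, of v], of "cinner v v"] cinner_v_v
  by (simp add: cinner_hom_part)

lemma sot_transfer:
  assumes "sot_convergent c M"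
  obtains s where "poly_part c z sums s" "\<And>x. cinner (ev_sum c M x) v = s * cinner x v"
proof
  show s: "poly_part c z sums (cinner (ev_sum c M v) v / cinner v v)"
    by (rule sums_transfer[OF sot_convergent_sums[OF assms]])
  show "cinner (ev_sum c M x) v = cinner (ev_sum c M v) v / cinner v v * cinner x v" for x
    using sums_cinner_left[OF sot_convergent_sums[OF assms, of x], of v] sums_mult2[OF s]
    unfolding cinner_hom_part by (rule sums_unique2)
qed

text \<open>The scalar \<open>s\<close> is the compression of \<open>T\<close> to the line through
  \<open>v\<close>. Compression does not increase norms, so the remainders at \<open>z\<close> are
  dominated by the operator remainders.\<close>

lemma norm_transfer:
  assumes "norm_convergent c M"
  shows "norm_convergent c (mult_tuple z)"
proof -
  obtain T where T: "bounded_clinear T"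
    "(\<lambda>N. onorm (\<lambda>h. (\<Sum>k<N. hom_part c M k h) - T h)) \<longlonglongrightarrow> 0"
    using assms unfolding norm_convergent_def by blast
  define s where "s = cinner (T v) v / cinner v v"
  have le: "cmod ((\<Sum>k<N. poly_part c z k) - s) \<le> onorm (\<lambda>h. (\<Sum>k<N. hom_part c M k h) - T h)" for N
  proof -
    let ?P = "\<lambda>h. (\<Sum>k<N. hom_part c M k h) - T h"
    have "((\<Sum>k<N. poly_part c z k) - s) * cinner v v = cinner (?P v) v"
      using cinner_v_v
      by (simp add: s_def cinner_diff_left cinner_sum_left cinner_hom_part sum_distrib_right left_diff_distrib)
    then have "cmod ((\<Sum>k<N. poly_part c z k) - s) * (norm v)\<^sup>2 = cmod (cinner (?P v) v)"
      by (metis cinner_self norm_mult norm_of_real abs_of_nonneg zero_le_power2)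
    also have "\<dots> \<le> norm (?P v) * norm v" by (rule cinner_norm_ineq)
    also have "\<dots> \<le> onorm ?P * norm v * norm v"
      by (intro mult_right_mono onorm bounded_linear_remainder bounded T) simp
    finally show ?thesis using nonzero by (simp add: power2_eq_square)
  qed
  have "(\<lambda>N. onorm (\<lambda>h. (\<Sum>k<N. hom_part c (mult_tuple z) k h) - s * h)) \<longlonglongrightarrow> 0"
  proof (rule tendsto_sandwich[OF _ _ tendsto_const T(2)])
    show "\<forall>\<^sub>F N in sequentially. 0 \<le> onorm (\<lambda>h. (\<Sum>k<N. hom_part c (mult_tuple z) k h) - s * h)"
      by (rule always_eventually, rule allI, rule onorm_pos_le,
          rule bounded_linear_remainder[OF bounded_tuple_mult_tuple bounded_clinear_mult])
    show "\<forall>\<^sub>F N in sequentially. onorm (\<lambda>h. (\<Sum>k<N. hom_part c (mult_tuple z) k h) - s * h)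
        \<le> onorm (\<lambda>h. (\<Sum>k<N. hom_part c M k h) - T h)"
    proof (rule always_eventually, rule allI, rule onorm_bound)
      fix N h
      show "0 \<le> onorm (\<lambda>h. (\<Sum>k<N. hom_part c M k h) - T h)"
        by (rule onorm_pos_le[OF bounded_linear_remainder[OF bounded T(1)]])
      show "cmod ((\<Sum>k<N. hom_part c (mult_tuple z) k h) - s * h) \<le>
          onorm (\<lambda>h. (\<Sum>k<N. hom_part c M k h) - T h) * cmod h"
        using mult_right_mono[OF le[of N], of "cmod h"]
        by (simp add: hom_part_mult_tuple left_diff_distrib flip: sum_distrib_right norm_mult)
    qed
  qed
  then show ?thesis unfolding norm_convergent_def using bounded_clinear_mult by blast
qed

lemma joint_eigenvector_scale: "joint_eigenvector (scale_tuple r M) v (\<lambda>i. of_real r * z i)"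
  using bounded_tuple_scale[OF bounded, of r]
  by unfold_locales (simp_all add: nonzero scale_tuple_def cinner_scaleR_left eigen)

lemma C_sot_transfer:
  assumes M: "M \<in> C_sot f"
  shows "mult_tuple z \<in> C_sot f"
    and "cinner (ev_sum (f j) M x) v = ev_sum (f j) (mult_tuple z) 1 * cinner x v"
proof -
  have sot: "sot_convergent (f j) M" for j using M by (simp add: C_sot_def)
  have "sot_convergent (f j) (mult_tuple z)" for j
    by (rule sot_transfer[OF sot[of j]]) (rule ev_sum_mult_tuple(2))
  then show "mult_tuple z \<in> C_sot f" by (simp add: C_sot_def bounded_tuple_mult_tuple)
  obtain s where "poly_part (f j) z sums s" "\<And>x. cinner (ev_sum (f j) M x) v = s * cinner x v"
    using sot_transfer[OF sot[of j]] by metis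
  then show "cinner (ev_sum (f j) M x) v = ev_sum (f j) (mult_tuple z) 1 * cinner x v"
    by (simp add: ev_sum_mult_tuple)
qed

text \<open>Scaling \<open>M\<close> by r keeps \<open>v\<close> an eigenvector and scales the point
  to r z, so the transfer for convergent series applies at each r near 1; the limit in r is then
  tested against \<open>v\<close>.\<close>

lemma C_rad_transfer:
  assumes M: "M \<in> C_rad f"
  shows "mult_tuple z \<in> C_rad f"
    and "cinner (ev_rad (f j) M x) v = ev_rad (f j) (mult_tuple z) 1 * cinner x v"
proof -
  obtain \<delta> where \<delta>: "\<delta> \<in> {0<..<1}"
    and nc: "\<And>r j. r \<in> {\<delta><..<1} \<Longrightarrow> norm_convergent (f j) (scale_tuple r M)"
    using M unfolding C_rad_def by blast
  have "\<forall>\<^sub>F r in at_left 1. r \<in> {\<delta><..<1}"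
    using \<delta> by (intro eventually_at_leftI[of \<delta>]) auto
  then have ev: "\<forall>\<^sub>F r in at_left 1. cinner (ev_sum (f j) (scale_tuple r M) x) v =
      ev_sum (f j) (scale_tuple r (mult_tuple z)) 1 * cinner x v" for j x
  proof eventually_elim
    case (elim r)
    interpret r: joint_eigenvector "scale_tuple r M" v "\<lambda>i. of_real r * z i"
      by (rule joint_eigenvector_scale)
    obtain s where "poly_part (f j) (\<lambda>i. of_real r * z i) sums s"
      "\<And>x. cinner (ev_sum (f j) (scale_tuple r M) x) v = s * cinner x v"
      using r.sot_transfer[OF norm_convergent_imp_sot[OF r.bounded nc[OF elim]]] by metis
    then show ?case by (simp add: scale_mult_tuple ev_sum_mult_tuple)
  qed
  define s where "s j = cinner (ev_rad (f j) M v) v / cinner v v" for j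
  have "((\<lambda>r. cinner (ev_sum (f j) (scale_tuple r M) v) v / cinner v v) \<longlongrightarrow> s j) (at_left 1)" for j
    unfolding s_def by (intro tendsto_intros tendsto_cinner_left C_rad_tendsto(2)[OF M] cinner_v_v)
  moreover have "\<forall>\<^sub>F r in at_left 1. cinner (ev_sum (f j) (scale_tuple r M) v) v / cinner v v =
      ev_sum (f j) (scale_tuple r (mult_tuple z)) 1" for j
    using ev[of j v] by eventually_elim (simp add: cinner_v_v)
  ultimately have lim1: "((\<lambda>r. ev_sum (f j) (scale_tuple r (mult_tuple z)) 1) \<longlongrightarrow> s j) (at_left 1)" for j
    by (rule Lim_transform_eventually)
  have ncz: "norm_convergent (f j) (scale_tuple r (mult_tuple z))" if "r \<in> {\<delta><..<1}" for r j
    unfolding scale_mult_tuple by (rule joint_eigenvector.norm_transfer[OF joint_eigenvector_scale nc[OF that]])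
  have hom: "ev_sum (f j) (scale_tuple r (mult_tuple z)) h = ev_sum (f j) (scale_tuple r (mult_tuple z)) 1 * h"
    if "r \<in> {\<delta><..<1}" for r j h
    by (rule fun_cong[OF bounded_clinear_complex_eq[OF sot_convergent_bounded[OF
      norm_convergent_imp_sot[OF bounded_tuple_scale[OF bounded_tuple_mult_tuple] ncz[OF that]]]]])
  have lim: "((\<lambda>r. ev_sum (f j) (scale_tuple r (mult_tuple z)) h) \<longlongrightarrow> s j * h) (at_left 1)" for j h
  proof (rule Lim_transform_eventually)
    show "((\<lambda>r. ev_sum (f j) (scale_tuple r (mult_tuple z)) 1 * h) \<longlongrightarrow> s j * h) (at_left 1)"
      by (intro tendsto_intros lim1)
    show "\<forall>\<^sub>F r in at_left 1. ev_sum (f j) (scale_tuple r (mult_tuple z)) 1 * h =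
        ev_sum (f j) (scale_tuple r (mult_tuple z)) h"
      using \<open>\<forall>\<^sub>F r in at_left 1. r \<in> {\<delta><..<1}\<close> by eventually_elim (rule hom[symmetric])
  qed
  show "mult_tuple z \<in> C_rad f"
    unfolding C_rad_def using \<delta> ncz lim bounded_clinear_mult bounded_tuple_mult_tuple by blast
  have "ev_rad (f j) (mult_tuple z) = (\<lambda>h. s j * h)" by (rule ev_rad_eq) (rule lim)
  moreover have "cinner (ev_rad (f j) M x) v = s j * cinner x v"
  proof (rule tendsto_unique)
    show "((\<lambda>r. cinner (ev_sum (f j) (scale_tuple r M) x) v) \<longlongrightarrow> cinner (ev_rad (f j) M x) v) (at_left 1)"
      by (intro tendsto_cinner_left C_rad_tendsto(2)[OF M])
    show "((\<lambda>r. cinner (ev_sum (f j) (scale_tuple r M) x) v) \<longlongrightarrow> s j * cinner x v) (at_left 1)"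
    proof (rule Lim_transform_eventually)
      show "((\<lambda>r. ev_sum (f j) (scale_tuple r (mult_tuple z)) 1 * cinner x v) \<longlongrightarrow> s j * cinner x v) (at_left 1)"
        by (intro tendsto_intros lim1)
      show "\<forall>\<^sub>F r in at_left 1. ev_sum (f j) (scale_tuple r (mult_tuple z)) 1 * cinner x v =
          cinner (ev_sum (f j) (scale_tuple r M) x) v"
        using ev[of j x] by eventually_elim simp
    qed
  qed simp
  ultimately show "cinner (ev_rad (f j) M x) v = ev_rad (f j) (mult_tuple z) 1 * cinner x v" by simp
qed

lemma tuple_eval_transfer:
  assumes M: "M \<in> C_sot f \<union> C_rad f"
  shows "mult_tuple z \<in> C_sot f \<union> C_rad f"
    and "cinner (tuple_eval f M j x) v = tuple_eval f (mult_tuple z) j 1 * cinner x v"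
proof -
  show "mult_tuple z \<in> C_sot f \<union> C_rad f"
    using M C_sot_transfer(1) C_rad_transfer(1) by blast
  show "cinner (tuple_eval f M j x) v = tuple_eval f (mult_tuple z) j 1 * cinner x v"
  proof (cases "M \<in> C_sot f")
    case True
    then show ?thesis using C_sot_transfer[OF True] by (simp add: tuple_eval_def)
  next
    case False
    then have "M \<in> C_rad f" using M by blast
    \<comment> \<open>When \<open>M\<close> is only in \<open>C_rad\<close>, the point
      \<open>z\<close> may still lie in \<open>C_sot\<close>; then \<open>tuple_eval\<close> uses
      different rules at \<open>M\<close> and at \<open>z\<close>, which Abel's theorem reconciles.
      The opposite mismatch cannot occur by \<open>C_sot_transfer\<close>.\<close>
    moreover have "ev_rad (f j) (mult_tuple z) = ev_sum (f j) (mult_tuple z)" if "mult_tuple z \<in> C_sot f"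
      using that by (intro ev_rad_eq_ev_sum) (simp_all add: C_sot_def)
    ultimately show ?thesis using False C_rad_transfer(2)[of f j x] by (auto simp: tuple_eval_def)
  qed
qed

end


section \<open>Eigenvectors of the universal model\<close>

text \<open>The common outcome of the three cases of the model property, in coordinates with respect
  to the basis \<open>f_\<alpha>\<close>.\<close>

locale universal_model =
  fixes f g :: "'n::finite \<Rightarrow> 'n ncps" and M :: "'n \<Rightarrow> 'n list ell2 \<Rightarrow> 'n list ell2"
  assumes model_mult: "left_multiplier (g i) (M i)"
    and model_conv: "M \<in> C_sot f \<union> C_rad f"
    and model_eval: "tuple_eval f M = left_creation"
begin

definition g_vec :: "'n \<Rightarrow> 'n list ell2" where
  "g_vec i = M i (ell2_basis [])"

text \<open>On the open unit ball this is \<open>g\<close> evaluated at \<open>w\<close>, since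
  pairing with the Szego kernel sums the power series.\<close>

definition inverse_map :: "complex ^ 'n \<Rightarrow> complex ^ 'n" where
  "inverse_map w = (\<chi> i. cinner (g_vec i) (szego (($) w)))"

lemma g_eq: "g i = ell2_coeff (g_vec i)"
  unfolding g_vec_def by (rule left_multiplier_coeff[OF model_mult])

lemma model_mult_vec: "left_multiplier (ell2_coeff (g_vec i)) (M i)"
  using model_mult by (simp add: g_eq)

lemma model_bounded: "bounded_clinear (M i)"
  by (rule left_multiplier_bounded[OF model_mult])

lemma model_bounded_tuple: "bounded_tuple M"
  by (simp add: bounded_tuple_def model_bounded)

lemma szego_model:
  assumes "ball_point (($) w)"
  shows "cadjoint (M i) (szego (($) w)) = cnj (inverse_map w $ i) *\<^sub>C szego (($) w)"
  using ball_point.szego_eigenvector[OF assms model_mult_vec] by (simp add: inverse_map_def)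

lemma scalar_domainD:
  assumes z: "z \<in> scalar_domain f g"
  shows "ball_point (scalar_eval f z)" and "inverse_map (\<chi> i. scalar_eval f z i) = z"
proof -
  let ?w = "scalar_eval f z"
  have conv: "mult_tuple (($) z) \<in> C_sot f \<union> C_rad f"
    using z by (simp add: scalar_domain_def nc_domain_def scalar_tuple_eq)
  have te: "tuple_eval f (mult_tuple (($) z)) = mult_tuple ?w"
    unfolding scalar_eval_def[abs_def] scalar_tuple_eq by (rule tuple_eval_mult_tuple[OF conv])
  have "row_norm (mult_tuple ?w) < 1"
    using z te by (simp add: scalar_domain_def nc_domain_def scalar_tuple_eq)
  then show bp: "ball_point ?w"
    by unfold_locales (simp add: row_norm_mult_tuple)
  interpret ball_point ?w by (rule bp)
  have ev: "ev_sum (g i) (mult_tuple ?w) = (\<lambda>h. cinner (g_vec i) (szego ?w) * h)"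
    "sot_convergent (g i) (mult_tuple ?w)" for i
    unfolding g_eq by (rule ev_sum_mult_tuple_ell2)+
  have "(\<forall>i. ev_sum (g i) (mult_tuple ?w) = mult_tuple (($) z) i) \<or>
      (\<forall>i. ev_rad (g i) (mult_tuple ?w) = mult_tuple (($) z) i)"
    using z te by (auto simp: scalar_domain_def nc_domain_def scalar_tuple_eq)
  \<comment> \<open>At a scalar point of the ball the series of \<open>g i\<close> converges, so the
    radial reading of \<open>g(f(z)) = z\<close> reduces to the plain one.\<close>
  then have "ev_sum (g i) (mult_tuple ?w) 1 = z $ i" for i
    using ev_rad_eq_ev_sum[OF bounded_tuple_mult_tuple ev(2)] by (auto simp: mult_tuple_def)
  moreover have "($) (\<chi> i. ?w i) = ?w" by (simp add: fun_eq_iff)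
  ultimately show "inverse_map (\<chi> i. ?w i) = z"
    by (simp add: vec_eq_iff inverse_map_def ev)
qed

lemma eigenvector_in_domain:
  assumes v: "v \<noteq> 0" "\<And>i. cadjoint (M i) v = cnj (z $ i) *\<^sub>C v"
  shows "z \<in> scalar_domain f g"
    and "ell2_coeff v [] \<noteq> 0" and "v = ell2_coeff v [] *\<^sub>C szego (scalar_eval f z)"
proof -
  interpret joint_eigenvector M v "($) z"
    by unfold_locales
      (simp_all add: model_bounded_tuple v cinner_cadjoint[OF model_bounded] cinner_scaleC_right)
  let ?w = "scalar_eval f z"
  note conv = tuple_eval_transfer(1)[OF model_conv]
  have te: "tuple_eval f (mult_tuple (($) z)) = mult_tuple ?w"
    unfolding scalar_eval_def[abs_def] scalar_tuple_eq by (rule tuple_eval_mult_tuple[OF conv])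
  have shift: "cinner (left_creation j x) v = ?w j * cinner x v" for j x
    using tuple_eval_transfer(2)[OF model_conv, of j x] by (simp add: model_eval te mult_tuple_def)
  \<comment> \<open>The eigenvector equation for the creation operators is a recursion along the
    first letter, so the coefficient at the empty word determines \<open>v\<close>.\<close>
  have coeff: "ell2_coeff v \<alpha> = ell2_coeff v [] * cnj (prod_list (map ?w \<alpha>))" for \<alpha>
  proof (induction \<alpha>)
    case (Cons j \<alpha>)
    have "cnj (ell2_coeff v (j # \<alpha>)) = ?w j * cnj (ell2_coeff v \<alpha>)"
      using shift[of j "ell2_basis \<alpha>"] by (simp add: left_creation_basis cinner_basis_left)
    then have "ell2_coeff v (j # \<alpha>) = cnj (?w j) * ell2_coeff v \<alpha>"
      by (metis complex_cnj_cnj complex_cnj_mult)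
    then show ?case using Cons by simp
  qed simp
  show v0: "ell2_coeff v [] \<noteq> 0"
  proof
    assume "ell2_coeff v [] = 0"
    then have "v = 0" by (intro ell2_eqI, subst coeff) simp
    then show False using v(1) by simp
  qed
  \<comment> \<open>Dividing by the nonzero constant coefficient shows that the products of the
    \<open>f_j(z)\<close> inherit square summability from \<open>v\<close>, which places
    \<open>f(z)\<close> in the open ball.\<close>
  have "(\<lambda>\<alpha>. prod_list (map (\<lambda>j. cnj (?w j)) \<alpha>)) = (\<lambda>\<alpha>. inverse (ell2_coeff v []) * ell2_coeff v \<alpha>)"
  proof
    show "prod_list (map (\<lambda>j. cnj (?w j)) \<alpha>) = inverse (ell2_coeff v []) * ell2_coeff v \<alpha>" for \<alpha>
      using coeff[of \<alpha>] v0 by (simp add: cnj_prod_list o_def)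
  qed
  then have "square_summable (\<lambda>\<alpha>. prod_list (map (\<lambda>j. cnj (?w j)) \<alpha>))" by simp
  then have bp: "ball_point ?w"
    by unfold_locales (simp add: square_summable_words_iff)
  interpret ball_point ?w by (rule bp)
  show v_eq: "v = ell2_coeff v [] *\<^sub>C szego ?w"
    by (rule ell2_eqI) (simp add: ell2_coeff_szego, rule coeff)
  \<comment> \<open>The pairing of \<open>M i v\<close> with \<open>v\<close> is computed twice:
    through the multiplier property at the Szego kernel and through the eigenvalue
    \<open>z $ i\<close>.\<close>
  have "cinner (g_vec i) (szego ?w) = z $ i" for i
  proof -
    have "cinner (M i v) v = cinner (g_vec i) (szego ?w) * cinner v v"
      using cinner_left_multiplier_szego[OF model_mult_vec, of i v]
      by (subst (2 4) v_eq) (simp add: cinner_scaleC_right)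
    then show ?thesis using eigen[of i v] cinner_v_v by simp
  qed
  then have ev: "ev_sum (g i) (mult_tuple ?w) = mult_tuple (($) z) i" "sot_convergent (g i) (mult_tuple ?w)" for i
    unfolding g_eq mult_tuple_simp[of "($) z"] using ev_sum_mult_tuple_ell2 by simp_all
  show "z \<in> scalar_domain f g"
    unfolding scalar_domain_def nc_domain_def scalar_tuple_eq mem_Collect_eq te
    using conv in_ball ev
    by (simp add: C_sot_def bounded_tuple_mult_tuple row_norm_mult_tuple)
qed

text \<open>The Szego kernel at \<open>w\<close> is a joint eigenvector whose eigenvalues are the
  conjugates of \<open>g(w)\<close>, so \<open>g(w)\<close> is in the domain and this kernel is
  proportional to the one at \<open>f(g(w))\<close>. Both have constant coefficient 1; the
  one-letter coefficients then identify the points.\<close>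

lemma inverse_map_in_domain:
  assumes w: "ball_point (($) w)"
  shows "inverse_map w \<in> scalar_domain f g" and "scalar_eval f (inverse_map w) = ($) w"
proof -
  interpret ball_point "($) w" by (rule w)
  have c0: "ell2_coeff (szego (($) w)) [] = 1" by (simp add: ell2_coeff_szego)
  then have nz: "szego (($) w) \<noteq> 0" by auto
  note eig = eigenvector_in_domain[OF nz szego_model[OF w]]
  show dom: "inverse_map w \<in> scalar_domain f g" by (rule eig)
  interpret e: ball_point "scalar_eval f (inverse_map w)" by (rule scalar_domainD[OF dom])
  have "szego (($) w) = szego (scalar_eval f (inverse_map w))" using eig(3) c0 by simp
  then have "ell2_coeff (szego (($) w)) [i] = ell2_coeff (szego (scalar_eval f (inverse_map w))) [i]" for i
    by simp
  then show "scalar_eval f (inverse_map w) = ($) w"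
    by (simp add: ell2_coeff_szego e.ell2_coeff_szego fun_eq_iff)
qed

lemma poisson_kernel_eq:
  assumes "z \<in> scalar_domain f g"
  shows "poisson_kernel f z = sqrt (1 - (\<Sum>i\<in>UNIV. (cmod (scalar_eval f z i))\<^sup>2)) *\<^sub>R szego (scalar_eval f z)"
  using infsumI[OF ball_point.szego_has_sum[OF scalar_domainD(1)[OF assms]]]
  by (simp add: poisson_kernel_def)

lemma poisson_kernel_norm:
  assumes "z \<in> scalar_domain f g"
  shows "norm (poisson_kernel f z) = 1"
proof -
  interpret ball_point "scalar_eval f z" by (rule scalar_domainD(1)[OF assms])
  have "(norm (poisson_kernel f z))\<^sup>2 = 1"
    using in_ball by (simp add: poisson_kernel_eq[OF assms] power_mult_distrib norm_szego)
  then show ?thesis by (metis norm_ge_zero power2_eq_1_iff abs_of_nonneg abs_minus_cancel abs_one)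
qed

lemma hardy_eval_eq:
  assumes z: "z \<in> scalar_domain f g" and T: "left_multiplier c T"
  shows "hardy_eval f M T z = cinner (T (ell2_basis [])) (szego (scalar_eval f z))"
proof -
  interpret ball_point "scalar_eval f z" by (rule scalar_domainD(1)[OF z])
  have "(THE c. hardy_representation f M T c) = c"
    by (rule the_equality)
      (simp_all add: hardy_representation_left_multiplier_iff[OF model_eval T])
  then have "hardy_eval f M T z =
      (\<Sum>k. \<Sum>\<alpha> | length \<alpha> = k. ell2_coeff (T (ell2_basis [])) \<alpha> * prod_list (map (scalar_eval f z) \<alpha>))"
    using left_multiplier_coeff[OF T] by (simp add: hardy_eval_def)
  also have "\<dots> = cinner (T (ell2_basis [])) (szego (scalar_eval f z))"
    by (rule sums_unique[symmetric, OF cinner_szego_sums])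
  finally show ?thesis .
qed

lemma hardy_eval_poisson:
  assumes z: "z \<in> scalar_domain f g" and T: "left_multiplier c T"
  shows "cadjoint T (poisson_kernel f z) = cnj (hardy_eval f M T z) *\<^sub>C poisson_kernel f z"
    and "cinner (T x) (poisson_kernel f z) = hardy_eval f M T z * cinner x (poisson_kernel f z)"
    and "hardy_eval f M T z = cinner (T (poisson_kernel f z)) (poisson_kernel f z)"
proof -
  interpret ball_point "scalar_eval f z" by (rule scalar_domainD(1)[OF z])
  have T': "left_multiplier (ell2_coeff (T (ell2_basis []))) T"
    using T left_multiplier_coeff[OF T] by simp
  show 1: "cinner (T x) (poisson_kernel f z) = hardy_eval f M T z * cinner x (poisson_kernel f z)" for x
    by (simp add: poisson_kernel_eq[OF z] cinner_scaleR_right cinner_left_multiplier_szego[OF T', of x]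
        hardy_eval_eq[OF z T])
  show "cadjoint T (poisson_kernel f z) = cnj (hardy_eval f M T z) *\<^sub>C poisson_kernel f z"
    by (rule cinner_eqI_right)
      (simp add: cinner_scaleC_right 1 flip: cinner_cadjoint[OF left_multiplier_bounded[OF T]])
  show "hardy_eval f M T z = cinner (T (poisson_kernel f z)) (poisson_kernel f z)"
    by (simp add: 1 cinner_self poisson_kernel_norm[OF z])
qed

end


section \<open>Complex analysis on the scalar domain\<close>

section \<open>Differentiability of the Szego kernel\<close>

lemma ball_point_iff_norm: "ball_point (($) w) \<longleftrightarrow> norm w < 1" for w :: "complex ^ 'n::finite"
  by (simp add: ball_point_def norm_vec_def L2_set_def)

text \<open>The Szego kernel at \<open>w\<close> is the resolvent of \<open>creation_comb w\<close>,
  a strict contraction in the ball, applied to the vacuum (\<open>szego_recursion\<close>).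
  Differentiability is extracted from this fixed point equation. Conjugates make the dependence on
  \<open>a\<close> conjugate linear.\<close>

definition creation_comb :: "complex ^ 'n::finite \<Rightarrow> 'n list ell2 \<Rightarrow> 'n list ell2" where
  "creation_comb a x = (\<Sum>i\<in>UNIV. cnj (a $ i) *\<^sub>C left_creation i x)"

lemma bounded_clinear_left_creation: "bounded_clinear (left_creation j)" for j :: "'n::finite"
  by (rule left_multiplier_bounded[OF left_multiplier_creation])

lemma bounded_clinear_creation_comb: "bounded_clinear (creation_comb a)"
  unfolding creation_comb_def
  by (intro bounded_clinear_setsum bounded_clinear_cmult bounded_clinear_left_creation)

lemmas creation_comb_add_right = bounded_clinear_add[OF bounded_clinear_creation_comb]
  and creation_comb_diff_right = bounded_clinear_diff[OF bounded_clinear_creation_comb]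
  and creation_comb_scaleC_right = bounded_clinear_scaleC[OF bounded_clinear_creation_comb]

lemma creation_comb_add_left: "creation_comb (a + b) x = creation_comb a x + creation_comb b x"
  by (simp add: creation_comb_def scaleC_add_left sum.distrib)

lemma creation_comb_cmult_left: "creation_comb (c *s a) x = cnj c *\<^sub>C creation_comb a x"
  by (simp add: creation_comb_def scaleC_sum_right scaleC_scaleC)

lemma norm_creation_comb_le: "norm (creation_comb a x) \<le> norm a * norm x"
proof -
  have "norm (creation_comb a x) = norm (\<Sum>i\<in>UNIV. left_creation i (cnj (a $ i) *\<^sub>C x))"
    by (simp add: creation_comb_def bounded_clinear_scaleC[OF bounded_clinear_left_creation])
  also have "\<dots> \<le> sqrt (\<Sum>i\<in>UNIV. (norm (cnj (a $ i) *\<^sub>C x))\<^sup>2)"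
    by (rule norm_sum_left_creation_le)
  also have "\<dots> = norm a * norm x"
    by (simp add: norm_scaleC power_mult_distrib norm_vec_def L2_set_def real_sqrt_mult
        flip: sum_distrib_right)
  finally show ?thesis .
qed

lemma ell2_coeff_creation_comb_Nil [simp]: "ell2_coeff (creation_comb a x) [] = 0"
  by (simp add: creation_comb_def ell2_coeff_sum ell2_coeff_left_creation ncps_var_def)

lemma ell2_coeff_creation_comb_Cons [simp]:
  "ell2_coeff (creation_comb a x) (i # \<alpha>) = cnj (a $ i) * ell2_coeff x \<alpha>"
  by (simp add: creation_comb_def ell2_coeff_sum ell2_coeff_left_creation ncps_mult_var_left
      if_distrib cong: if_cong)

lemma szego_recursion:
  assumes "norm w < 1"
  shows "szego (($) w) = ell2_basis [] + creation_comb w (szego (($) w))"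
proof (rule ell2_eqI)
  interpret ball_point "($) w" using assms by (simp add: ball_point_iff_norm)
  show "ell2_coeff (szego (($) w)) \<alpha> =
      ell2_coeff (ell2_basis [] + creation_comb w (szego (($) w))) \<alpha>" for \<alpha>
    by (cases \<alpha>) (simp_all add: ell2_coeff_szego ell2_coeff_basis)
qed

lemma creation_resolvent_bound:
  assumes w: "norm w < 1" and d: "d = y + creation_comb w d"
  shows "norm d \<le> norm y / (1 - norm w)"
proof -
  have "norm d \<le> norm y + norm w * norm d"
    using norm_triangle_ineq[of y "creation_comb w d"] norm_creation_comb_le[of w d] d by simp
  then show ?thesis using w by (simp add: field_simps)
qed

lemma creation_resolvent_ex1:
  assumes w: "norm w < 1"
  shows "\<exists>!d. d = y + creation_comb w d"
proof -
  have "\<exists>!d. y + creation_comb w d = d"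
  proof (rule banach_fix_type[of "norm w"])
    show "\<forall>x x'. dist (y + creation_comb w x) (y + creation_comb w x') \<le> norm w * dist x x'"
      by (simp add: dist_norm norm_creation_comb_le flip: creation_comb_diff_right)
  qed (use w in simp_all)
  then show ?thesis by (simp add: eq_commute[of _ "y + _"])
qed

text \<open>The equation results from formally differentiating \<open>szego_recursion\<close> in the
  direction \<open>u\<close>; its unique solution is a resolvent applied to the source term.\<close>

definition szego_deriv :: "complex ^ 'n::finite \<Rightarrow> complex ^ 'n \<Rightarrow> 'n list ell2" where
  "szego_deriv w u = (THE d. d = creation_comb u (szego (($) w)) + creation_comb w d)"

lemma szego_deriv_eq:
  assumes "norm w < 1"
  shows "szego_deriv w u = creation_comb u (szego (($) w)) + creation_comb w (szego_deriv w u)"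
  unfolding szego_deriv_def by (rule theI'[OF creation_resolvent_ex1[OF assms]])

lemma szego_deriv_eqI:
  assumes "norm w < 1" "d = creation_comb u (szego (($) w)) + creation_comb w d"
  shows "d = szego_deriv w u"
  using creation_resolvent_ex1[OF assms(1)] assms(2) szego_deriv_eq[OF assms(1)] by blast

lemma szego_deriv_add:
  assumes w: "norm w < 1"
  shows "szego_deriv w (u + u') = szego_deriv w u + szego_deriv w u'"
  using szego_deriv_eq[OF w, of u] szego_deriv_eq[OF w, of u']
  by (intro szego_deriv_eqI[OF w, symmetric])
    (simp add: creation_comb_add_left creation_comb_add_right algebra_simps)

lemma szego_deriv_cmult:
  assumes w: "norm w < 1"
  shows "szego_deriv w (c *s u) = cnj c *\<^sub>C szego_deriv w u"
proof (rule szego_deriv_eqI[OF w, symmetric])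
  have "cnj c *\<^sub>C szego_deriv w u =
      cnj c *\<^sub>C (creation_comb u (szego (($) w)) + creation_comb w (szego_deriv w u))"
    by (rule arg_cong[OF szego_deriv_eq[OF w]])
  also have "\<dots> = creation_comb (c *s u) (szego (($) w))
      + creation_comb w (cnj c *\<^sub>C szego_deriv w u)"
    by (simp add: creation_comb_cmult_left creation_comb_scaleC_right scaleC_add_right)
  finally show "cnj c *\<^sub>C szego_deriv w u = creation_comb (c *s u) (szego (($) w))
      + creation_comb w (cnj c *\<^sub>C szego_deriv w u)" .
qed

lemma bounded_linear_szego_deriv:
  assumes w: "norm w < 1"
  shows "bounded_linear (szego_deriv w)"
proof (rule bounded_linear_intro)
  show "szego_deriv w (u + u') = szego_deriv w u + szego_deriv w u'" for u u'
    by (rule szego_deriv_add[OF w])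
  show "szego_deriv w (r *\<^sub>R u) = r *\<^sub>R szego_deriv w u" for r u
  proof -
    have "r *\<^sub>R u = of_real r *s u" by (simp add: vec_eq_iff scaleR_conv_of_real[where 'a = complex])
    then show ?thesis by (simp add: szego_deriv_cmult[OF w] scaleR_scaleC)
  qed
  show "norm (szego_deriv w u) \<le> norm u * (norm (szego (($) w)) / (1 - norm w))" for u
    using creation_resolvent_bound[OF w szego_deriv_eq[OF w, of u]] w
      divide_right_mono[OF norm_creation_comb_le[of u "szego (($) w)"], of "1 - norm w"] by simp
qed

lemma szego_has_derivative:
  fixes w :: "complex ^ 'n::finite"
  assumes w: "norm w < 1"
  shows "((\<lambda>w. szego (($) w)) has_derivative szego_deriv w) (at w)"
  unfolding has_derivative_at
proof (intro conjI bounded_linear_szego_deriv[OF w])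
  \<comment> \<open>\<open>q\<close> bounds the norm of \<open>w + h\<close> for all
    \<open>h\<close> shorter than half the distance to the sphere. \<open>C\<close> collects one
    resolvent estimate at \<open>w + h\<close>, giving \<open>1 - q\<close>, and one at
    \<open>w\<close>, giving \<open>1 - norm w\<close>.\<close>
  define q where "q = (1 + norm w) / 2"
  define C where "C = norm (szego (($) w)) / (1 - q) / (1 - norm w)"
  have q: "q < 1" using w by (simp add: q_def)
  have est: "norm (szego (($) (w + h)) - szego (($) w) - szego_deriv w h) \<le> C * norm h * norm h"
    if h: "norm h < (1 - norm w) / 2" for h
  proof -
    let ?k = "szego (($) w)"
    define d where "d = szego (($) (w + h)) - ?k"
    have wh: "norm (w + h) \<le> q" using norm_triangle_ineq[of w h] h by (simp add: q_def field_simps)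
    then have wh1: "norm (w + h) < 1" using q by simp
    \<comment> \<open>The difference of the recursions at \<open>w + h\<close> and \<open>w\<close>,
      arranged as a resolvent equation at \<open>w + h\<close>; it yields that \<open>d\<close> is
      of first order in \<open>h\<close>.\<close>
    have d: "d = creation_comb h ?k + creation_comb (w + h) d"
    proof -
      have "creation_comb w ?k = ?k - ell2_basis []"
        "creation_comb (w + h) (szego (($) (w + h))) = szego (($) (w + h)) - ell2_basis []"
        by (metis add_diff_cancel_left' szego_recursion w wh1)+
      moreover have "creation_comb (w + h) d =
          creation_comb (w + h) (szego (($) (w + h))) - (creation_comb w ?k + creation_comb h ?k)"
        by (simp add: d_def creation_comb_diff_right flip: creation_comb_add_left)
      ultimately show ?thesis by (simp add: d_def)
    qed
    have "norm d \<le> norm (creation_comb h ?k) / (1 - norm (w + h))"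
      by (rule creation_resolvent_bound[OF wh1 d])
    also have "\<dots> \<le> (norm h * norm ?k) / (1 - q)"
      using wh q by (intro frac_le norm_creation_comb_le) auto
    finally have nd: "norm d \<le> norm h * norm ?k / (1 - q)" .
    \<comment> \<open>The error solves a resolvent equation at \<open>w\<close> with source
      \<open>creation_comb h d\<close>, which is of second order because \<open>d\<close> is already
      of first order.\<close>
    have "d - szego_deriv w h = creation_comb h d + creation_comb w (d - szego_deriv w h)"
    proof -
      have 1: "creation_comb w (szego_deriv w h) = szego_deriv w h - creation_comb h ?k"
        and 2: "creation_comb (w + h) d = d - creation_comb h ?k"
        by (metis add_diff_cancel_left' szego_deriv_eq[OF w] d)+
      have "creation_comb h d + creation_comb w (d - szego_deriv w h) =
          creation_comb (w + h) d - creation_comb w (szego_deriv w h)"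
        by (simp add: creation_comb_add_left creation_comb_diff_right)
      then show ?thesis by (simp only: 1 2) simp
    qed
    then have "norm (d - szego_deriv w h) \<le> norm (creation_comb h d) / (1 - norm w)"
      by (rule creation_resolvent_bound[OF w])
    also have "\<dots> \<le> norm h * (norm h * norm ?k / (1 - q)) / (1 - norm w)"
      using w by (intro divide_right_mono order_trans[OF norm_creation_comb_le] mult_left_mono nd) auto
    finally show ?thesis by (simp add: d_def C_def ac_simps)
  qed
  show "((\<lambda>h. norm (szego (($) (w + h)) - szego (($) w) - szego_deriv w h) / norm h) \<longlongrightarrow> 0) (at 0)"
  proof (rule tendsto_sandwich[OF _ _ tendsto_const])
    have "((\<lambda>h :: complex ^ 'n. C * norm h) \<longlongrightarrow> C * norm (0 :: complex ^ 'n)) (at 0)"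
      by (rule tendsto_mult[OF tendsto_const tendsto_norm[OF tendsto_ident_at]])
    then show "((\<lambda>h :: complex ^ 'n. C * norm h) \<longlongrightarrow> 0) (at 0)" by simp
    show "\<forall>\<^sub>F h in at 0. norm (szego (($) (w + h)) - szego (($) w) - szego_deriv w h) / norm h \<le> C * norm h"
      unfolding eventually_at
    proof (intro exI[of _ "(1 - norm w) / 2"] conjI ballI impI)
      show "norm (szego (($) (w + h)) - szego (($) w) - szego_deriv w h) / norm h \<le> C * norm h"
        if "h \<noteq> 0 \<and> dist h 0 < (1 - norm w) / 2" for h
        using est[of h] that by (simp add: divide_simps)
    qed (use w in simp)
  qed simp
qed


section \<open>Holomorphy on the scalar domain\<close>

context universal_model
begin

lemma scalar_domain_eq_image: "scalar_domain f g = inverse_map ` ball 0 1"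
proof (intro equalityI subsetI)
  fix z assume z: "z \<in> scalar_domain f g"
  let ?w = "\<chi> i. scalar_eval f z i"
  have "($) ?w = scalar_eval f z" by (simp add: fun_eq_iff)
  then have "norm ?w < 1" using scalar_domainD(1)[OF z] by (simp flip: ball_point_iff_norm)
  then show "z \<in> inverse_map ` ball 0 1"
    using scalar_domainD(2)[OF z] by (intro image_eqI[of _ _ ?w]) simp_all
qed (auto simp: ball_point_iff_norm intro: inverse_map_in_domain)

lemma scalar_eval_inverse_map: "norm w < 1 \<Longrightarrow> scalar_eval f (inverse_map w) = ($) w"
  by (rule inverse_map_in_domain) (simp add: ball_point_iff_norm)

definition inverse_map_deriv :: "complex ^ 'n \<Rightarrow> complex ^ 'n \<Rightarrow> complex ^ 'n" where
  "inverse_map_deriv w u = (\<chi> i. cinner (g_vec i) (szego_deriv w u))"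

lemma inverse_map_has_derivative:
  assumes w: "norm w < 1"
  shows "(inverse_map has_derivative inverse_map_deriv w) (at w)"
proof -
  have "bounded_linear (\<lambda>x. \<chi> i. cinner (g_vec i) x)"
  proof (rule bounded_linear_intro)
    show "norm (\<chi> i. cinner (g_vec i) x) \<le> norm x * (\<Sum>i\<in>UNIV. norm (g_vec i))" for x
    proof -
      have "norm (\<chi> i. cinner (g_vec i) x) \<le> (\<Sum>i\<in>UNIV. cmod (cinner (g_vec i) x))"
        unfolding norm_vec_def by (rule order_trans[OF L2_set_le_sum]) simp_all
      also have "\<dots> \<le> (\<Sum>i\<in>UNIV. norm (g_vec i) * norm x)" by (intro sum_mono cinner_norm_ineq)
      finally show ?thesis by (simp add: sum_distrib_left mult.commute)
    qed
  qed (simp_all add: vec_eq_iff cinner_add_right cinner_scaleR_right scaleR_conv_of_real[where 'a = complex])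
  from bounded_linear.has_derivative[OF this szego_has_derivative[OF w]]
  show ?thesis by (simp add: inverse_map_def[abs_def] inverse_map_deriv_def[abs_def])
qed

lemma cinner_model_szego:
  assumes "norm w < 1"
  shows "cinner (M i x) (szego (($) w)) = inverse_map w $ i * cinner x (szego (($) w))"
  using ball_point.cinner_left_multiplier_szego[OF _ model_mult_vec, of "($) w" i x] assms
  by (simp add: ball_point_iff_norm inverse_map_def)

text \<open>A direction annihilated by the derivative of the inverse map would turn the derivative of
  the Szego kernel into a joint eigenvector with vanishing constant coefficient.\<close>

lemma inverse_map_deriv_injective:
  assumes w: "norm w < 1" and u: "inverse_map_deriv w u = 0"
  shows "u = 0"
proof -
  define d where "d = szego_deriv w u"
  have d_eq: "d = creation_comb u (szego (($) w)) + creation_comb w d"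
    unfolding d_def by (rule szego_deriv_eq[OF w])
  have "cinner (M i x) d = inverse_map w $ i * cinner x d" for i x
  proof -
    have kernel: "((\<lambda>w. cinner y (szego (($) w))) has_derivative (\<lambda>u. cinner y (szego_deriv w u))) (at w)" for y
      by (rule bounded_linear.has_derivative[OF bounded_linear_cinner_right szego_has_derivative[OF w]])
    have comp: "((\<lambda>w. inverse_map w $ i) has_derivative (\<lambda>u. inverse_map_deriv w u $ i)) (at w)"
      by (rule bounded_linear.has_derivative[OF bounded_linear_vec_nth inverse_map_has_derivative[OF w]])
    \<comment> \<open>Differentiates the eigenvector identity for the Szego kernels. In the
      direction \<open>u\<close> the term with the derivative of the inverse map drops out by
      assumption, so \<open>d\<close> satisfies the same eigenvalue equations.\<close>
    have "((\<lambda>w. cinner (M i x) (szego (($) w))) has_derivative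
        (\<lambda>u. inverse_map w $ i * cinner x (szego_deriv w u) + inverse_map_deriv w u $ i * cinner x (szego (($) w)))) (at w)"
    proof (rule has_derivative_transform_within_open[OF has_derivative_mult[OF comp kernel[of x]], of "ball 0 1"])
      show "inverse_map w' $ i * cinner x (szego (($) w')) = cinner (M i x) (szego (($) w'))"
        if "w' \<in> ball 0 1" for w'
        using cinner_model_szego[of w' i x] that by simp
    qed (use w in simp_all)
    from has_derivative_unique[OF this kernel[of "M i x"]]
    have "cinner (M i x) (szego_deriv w u) =
        inverse_map w $ i * cinner x (szego_deriv w u) + inverse_map_deriv w u $ i * cinner x (szego (($) w))"
      by (simp add: fun_eq_iff)
    then show ?thesis by (simp add: u d_def)
  qed
  then have eig: "cadjoint (M i) d = cnj (inverse_map w $ i) *\<^sub>C d" for i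
    by (rule_tac cinner_eqI_right)
      (simp add: cinner_scaleC_right flip: cinner_cadjoint[OF model_bounded])
  have "ell2_coeff d [] = 0" by (subst d_eq) simp
  then have "d = 0" using eigenvector_in_domain(2)[OF _ eig] by blast
  \<comment> \<open>With \<open>d = 0\<close> the defining equation leaves only its source term,
    whose one-letter coefficients are the conjugates of the entries of \<open>u\<close> because the
    kernel has constant coefficient 1.\<close>
  then have "creation_comb u (szego (($) w)) = 0"
    using d_eq bounded_clinear_0[OF bounded_clinear_creation_comb[of w]] by simp
  then have "ell2_coeff (creation_comb u (szego (($) w))) [i] = 0" for i by simp
  moreover have "ell2_coeff (szego (($) w)) [] = 1"
    using ball_point.ell2_coeff_szego[of "($) w" "[]"] w by (simp add: ball_point_iff_norm)
  ultimately show "u = 0" by (simp add: vec_eq_iff)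
qed

lemma continuous_on_inverse_map: "continuous_on (ball 0 1) inverse_map"
  by (rule continuous_at_imp_continuous_on)
    (auto intro: has_derivative_continuous[OF inverse_map_has_derivative])

lemma open_scalar_domain: "open (scalar_domain f g)"
  unfolding scalar_domain_eq_image
proof (rule invariance_of_domain)
  show "continuous_on (ball 0 1) inverse_map" by (rule continuous_on_inverse_map)
  show "inj_on inverse_map (ball 0 1)"
  proof (rule inj_onI)
    fix w w' assume "w \<in> ball 0 1" "w' \<in> ball 0 1" "inverse_map w = inverse_map w'"
    then have "($) w = ($) w'" using scalar_eval_inverse_map[of w] scalar_eval_inverse_map[of w'] by simp
    then show "w = w'" by (simp add: vec_eq_iff)
  qed
qed simp

lemma hardy_eval_holomorphic:
  assumes T: "left_multiplier c T"
  shows "holomorphic_several (hardy_eval f M T) (scalar_domain f g)"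
  unfolding holomorphic_several_def
proof (intro conjI ballI open_scalar_domain)
  fix z assume z: "z \<in> scalar_domain f g"
  define F where "F z = (\<chi> i. scalar_eval f z i)" for z
  obtain w where w: "norm w < 1" "z = inverse_map w"
    using z by (auto simp: scalar_domain_eq_image)
  have F_inv: "F (inverse_map w) = w" if "norm w < 1" for w
    using scalar_eval_inverse_map[OF that] by (simp add: F_def vec_eq_iff)
  let ?D = "inverse_map_deriv w"
  note D = inverse_map_has_derivative[OF w(1)]
  have lin: "linear ?D" by (rule has_derivative_linear[OF D])
  have inj: "inj ?D"
    using inverse_map_deriv_injective[OF w(1)] by (simp add: linear_injective_0[OF lin])
  obtain E where E: "linear E" "\<And>x. E (?D x) = x" "\<And>x. ?D (E x) = x"
    using linear_injective_isomorphism[OF lin inj] by blast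
  \<comment> \<open>The direction enters \<open>szego_deriv\<close> conjugate linearly and
    \<open>szego_deriv\<close> stands in the conjugate linear slot of \<open>cinner\<close>; the two
    conjugations cancel, and complex linearity passes to the inverse \<open>E\<close>.\<close>
  have D_cmult: "?D (a *s u) = a *s ?D u" for a u
    by (simp add: inverse_map_deriv_def szego_deriv_cmult[OF w(1)] cinner_scaleC_right vec_eq_iff)
  have E_cmult: "E (a *s u) = a *s E u" for a u
    using E(2)[of "a *s E u"] by (simp add: D_cmult E(3))
  \<comment> \<open>The strong inverse rule asks for continuity of \<open>inverse_map\<close> on the
    ball and for \<open>F\<close> to be a left inverse there; regularity of \<open>F\<close> is its
    conclusion.\<close>
  have "(F has_derivative E) (at (inverse_map w))"
  proof (rule has_derivative_inverse_strong[OF _ _ continuous_on_inverse_map _ D])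
    show "?D \<circ> E = id" using E(3) by (simp add: fun_eq_iff)
  qed (use w(1) F_inv in simp_all)
  moreover have "F (inverse_map w) = w" by (rule F_inv[OF w(1)])
  ultimately have "((\<lambda>z. szego (($) (F z))) has_derivative (\<lambda>u. szego_deriv w (E u))) (at z)"
    using has_derivative_compose[of F E z UNIV "\<lambda>w. szego (($) w)" "szego_deriv w"]
      szego_has_derivative[OF w(1)] w(2) by simp
  then have "((\<lambda>z. cinner (T (ell2_basis [])) (szego (($) (F z)))) has_derivative
      (\<lambda>u. cinner (T (ell2_basis [])) (szego_deriv w (E u)))) (at z)"
    by (rule bounded_linear.has_derivative[OF bounded_linear_cinner_right])
  then have "(hardy_eval f M T has_derivative
      (\<lambda>u. cinner (T (ell2_basis [])) (szego_deriv w (E u)))) (at z)"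
  proof (rule has_derivative_transform_within_open[OF _ open_scalar_domain z])
    fix z' assume z': "z' \<in> scalar_domain f g"
    have "($) (F z') = scalar_eval f z'" by (simp add: F_def fun_eq_iff)
    then show "cinner (T (ell2_basis [])) (szego (($) (F z'))) = hardy_eval f M T z'"
      by (simp add: hardy_eval_eq[OF z' T])
  qed
  moreover have "cinner (T (ell2_basis [])) (szego_deriv w (E (a *s u))) =
      a * cinner (T (ell2_basis [])) (szego_deriv w (E u))" for a u
    by (simp add: E_cmult szego_deriv_cmult[OF w(1)] cinner_scaleC_right)
  ultimately show "\<exists>D. (hardy_eval f M T has_derivative D) (at z) \<and> (\<forall>c v. D (c *s v) = c * D v)"
    by blast
qed

lemma hardy_eval_bounded:
  assumes T: "left_multiplier c T"
  shows "bounded (hardy_eval f M T ` scalar_domain f g)"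
  unfolding bounded_iff
proof (intro exI[of _ "onorm T"] ballI, clarify)
  fix z assume z: "z \<in> scalar_domain f g"
  show "cmod (hardy_eval f M T z) \<le> onorm T"
    using cmod_cinner_le_onorm[OF left_multiplier_bounded[OF T], of "poisson_kernel f z" "poisson_kernel f z"]
    by (simp add: poisson_kernel_norm[OF z] flip: hardy_eval_poisson(3)[OF z T])
qed

lemma eigenvector_iff:
  "(v \<noteq> 0 \<and> (\<exists>\<mu> :: 'n \<Rightarrow> complex. \<forall>i. cadjoint (M i) v = \<mu> i *\<^sub>C v)) \<longleftrightarrow>
    (\<exists>z\<in>scalar_domain f g. \<exists>c. c \<noteq> 0 \<and> v = c *\<^sub>C poisson_kernel f z)" (is "?L \<longleftrightarrow> ?R")
proof
  assume ?L
  then obtain \<mu> where v: "v \<noteq> 0" and \<mu>: "\<And>i. cadjoint (M i) v = \<mu> i *\<^sub>C v" by blast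
  \<comment> \<open>The eigenvalues of the adjoints are the conjugates of the coordinates of the
    point.\<close>
  let ?z = "\<chi> i. cnj (\<mu> i)"
  have "cadjoint (M i) v = cnj (?z $ i) *\<^sub>C v" for i by (simp add: \<mu>)
  note eig = eigenvector_in_domain[OF v this]
  interpret ball_point "scalar_eval f ?z" by (rule scalar_domainD(1)[OF eig(1)])
  let ?s = "sqrt (1 - (\<Sum>i\<in>UNIV. (cmod (scalar_eval f ?z i))\<^sup>2))"
  have s: "?s \<noteq> 0" using in_ball by simp
  have "v = (ell2_coeff v [] / of_real ?s) *\<^sub>C poisson_kernel f ?z"
    using eig(3) s by (simp add: poisson_kernel_eq[OF eig(1)] scaleR_scaleC scaleC_scaleC)
  moreover have "ell2_coeff v [] / of_real ?s \<noteq> 0" using eig(2) s by simp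
  ultimately show ?R using eig(1) by blast
next
  assume ?R
  then obtain z c where z: "z \<in> scalar_domain f g" and c: "c \<noteq> 0" "v = c *\<^sub>C poisson_kernel f z" by blast
  have "norm v = cmod c" by (simp add: c norm_scaleC poisson_kernel_norm[OF z])
  moreover have "cadjoint (M i) v = cnj (hardy_eval f M (M i) z) *\<^sub>C v" for i
    by (simp add: c bounded_clinear_scaleC[OF bounded_clinear_cadjoint[OF model_bounded]]
        hardy_eval_poisson(1)[OF z model_mult] scaleC_scaleC mult.commute)
  ultimately show ?L using c(1) by auto
qed

lemma model_poisson_kernel:
  assumes z: "z \<in> scalar_domain f g"
  shows "cadjoint (M i) (poisson_kernel f z) = cnj (z $ i) *\<^sub>C poisson_kernel f z"
proof -
  have "hardy_eval f M (M i) z = inverse_map (\<chi> i. scalar_eval f z i) $ i"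
    using hardy_eval_eq[OF z model_mult[of i]]
    by (simp add: inverse_map_def g_vec_def vec_lambda_inverse)
  also have "inverse_map (\<chi> i. scalar_eval f z i) $ i = z $ i"
    by (simp add: scalar_domainD(2)[OF z])
  finally show ?thesis using hardy_eval_poisson(1)[OF z model_mult[of i]] by simp
qed

lemma hardy_algebraE:
  assumes "T \<in> hardy_algebra M"
  obtains c where "left_multiplier c T"
  using hardy_algebra_left_multiplier[of g M T] model_mult assms by blast

lemma hardy_eval_multiplicative:
  assumes "S \<in> hardy_algebra M" "T \<in> hardy_algebra M" and z: "z \<in> scalar_domain f g"
  shows "hardy_eval f M (S \<circ> T) z = hardy_eval f M S z * hardy_eval f M T z"
proof -
  obtain c d where S: "left_multiplier c S" and T: "left_multiplier d T"
    using assms(1,2) by (meson hardy_algebraE)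
  show ?thesis
    using hardy_eval_poisson(3)[OF z left_multiplier_compose[OF S T]]
      hardy_eval_poisson(2)[OF z S] hardy_eval_poisson(2)[OF z T]
    by (simp add: cinner_self poisson_kernel_norm[OF z])
qed

lemma hardy_eval_wot_continuous:
  assumes z: "z \<in> scalar_domain f g"
  shows "continuous_map (subtopology wot (hardy_algebra M)) euclidean (\<lambda>T. hardy_eval f M T z)"
proof (rule continuous_map_eq)
  show "continuous_map (subtopology wot (hardy_algebra M)) euclidean
      (\<lambda>T. cinner (T (poisson_kernel f z)) (poisson_kernel f z))"
    by (rule continuous_map_from_subtopology[OF continuous_map_wot_cinner])
  show "cinner (T (poisson_kernel f z)) (poisson_kernel f z) = hardy_eval f M T z"
    if T: "T \<in> topspace (subtopology wot (hardy_algebra M))" for T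
  proof -
    obtain c where "left_multiplier c T" using T hardy_algebraE by auto
    then show ?thesis by (rule hardy_eval_poisson(3)[OF z, symmetric])
  qed
qed

end


section \<open>Reduction of the three model cases to the universal model\<close>

section \<open>Composition of power series\<close>

lemma ncps_compose_eq_sum:
  assumes "finite F" "\<And>\<alpha>. \<alpha> \<notin> F \<Longrightarrow> a \<alpha> * ncps_word f \<alpha> w = 0"
  shows "ncps_compose a f w = (\<Sum>\<alpha>\<in>F. a \<alpha> * ncps_word f \<alpha> w)"
  unfolding ncps_compose_def
  by (rule infsumI, rule has_sum_finite_neutralI[of F]) (use assms in auto)

lemma ncps_word_Nil [simp]: "ncps_word f [] = ncps_one"
  and ncps_word_Cons [simp]: "ncps_word f (i # \<alpha>) = ncps_mult (f i) (ncps_word f \<alpha>)"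
  by (simp_all add: ncps_word_def)

lemma ncps_word_append: "ncps_word f (\<alpha> @ \<beta>) = ncps_mult (ncps_word f \<alpha>) (ncps_word f \<beta>)"
  by (induction \<alpha>) (simp_all add: ncps_mult_assoc)

lemma ncps_compose_basis: "ncps_compose (ell2_coeff (ell2_basis \<alpha>)) f = ncps_word f \<alpha>"
proof
  show "ncps_compose (ell2_coeff (ell2_basis \<alpha>)) f w = ncps_word f \<alpha> w" for w
    by (subst ncps_compose_eq_sum[of "{\<alpha>}"]) (auto simp: ell2_coeff_basis)
qed

text \<open>Composition respects products with a word on the right. The finiteness hypothesis is the
  common ground of polynomials \<open>c\<close> and of tuples \<open>f\<close> without constant
  terms.\<close>

lemma ncps_compose_mult_basis:
  assumes fin: "\<And>w. finite {\<alpha>. c \<alpha> * ncps_word f \<alpha> w \<noteq> 0}"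
  shows "ncps_compose (ncps_mult c (ell2_coeff (ell2_basis \<beta>))) f =
    ncps_mult (ncps_compose c f) (ncps_word f \<beta>)"
proof
  fix w
  \<comment> \<open>The words that contribute at some prefix of \<open>w\<close>, so that one finite
    index set serves all cuts and the sums can be interchanged.\<close>
  define F where "F = (\<Union>k\<le>length w. {\<alpha>. c \<alpha> * ncps_word f \<alpha> (take k w) \<noteq> 0})"
  have F: "finite F" unfolding F_def using fin by blast
  have F0: "c \<alpha> * ncps_word f \<alpha> (take k w) = 0" if "\<alpha> \<notin> F" "k \<le> length w" for \<alpha> k
    using that by (auto simp: F_def)
  have word: "c \<alpha> * ncps_word f (\<alpha> @ \<beta>) w =
      (\<Sum>k\<le>length w. (c \<alpha> * ncps_word f \<alpha> (take k w)) * ncps_word f \<beta> (drop k w))" for \<alpha>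
    by (simp add: ncps_word_append ncps_mult_def sum_distrib_left mult.assoc)
  have "ncps_compose (ncps_mult c (ell2_coeff (ell2_basis \<beta>))) f w =
      (\<Sum>\<gamma>\<in>(\<lambda>\<alpha>. \<alpha> @ \<beta>) ` F. ncps_mult c (ell2_coeff (ell2_basis \<beta>)) \<gamma> * ncps_word f \<gamma> w)"
  proof (rule ncps_compose_eq_sum)
    fix \<gamma> assume \<gamma>: "\<gamma> \<notin> (\<lambda>\<alpha>. \<alpha> @ \<beta>) ` F"
    show "ncps_mult c (ell2_coeff (ell2_basis \<beta>)) \<gamma> * ncps_word f \<gamma> w = 0"
    proof (cases "\<gamma> \<in> range (\<lambda>\<alpha>. \<alpha> @ \<beta>)")
      case True
      then obtain \<alpha> where \<alpha>: "\<gamma> = \<alpha> @ \<beta>" by blast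
      then have "\<alpha> \<notin> F" using \<gamma> by blast
      then have "(\<Sum>k\<le>length w. (c \<alpha> * ncps_word f \<alpha> (take k w)) * ncps_word f \<beta> (drop k w)) = 0"
        using F0[of \<alpha>] by (intro sum.neutral) auto
      then show ?thesis by (simp add: \<alpha> ncps_mult_basis_append word)
    qed (simp add: ncps_mult_basis_not_append)
  qed (use F in simp)
  also have "\<dots> = (\<Sum>\<alpha>\<in>F. c \<alpha> * ncps_word f (\<alpha> @ \<beta>) w)"
    by (subst sum.reindex) (simp_all add: inj_on_def ncps_mult_basis_append)
  also have "\<dots> = (\<Sum>k\<le>length w. (\<Sum>\<alpha>\<in>F. c \<alpha> * ncps_word f \<alpha> (take k w)) * ncps_word f \<beta> (drop k w))"
    unfolding word by (subst sum.swap) (simp add: sum_distrib_right)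
  also have "\<dots> = ncps_mult (ncps_compose c f) (ncps_word f \<beta>) w"
    unfolding ncps_mult_def
  proof (rule sum.cong[OF refl])
    fix k assume "k \<in> {..length w}"
    then have "ncps_compose c f (take k w) = (\<Sum>\<alpha>\<in>F. c \<alpha> * ncps_word f \<alpha> (take k w))"
      using F0[of _ k] by (intro ncps_compose_eq_sum F) simp
    then show "(\<Sum>\<alpha>\<in>F. c \<alpha> * ncps_word f \<alpha> (take k w)) * ncps_word f \<beta> (drop k w) =
        ncps_compose c f (take k w) * ncps_word f \<beta> (drop k w)" by simp
  qed
  finally show "ncps_compose (ncps_mult c (ell2_coeff (ell2_basis \<beta>))) f w =
      ncps_mult (ncps_compose c f) (ncps_word f \<beta>) w" .
qed


section \<open>Series without constant terms\<close>

lemma ncps_mult_vanish: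
  assumes "\<And>u. length u < m \<Longrightarrow> q u = 0" "length w < m"
  shows "ncps_mult p q w = 0"
  unfolding ncps_mult_def using assms by (intro sum.neutral) auto

locale no_constant_terms =
  fixes f :: "'n::finite \<Rightarrow> 'n ncps"
  assumes const0: "f i [] = 0"
begin

text \<open>Each factor without constant term raises the order by at least one.\<close>

lemma ncps_word_vanish: "length w < length \<alpha> \<Longrightarrow> ncps_word f \<alpha> w = 0"
proof (induction \<alpha> arbitrary: w)
  case (Cons i \<alpha>)
  show ?case
  proof (cases w)
    case (Cons a u)
    then have "ncps_mult (\<lambda>u. f i (a # u)) (ncps_word f \<alpha>) u = 0"
      using Cons.prems by (intro ncps_mult_vanish[of "length \<alpha>"] Cons.IH) auto
    then show ?thesis using Cons by (simp add: ncps_mult_Cons const0)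
  qed (simp add: const0)
qed simp

text \<open>In the lowest possible degree only the linear parts of the factors matter: the
  coefficients form a tensor power of the Jacobian matrix.\<close>

lemma ncps_word_Cons_Cons:
  assumes "length w = length \<alpha>"
  shows "ncps_word f (i # \<alpha>) (a # w) = f i [a] * ncps_word f \<alpha> w"
proof -
  have "ncps_mult (\<lambda>u. f i (a # u)) (ncps_word f \<alpha>) w =
      (\<Sum>k\<in>{0}. f i (a # take k w) * ncps_word f \<alpha> (drop k w))"
    unfolding ncps_mult_def
    by (rule sum.mono_neutral_right) (use assms in \<open>auto simp: ncps_word_vanish\<close>)
  then show ?thesis by (simp add: ncps_mult_Cons const0)
qed

lemma finite_composable: "finite {\<alpha>. c \<alpha> * ncps_word f \<alpha> w \<noteq> 0}"
proof (rule finite_subset)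
  show "{\<alpha>. c \<alpha> * ncps_word f \<alpha> w \<noteq> 0} \<subseteq> {\<alpha>. length \<alpha> < Suc (length w)}"
    using ncps_word_vanish[of w] by (force simp: less_Suc_eq_le not_less[symmetric])
qed simp

lemma ncps_compose_words:
  assumes "length w = m"
  shows "ncps_compose c f w = (\<Sum>k<m. \<Sum>\<alpha> | length \<alpha> = k. c \<alpha> * ncps_word f \<alpha> w) +
    (\<Sum>\<alpha> | length \<alpha> = m. c \<alpha> * ncps_word f \<alpha> w)"
proof -
  have "ncps_compose c f w = (\<Sum>\<alpha> | length \<alpha> < Suc m. c \<alpha> * ncps_word f \<alpha> w)"
    by (rule ncps_compose_eq_sum) (use assms in \<open>auto simp: ncps_word_vanish\<close>)
  then show ?thesis by (simp flip: sum_words_less)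
qed

text \<open>A tensor power of an invertible matrix is injective: the first tensor factor is undone
  by the inverse matrix, and the induction hypothesis handles the rest.\<close>

lemma tensor_power_injective:
  assumes det: "det (\<chi> i j. f i [j]) \<noteq> 0"
    and zero: "\<And>w. length w = m \<Longrightarrow> (\<Sum>\<alpha> | length \<alpha> = m. e \<alpha> * ncps_word f \<alpha> w) = 0"
    and "length \<alpha> = m"
  shows "e \<alpha> = 0"
  using zero \<open>length \<alpha> = m\<close>
proof (induction m arbitrary: e \<alpha>)
  case 0
  then show ?case using "0.prems"(1)[of "[]"] by (simp add: ncps_one_def)
next
  case (Suc m)
  define A :: "complex ^ 'n ^ 'n" where "A = (\<chi> i j. f i [j])"
  obtain B where B: "A ** B = mat 1"
    using det invertible_det_nz[of A] unfolding A_def invertible_def by blast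
  from Suc.prems obtain i \<beta> where \<alpha>: "\<alpha> = i # \<beta>" "length \<beta> = m" by (cases \<alpha>) auto
  have "(\<Sum>\<beta> | length \<beta> = m. e (i # \<beta>) * ncps_word f \<beta> w) = 0" if w: "length w = m" for w
  proof -
    define x where "x i = (\<Sum>\<beta> | length \<beta> = m. e (i # \<beta>) * ncps_word f \<beta> w)" for i
    \<comment> \<open>The hypothesis at the words \<open>a # w\<close> says that the row vector
      \<open>x\<close> is annihilated by the Jacobian matrix; multiplication by \<open>B\<close>
      then gives \<open>x i = 0\<close>.\<close>
    have A0: "(\<Sum>k\<in>UNIV. x k * A $ k $ a) = 0" for a
    proof -
      have "(\<Sum>k\<in>UNIV. x k * A $ k $ a) =
          (\<Sum>k\<in>UNIV. \<Sum>\<beta> | length \<beta> = m. e (k # \<beta>) * ncps_word f (k # \<beta>) (a # w))"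
        unfolding x_def sum_distrib_right
        by (intro sum.cong refl) (use w in \<open>simp add: ncps_word_Cons_Cons A_def del: ncps_word_Cons\<close>)
      also have "\<dots> = 0" using Suc.prems(1)[of "a # w"] w by (simp only: sum_words_Suc length_Cons)
      finally show ?thesis .
    qed
    have "x i = (\<Sum>k\<in>UNIV. x k * (A ** B) $ k $ i)"
      by (simp add: B mat_def if_distrib cong: if_cong)
    also have "\<dots> = (\<Sum>k\<in>UNIV. \<Sum>a\<in>UNIV. x k * A $ k $ a * B $ a $ i)"
      by (simp add: matrix_matrix_mult_def sum_distrib_left mult.assoc)
    also have "\<dots> = (\<Sum>a\<in>UNIV. (\<Sum>k\<in>UNIV. x k * A $ k $ a) * B $ a $ i)"
      by (subst sum.swap) (simp add: sum_distrib_right)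
    also have "\<dots> = 0" by (simp add: A0)
    finally show ?thesis by (simp add: x_def)
  qed
  then have "e (i # \<beta>) = 0" using Suc.IH[of "\<lambda>\<beta>. e (i # \<beta>)"] \<alpha>(2) by blast
  then show ?case by (simp add: \<alpha>)
qed

text \<open>Strong induction on the degree: once the coefficients agree in lower degrees, the degree
  \<open>m\<close> part of the composition sees only the leading parts of the
  \<open>f_\<alpha>\<close> with words of length \<open>m\<close>.\<close>

lemma ncps_compose_injective:
  assumes det: "det (\<chi> i j. f i [j]) \<noteq> 0" and eq: "ncps_compose c f = ncps_compose d f"
  shows "c = d"
proof
  have "\<forall>\<alpha>. length \<alpha> = m \<longrightarrow> c \<alpha> = d \<alpha>" for m
  proof (induction m rule: less_induct)
    case (less m)
    have "(\<Sum>\<alpha> | length \<alpha> = m. (c \<alpha> - d \<alpha>) * ncps_word f \<alpha> w) = 0" if w: "length w = m" for w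
    proof -
      have "(\<Sum>k<m. \<Sum>\<alpha> | length \<alpha> = k. c \<alpha> * ncps_word f \<alpha> w) =
          (\<Sum>k<m. \<Sum>\<alpha> | length \<alpha> = k. d \<alpha> * ncps_word f \<alpha> w)"
        using less by (intro sum.cong refl) auto
      then show ?thesis
        using fun_cong[OF eq, of w] unfolding ncps_compose_words[OF w]
        by (simp add: left_diff_distrib sum_subtractf)
    qed
    then show ?case using tensor_power_injective[OF det, of m "\<lambda>\<alpha>. c \<alpha> - d \<alpha>"] by auto
  qed
  then show "c \<alpha> = d \<alpha>" for \<alpha> by blast
qed

end


section \<open>Noncommutative polynomials\<close>

lemma nc_polynomial_basis: "nc_polynomial (ell2_coeff (ell2_basis \<alpha>))"
  by (simp add: nc_polynomial_def ell2_coeff_basis)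

lemma nc_polynomial_var: "nc_polynomial (ncps_var i)"
  by (simp add: nc_polynomial_def ncps_var_def)

lemma nc_polynomial_cmult: "nc_polynomial p \<Longrightarrow> nc_polynomial (\<lambda>w. a * p w)"
  unfolding nc_polynomial_def by (rule rev_finite_subset) auto

lemma nc_polynomial_sum:
  assumes "\<And>i. i \<in> A \<Longrightarrow> nc_polynomial (p i)"
  shows "nc_polynomial (\<lambda>w. \<Sum>i\<in>A. p i w)"
proof (cases "finite A")
  case True
  have sub: "{w. (\<Sum>i\<in>A. p i w) \<noteq> 0} \<subseteq> (\<Union>i\<in>A. {w. p i w \<noteq> 0})"
    by (auto elim: sum.not_neutral_contains_not_neutral)
  show ?thesis
    unfolding nc_polynomial_def
    by (rule finite_subset[OF sub]) (use True assms in \<open>auto simp: nc_polynomial_def\<close>)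
qed (simp add: nc_polynomial_def)

lemma nc_polynomial_mult:
  assumes "nc_polynomial p" "nc_polynomial q"
  shows "nc_polynomial (ncps_mult p q)"
proof -
  have "w \<in> (\<lambda>(u, v). u @ v) ` ({w. p w \<noteq> 0} \<times> {w. q w \<noteq> 0})" if "ncps_mult p q w \<noteq> 0" for w
  proof -
    have "\<exists>k. p (take k w) * q (drop k w) \<noteq> 0"
    proof (rule ccontr)
      assume "\<nexists>k. p (take k w) * q (drop k w) \<noteq> 0"
      then have "ncps_mult p q w = 0" unfolding ncps_mult_def by (intro sum.neutral) blast
      then show False using that by simp
    qed
    then obtain k where "p (take k w) * q (drop k w) \<noteq> 0" by blast
    then show ?thesis by (intro image_eqI[of _ _ "(take k w, drop k w)"]) auto
  qed
  then have sub: "{w. ncps_mult p q w \<noteq> 0} \<subseteq> (\<lambda>(u, v). u @ v) ` ({w. p w \<noteq> 0} \<times> {w. q w \<noteq> 0})"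
    by blast
  show ?thesis
    unfolding nc_polynomial_def
    by (rule finite_subset[OF sub]) (use assms in \<open>auto simp: nc_polynomial_def\<close>)
qed

lemma nc_polynomial_word:
  assumes "\<And>i. nc_polynomial (f i)"
  shows "nc_polynomial (ncps_word f \<alpha>)"
  by (induction \<alpha>)
    (use assms in \<open>simp_all add: nc_polynomial_mult nc_polynomial_basis flip: ell2_coeff_basis_Nil\<close>)

lemma nc_polynomial_composable: "nc_polynomial c \<Longrightarrow> finite {\<alpha>. c \<alpha> * ncps_word f \<alpha> w \<noteq> 0}"
  unfolding nc_polynomial_def by (rule rev_finite_subset) auto

lemma ncps_compose_polynomial:
  assumes "finite F" "{\<alpha>. c \<alpha> \<noteq> 0} \<subseteq> F"
  shows "ncps_compose c f = (\<lambda>w. \<Sum>\<alpha>\<in>F. c \<alpha> * ncps_word f \<alpha> w)"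
  by (rule ext, rule ncps_compose_eq_sum) (use assms in auto)

lemma nc_polynomial_compose:
  assumes "nc_polynomial c" "\<And>i. nc_polynomial (f i)"
  shows "nc_polynomial (ncps_compose c f)"
  unfolding ncps_compose_polynomial[OF assms(1)[unfolded nc_polynomial_def] subset_refl]
  by (intro nc_polynomial_sum nc_polynomial_cmult nc_polynomial_word assms)

lemma ncps_compose_sum:
  assumes "finite A" "\<And>i. i \<in> A \<Longrightarrow> nc_polynomial (p i)"
  shows "ncps_compose (\<lambda>u. \<Sum>i\<in>A. a i * p i u) f = (\<lambda>w. \<Sum>i\<in>A. a i * ncps_compose (p i) f w)"
proof -
  define F where "F = (\<Union>i\<in>A. {\<alpha>. p i \<alpha> \<noteq> 0})"
  have F: "finite F" using assms by (auto simp: F_def nc_polynomial_def)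
  have "{\<alpha>. (\<Sum>i\<in>A. a i * p i \<alpha>) \<noteq> 0} \<subseteq> F"
    by (auto simp: F_def elim!: sum.not_neutral_contains_not_neutral)
  then have "ncps_compose (\<lambda>u. \<Sum>i\<in>A. a i * p i u) f =
      (\<lambda>w. \<Sum>\<alpha>\<in>F. (\<Sum>i\<in>A. a i * p i \<alpha>) * ncps_word f \<alpha> w)"
    by (rule ncps_compose_polynomial[OF F])
  also have "\<dots> = (\<lambda>w. \<Sum>i\<in>A. a i * (\<Sum>\<alpha>\<in>F. p i \<alpha> * ncps_word f \<alpha> w))"
    by (rule ext) (simp add: sum_distrib_right sum_distrib_left mult.assoc, rule sum.swap)
  also have "\<dots> = (\<lambda>w. \<Sum>i\<in>A. a i * ncps_compose (p i) f w)"
  proof (intro ext sum.cong refl)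
    fix w i assume "i \<in> A"
    then have "ncps_compose (p i) f = (\<lambda>w. \<Sum>\<alpha>\<in>F. p i \<alpha> * ncps_word f \<alpha> w)"
      by (intro ncps_compose_polynomial[OF F]) (auto simp: F_def)
    then show "a i * (\<Sum>\<alpha>\<in>F. p i \<alpha> * ncps_word f \<alpha> w) = a i * ncps_compose (p i) f w" by simp
  qed
  finally show ?thesis .
qed

lemma nc_polynomial_expand:
  assumes "nc_polynomial q"
  shows "q = (\<lambda>w. \<Sum>\<beta> | q \<beta> \<noteq> 0. q \<beta> * ell2_coeff (ell2_basis \<beta>) w)"
  using assms by (auto simp: fun_eq_iff nc_polynomial_def ell2_coeff_basis if_distrib cong: if_cong)

lemma ncps_mult_sum_right:
  "ncps_mult r (\<lambda>u. \<Sum>i\<in>A. p i u) = (\<lambda>w. \<Sum>i\<in>A. ncps_mult r (p i) w)"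
  unfolding ncps_mult_def sum_distrib_left by (rule ext, rule sum.swap)

lemma ncps_compose_mult:
  assumes p: "nc_polynomial p" and q: "nc_polynomial q"
  shows "ncps_compose (ncps_mult p q) k = ncps_mult (ncps_compose p k) (ncps_compose q k)"
proof -
  let ?B = "{\<beta>. q \<beta> \<noteq> 0}"
  have fin: "finite ?B" using q by (simp add: nc_polynomial_def)
  have "ncps_mult p q = (\<lambda>w. \<Sum>\<beta>\<in>?B. q \<beta> * ncps_mult p (ell2_coeff (ell2_basis \<beta>)) w)"
    by (subst (1) nc_polynomial_expand[OF q])
      (simp only: ncps_mult_sum_right ncps_mult_cmult_right)
  then have "ncps_compose (ncps_mult p q) k =
      (\<lambda>w. \<Sum>\<beta>\<in>?B. q \<beta> * ncps_compose (ncps_mult p (ell2_coeff (ell2_basis \<beta>))) k w)"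
    by (simp add: ncps_compose_sum[OF fin] nc_polynomial_mult p nc_polynomial_basis)
  also have "\<dots> = (\<lambda>w. \<Sum>\<beta>\<in>?B. q \<beta> * ncps_mult (ncps_compose p k) (ncps_word k \<beta>) w)"
    by (simp add: ncps_compose_mult_basis[OF nc_polynomial_composable[OF p]])
  also have "\<dots> = ncps_mult (ncps_compose p k) (ncps_compose q k)"
    by (simp add: ncps_compose_polynomial[OF fin subset_refl] ncps_mult_sum_right ncps_mult_cmult_right)
  finally show ?thesis .
qed

lemma ncps_compose_one: "ncps_compose ncps_one k = ncps_one"
  using ncps_compose_basis[of "[]" k] by (simp add: ell2_coeff_basis_Nil)

lemma ncps_compose_word:
  assumes "\<And>i. nc_polynomial (f i)"
  shows "ncps_compose (ncps_word f \<alpha>) k = ncps_word (\<lambda>i. ncps_compose (f i) k) \<alpha>"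
  by (induction \<alpha>)
    (use assms in \<open>simp_all add: ncps_compose_one ncps_compose_mult nc_polynomial_word\<close>)

lemma ncps_compose_assoc:
  assumes c: "nc_polynomial c" and f: "\<And>i. nc_polynomial (f i)"
  shows "ncps_compose (ncps_compose c f) k = ncps_compose c (\<lambda>i. ncps_compose (f i) k)"
proof -
  have fin: "finite {\<alpha>. c \<alpha> \<noteq> 0}" using c by (simp add: nc_polynomial_def)
  show ?thesis
    unfolding ncps_compose_polynomial[OF fin subset_refl]
    by (simp add: ncps_compose_sum[OF fin] nc_polynomial_word f ncps_compose_word)
qed

lemma ncps_compose_var:
  assumes "nc_polynomial c"
  shows "ncps_compose c ncps_var = c"
  using assms nc_polynomial_expand[OF assms]
  by (subst ncps_compose_polynomial[OF _ subset_refl]) (auto simp: nc_polynomial_def ncps_word_var)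


section \<open>The universal model in the three cases\<close>

text \<open>The hypothesis may come from the radial alternative although \<open>M\<close> also lies
  in \<open>C_sot\<close>, where \<open>tuple_eval\<close> takes the plain sum; Abel's theorem
  covers this overlap.\<close>

lemma universal_modelI:
  assumes mult: "\<And>i. left_multiplier (g i) (M i)"
    and conv: "M \<in> C_sot f \<and> (\<forall>j. ev_sum (f j) M = left_creation j) \<or>
      M \<in> C_rad f \<and> (\<forall>j. ev_rad (f j) M = left_creation j)"
  shows "universal_model f g M"
proof
  show "tuple_eval f M = left_creation"
  proof (cases "M \<in> C_sot f")
    case True
    then have "ev_rad (f j) M = ev_sum (f j) M" for j
      by (intro ev_rad_eq_ev_sum) (simp_all add: C_sot_def)
    then show ?thesis using True conv by (auto simp: tuple_eval_def)
  qed (use conv in \<open>auto simp: tuple_eval_def\<close>)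
qed (use mult conv in auto)

lemma left_creationI:
  assumes "bounded_clinear T" "\<And>\<beta>. T (ell2_basis \<beta>) = ell2_basis (j # \<beta>)"
  shows "T = left_creation (j :: 'n::finite)"
  by (rule ell2_clinear_eqI[OF assms(1) bounded_clinear_left_creation])
    (simp add: assms(2) left_creation_basis)

text \<open>Case A makes no assumption on convergence at \<open>M\<close> or on the value there.
  Both come from \<open>f_j(M)\<close> being a finite sum whose symbol is \<open>f_j\<close>
  composed with \<open>g\<close>, that is, the variable \<open>Z_j\<close>.\<close>

lemma model_A_universal:
  assumes "model_A f g M"
  shows "universal_model f g M"
proof -
  have f: "nc_polynomial (f i)"
    and g: "nc_polynomial (g i)" "ncps_compose (g i) f = ncps_var i"
    and M: "left_mult_A f (ncps_var i) (M i)" for i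
    using assms by (simp_all add: model_A_def)
  obtain k where k: "\<And>i. ncps_compose (f i) k = ncps_var i"
    using assms unfolding model_A_def by (elim conjE exE) (rule that, erule spec)
  \<comment> \<open>Substituting the polynomial inverse \<open>k\<close> undoes substitution of
    \<open>f\<close>, so composition with \<open>f\<close> is injective on polynomials.\<close>
  have inverse: "ncps_compose (ncps_compose c f) k = c" if "nc_polynomial c" for c
    using ncps_compose_assoc[OF that, of f k] by (simp add: f k ncps_compose_var[OF that])
  have inj: "c = d" if "nc_polynomial c" "nc_polynomial d" "ncps_compose c f = ncps_compose d f" for c d
    using inverse[OF that(1)] inverse[OF that(2)] that(3) by metis
  have mult: "left_multiplier (g i) (M i)" for i
  proof (rule left_multiplierI_basis)
    show "bounded_clinear (M i)" using M[of i] by (simp add: left_mult_A_def)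
    show "ell2_coeff (M i (ell2_basis \<beta>)) = ncps_mult (g i) (ell2_coeff (ell2_basis \<beta>))" for \<beta>
    proof (rule inj)
      show "nc_polynomial (ell2_coeff (M i (ell2_basis \<beta>)))"
        using M[of i] nc_polynomial_basis[of \<beta>] by (simp add: left_mult_A_def)
      show "nc_polynomial (ncps_mult (g i) (ell2_coeff (ell2_basis \<beta>)))"
        by (intro nc_polynomial_mult g nc_polynomial_basis)
      show "ncps_compose (ell2_coeff (M i (ell2_basis \<beta>))) f =
          ncps_compose (ncps_mult (g i) (ell2_coeff (ell2_basis \<beta>))) f"
        using M[of i] nc_polynomial_basis[of \<beta>]
        by (simp add: left_mult_A_def ncps_compose_basis g
            ncps_compose_mult_basis[OF nc_polynomial_composable[OF g(1)]])
    qed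
  qed
  then have bt: "bounded_tuple M" unfolding bounded_tuple_def using left_multiplier_bounded by blast
  \<comment> \<open>Only \<open>g\<close> composed with \<open>f\<close> is given as the identity.
    The other order follows by composing both sides with \<open>f\<close> and cancelling it.\<close>
  have fg: "ncps_compose (f j) g = ncps_var j" for j
  proof (rule inj)
    show "nc_polynomial (ncps_compose (f j) g)" by (intro nc_polynomial_compose f g)
    have "ncps_compose (ncps_compose (f j) g) f = f j"
      by (simp add: ncps_compose_assoc f g ncps_compose_var)
    also have "f j = ncps_compose (ncps_var j) f"
      using ncps_compose_basis[of "[j]" f] by (simp add: ell2_coeff_basis_Cons ell2_coeff_basis_Nil)
    finally show "ncps_compose (ncps_compose (f j) g) f = ncps_compose (ncps_var j) f" .
  qed (rule nc_polynomial_var)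
  have sums: "(\<lambda>k. hom_part (f j) M k h) sums left_creation j h" for j h
  proof -
    have fin: "finite {\<alpha>. f j \<alpha> \<noteq> 0}" using f by (simp add: nc_polynomial_def)
    obtain N where N: "{\<alpha>. f j \<alpha> \<noteq> 0} \<subseteq> {\<alpha>. length \<alpha> < N}" using finite_words_subset[OF fin] .
    have "left_multiplier (\<lambda>w. \<Sum>\<alpha> | length \<alpha> < N. f j \<alpha> * ncps_word g \<alpha> w)
        (\<lambda>h. \<Sum>\<alpha> | length \<alpha> < N. f j \<alpha> *\<^sub>C op_word M \<alpha> h)"
      by (intro left_multiplier_sum left_multiplier_cmult left_multiplier_op_word mult)
    then have "left_multiplier (ncps_var j) (\<lambda>h. \<Sum>\<alpha> | length \<alpha> < N. f j \<alpha> *\<^sub>C op_word M \<alpha> h)"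
      using ncps_compose_polynomial[OF finite_words_less N, of g] by (simp add: fg)
    from left_multiplier_unique[OF this left_multiplier_creation]
    have "(\<Sum>k<N. hom_part (f j) M k h) = left_creation j h"
      by (simp add: hom_part_def sum_words_less fun_eq_iff)
    moreover have "hom_part (f j) M k h = 0" if "k \<notin> {..<N}" for k
      unfolding hom_part_def using N that by (intro sum.neutral) force
    ultimately show ?thesis using sums_finite[of "{..<N}" "\<lambda>k. hom_part (f j) M k h"] by simp
  qed
  show ?thesis
  proof (rule universal_modelI[OF mult], rule disjI1, intro conjI allI)
    show "M \<in> C_sot f"
      using sums bt bounded_clinear_left_creation unfolding C_sot_def sot_convergent_def by blast
    show "ev_sum (f j) M = left_creation j" for j
      using sums_unique[OF sums] by (auto simp: ev_sum_def fun_eq_iff)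
  qed
qed

text \<open>Multiplication by \<open>Z_i\<close> or \<open>f_j\<close> is known on each basis vector
  as a formal power series; the invertible Jacobian makes its expansion in the
  \<open>f_\<alpha>\<close> unique, which fixes the coordinates.\<close>

lemma model_S_universal:
  assumes "model_S f g M"
  shows "universal_model f g M"
proof -
  interpret no_constant_terms f
    using assms by unfold_locales (simp add: model_S_def)
  have g: "ncps_compose (g i) f = ncps_var i" for i using assms by (simp add: model_S_def)
  have M: "left_mult_S f (ncps_var i) (M i)" for i using assms by (simp add: model_S_def)
  have det: "det (\<chi> i j. f i [j]) \<noteq> 0" using assms by (simp add: model_S_def)
  note inj = ncps_compose_injective[OF det]
  have mult: "left_multiplier (g i) (M i)" for i
  proof (rule left_multiplierI_basis)
    show "bounded_clinear (M i)" using M[of i] by (simp add: left_mult_S_def)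
    show "ell2_coeff (M i (ell2_basis \<beta>)) = ncps_mult (g i) (ell2_coeff (ell2_basis \<beta>))" for \<beta>
      using M[of i]
      by (rule_tac inj) (simp add: left_mult_S_def ncps_compose_basis g
          ncps_compose_mult_basis[OF finite_composable])
  qed
  have creation: "T = left_creation j" if T: "left_mult_S f (f j) T" for T j
  proof (rule left_creationI)
    show "bounded_clinear T" using T by (simp add: left_mult_S_def)
    have "ell2_coeff (T (ell2_basis \<beta>)) = ell2_coeff (ell2_basis (j # \<beta>))" for \<beta>
      using T by (rule_tac inj) (simp add: left_mult_S_def ncps_compose_basis)
    then show "T (ell2_basis \<beta>) = ell2_basis (j # \<beta>)" for \<beta> by (simp add: ell2_eqI)
  qed
  show ?thesis
    by (rule universal_modelI[OF mult]) (use assms creation in \<open>auto simp: model_S_def\<close>)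
qed

lemma ev_sum_basis: "ev_sum (ell2_coeff (ell2_basis \<alpha>)) X = op_word X \<alpha>"
proof
  fix h
  have "hom_part (ell2_coeff (ell2_basis \<alpha>)) X k h = (if k = length \<alpha> then op_word X \<alpha> h else 0)" for k
  proof -
    have "hom_part (ell2_coeff (ell2_basis \<alpha>)) X k h =
        (\<Sum>\<gamma> | length \<gamma> = k. if \<gamma> = \<alpha> then op_word X \<alpha> h else 0)"
      unfolding hom_part_def by (intro sum.cong refl) (simp add: ell2_coeff_basis)
    then show ?thesis by auto
  qed
  then have "(\<lambda>k. hom_part (ell2_coeff (ell2_basis \<alpha>)) X k h) sums op_word X \<alpha> h"
    using sums_single[of "length \<alpha>" "\<lambda>_. op_word X \<alpha> h"] by simp
  then show "ev_sum (ell2_coeff (ell2_basis \<alpha>)) X h = op_word X \<alpha> h"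
    by (simp add: ev_sum_def sums_unique[symmetric])
qed

lemma hom_part_mult_basis:
  fixes X :: "'n::finite \<Rightarrow> 'h::complex_hilbert_space \<Rightarrow> 'h"
  shows
  "hom_part (ncps_mult c (ell2_coeff (ell2_basis \<beta>))) X (k + length \<beta>) h =
    hom_part c X k (op_word X \<beta> h)"
proof -
  let ?d = "ncps_mult c (ell2_coeff (ell2_basis \<beta>))"
  have "hom_part ?d X (k + length \<beta>) h =
      (\<Sum>\<gamma>\<in>(\<lambda>\<alpha>. \<alpha> @ \<beta>) ` {\<alpha>. length \<alpha> = k}. ?d \<gamma> *\<^sub>C op_word X \<gamma> h)"
    unfolding hom_part_def
  proof (rule sum.mono_neutral_right)
    show "\<forall>\<gamma>\<in>{\<gamma>. length \<gamma> = k + length \<beta>} - (\<lambda>\<alpha>. \<alpha> @ \<beta>) ` {\<alpha>. length \<alpha> = k}.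
        ?d \<gamma> *\<^sub>C op_word X \<gamma> h = 0"
    proof
      fix \<gamma> assume "\<gamma> \<in> {\<gamma>. length \<gamma> = k + length \<beta>} - (\<lambda>\<alpha>. \<alpha> @ \<beta>) ` {\<alpha>. length \<alpha> = k}"
      then have "\<gamma> \<notin> range (\<lambda>\<alpha>. \<alpha> @ \<beta>)" by auto
      then show "?d \<gamma> *\<^sub>C op_word X \<gamma> h = 0" by (simp add: ncps_mult_basis_not_append)
    qed
  qed auto
  also have "\<dots> = hom_part c X k (op_word X \<beta> h)"
    unfolding hom_part_def
    by (subst sum.reindex) (simp_all add: inj_on_def ncps_mult_basis_append op_word_append)
  finally show ?thesis .
qed

text \<open>A word on the right shifts degrees by its length and acts as the operator applied first,
  so evaluation is multiplicative for such products.\<close>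

lemma ev_sum_mult_basis:
  fixes X :: "'n::finite \<Rightarrow> 'h::complex_hilbert_space \<Rightarrow> 'h"
  assumes "summable (\<lambda>k. hom_part c X k (op_word X \<beta> h))"
  shows "ev_sum (ncps_mult c (ell2_coeff (ell2_basis \<beta>))) X h = ev_sum c X (op_word X \<beta> h)"
proof -
  let ?d = "ncps_mult c (ell2_coeff (ell2_basis \<beta>))"
  have zero: "hom_part ?d X k h = 0" if "k < length \<beta>" for k
    unfolding hom_part_def
  proof (intro sum.neutral ballI)
    fix \<gamma> :: "'n list" assume "\<gamma> \<in> {\<gamma>. length \<gamma> = k}"
    then have "\<gamma> \<notin> range (\<lambda>\<alpha>. \<alpha> @ \<beta>)" using that by auto
    then show "?d \<gamma> *\<^sub>C op_word X \<gamma> h = 0" by (simp add: ncps_mult_basis_not_append)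
  qed
  have "(\<lambda>k. hom_part ?d X (k + length \<beta>) h) sums ev_sum c X (op_word X \<beta> h)"
    unfolding hom_part_mult_basis ev_sum_def by (rule summable_sums[OF assms])
  then have "(\<lambda>k. hom_part ?d X k h) sums ev_sum c X (op_word X \<beta> h)"
    using sums_iff_shift[of "\<lambda>k. hom_part ?d X k h" "length \<beta>"] by (simp add: zero)
  then show ?thesis by (simp add: ev_sum_def sums_unique[symmetric])
qed

lemma square_summable_mult_basis:
  assumes "square_summable c"
  shows "square_summable (ncps_mult c (ell2_coeff (ell2_basis \<beta>)))"
proof -
  let ?d = "ncps_mult c (ell2_coeff (ell2_basis \<beta>))"
  have "(\<lambda>w. (cmod (?d w))\<^sup>2) summable_on range (\<lambda>\<alpha>. \<alpha> @ \<beta>)"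
    using assms unfolding square_summable_def
    by (subst summable_on_reindex) (simp_all add: inj_on_def o_def ncps_mult_basis_append)
  then show ?thesis
    unfolding square_summable_def
    by (rule summable_on_cong_neutral[THEN iffD1, rotated -1])
      (auto simp: ncps_mult_basis_not_append)
qed

text \<open>The homogeneous parts of a square summable series have coefficient norms bounded by the
  norm of the whole. This lets the nonvanishing hypothesis of case F be applied to differences of
  vectors.\<close>

lemma free_holomorphic_ell2: "free_holomorphic 1 (ell2_coeff x)"
  unfolding free_holomorphic_def ncps_radius_def
proof (rule conv_radius_geI_ex)
  fix r :: real assume r: "0 < r" "ereal r < ereal 1"
  let ?s = "\<lambda>k. sqrt (\<Sum>\<alpha> | length \<alpha> = k. (cmod (ell2_coeff x \<alpha>))\<^sup>2)"
  have "summable (\<lambda>k. ?s k * r ^ k)"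
  proof (rule summable_comparison_test')
    show "summable (\<lambda>k. norm x * r ^ k)" using r by (intro summable_mult summable_geometric) simp
    have "?s k \<le> norm x" for k
      using ell2_sum_le_norm[of "{\<alpha>. length \<alpha> = k}" x] by (intro real_le_lsqrt) auto
    then show "norm (?s k * r ^ k) \<le> norm x * r ^ k" for k
      using r by (simp add: abs_mult sum_nonneg mult_right_mono)
  qed
  then show "\<exists>z. norm z = r \<and> summable (\<lambda>k. ?s k * z ^ k)" using r by (intro exI[of _ r]) simp
qed

lemma model_F_universal:
  fixes f g :: "'n::finite \<Rightarrow> 'n ncps"
  assumes "model_F f g M"
  shows "universal_model f g M"
proof -
  obtain \<gamma> where ball: "\<And>X. X \<in> op_ball \<gamma> \<Longrightarrow> ev_at f X \<in> op_ball 1"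
    and nonzero: "\<And>G. free_holomorphic 1 G \<Longrightarrow> G \<noteq> (\<lambda>_. 0) \<Longrightarrow>
      \<exists>X\<in>op_ball \<gamma>. ev_sum G (ev_at f X) \<noteq> (\<lambda>_. 0)"
    and g: "\<And>i. square_summable (g i)" "\<And>i X. X \<in> op_ball \<gamma> \<Longrightarrow> ev_sum (g i) (ev_at f X) = X i"
    and M: "\<And>i. left_mult_F \<gamma> f (ncps_var i) (M i)"
    and conv: "M \<in> C_sot f \<and> (\<forall>j. left_mult_F \<gamma> f (f j) (ev_sum (f j) M)) \<or>
      M \<in> C_rad f \<and> (\<forall>j. left_mult_F \<gamma> f (f j) (ev_rad (f j) M))"
    using assms unfolding model_F_def by (elim conjE exE) (rule that; blast)
  have sums: "(\<lambda>k. hom_part (ell2_coeff x) Y k h) sums ev_sum (ell2_coeff x) Y h"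
    if Y: "Y \<in> op_ball 1" for x and Y :: "'n \<Rightarrow> nat ell2 \<Rightarrow> nat ell2" and h
  proof (rule sot_convergent_sums, rule norm_convergent_imp_sot)
    show "bounded_tuple Y" using Y by (simp add: op_ball_def)
    then show "norm_convergent (ell2_coeff x) Y"
      using Y by (intro norm_convergent_row_bounded[OF row_bounded_row_norm]) (simp_all add: op_ball_def)
  qed
  \<comment> \<open>Apply the nonvanishing hypothesis to the series of \<open>x - y\<close>: a
    vector is determined by its evaluations on the operator ball of radius
    \<open>\<gamma>\<close>.\<close>
  have inj: "x = y"
    if eq: "\<And>X. X \<in> op_ball \<gamma> \<Longrightarrow> ev_sum (ell2_coeff x) (ev_at f X) = ev_sum (ell2_coeff y) (ev_at f X)" for x y
  proof (rule ccontr)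
    assume "x \<noteq> y"
    then have "ell2_coeff (x - y) \<noteq> (\<lambda>_. 0)" by (auto simp: fun_eq_iff intro: ell2_eqI)
    then obtain X where X: "X \<in> op_ball \<gamma>" "ev_sum (ell2_coeff (x - y)) (ev_at f X) \<noteq> (\<lambda>_. 0)"
      using nonzero[OF free_holomorphic_ell2] by blast
    have "ev_sum (ell2_coeff (x - y)) (ev_at f X) h = 0" for h
    proof -
      have "(\<lambda>k. hom_part (ell2_coeff x) (ev_at f X) k h - hom_part (ell2_coeff y) (ev_at f X) k h)
          sums (ev_sum (ell2_coeff x) (ev_at f X) h - ev_sum (ell2_coeff y) (ev_at f X) h)"
        by (intro sums_diff sums ball X)
      also have "(\<lambda>k. hom_part (ell2_coeff x) (ev_at f X) k h - hom_part (ell2_coeff y) (ev_at f X) k h)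
          = (\<lambda>k. hom_part (ell2_coeff (x - y)) (ev_at f X) k h)"
        by (simp add: hom_part_def scaleC_diff_left sum_subtractf)
      finally show ?thesis by (simp add: eq[OF X(1)] ev_sum_def sums_unique[symmetric])
    qed
    then show False using X(2) by blast
  qed
  have var: "ev_sum (ncps_var i) X = X i" for i and X :: "'n \<Rightarrow> nat ell2 \<Rightarrow> nat ell2"
    using ev_sum_basis[of "[i]" X] by (simp add: ell2_coeff_basis_Cons ell2_coeff_basis_Nil)
  have mult: "left_multiplier (g i) (M i)" for i
  proof (rule left_multiplierI_basis)
    show "bounded_clinear (M i)" using M[of i] by (simp add: left_mult_F_def)
    fix \<beta>
    \<comment> \<open>The expected image of the basis vector has to be a vector before
      \<open>inj\<close> can compare it with the actual one; right multiplication by a word keeps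
      \<open>g i\<close> square summable.\<close>
    define s where "s = Abs_ell2 (ncps_mult (g i) (ell2_coeff (ell2_basis \<beta>)))"
    have s: "ell2_coeff s = ncps_mult (g i) (ell2_coeff (ell2_basis \<beta>))"
      by (simp add: s_def square_summable_mult_basis g)
    have "M i (ell2_basis \<beta>) = s"
    proof (rule inj)
      fix X :: "'n \<Rightarrow> nat ell2 \<Rightarrow> nat ell2"
      assume X: "X \<in> op_ball \<gamma>"
      have "ev_sum (ell2_coeff s) (ev_at f X) h = ev_sum (g i) (ev_at f X) (op_word (ev_at f X) \<beta> h)" for h
        using sums[OF ball[OF X], of "Abs_ell2 (g i)"]
        unfolding s by (intro ev_sum_mult_basis) (simp add: g sums_iff)
      then show "ev_sum (ell2_coeff (M i (ell2_basis \<beta>))) (ev_at f X) = ev_sum (ell2_coeff s) (ev_at f X)"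
        using M[of i] X by (simp add: left_mult_F_def var g ev_sum_basis fun_eq_iff)
    qed
    then show "ell2_coeff (M i (ell2_basis \<beta>)) = ncps_mult (g i) (ell2_coeff (ell2_basis \<beta>))"
      by (simp add: s)
  qed
  have creation: "T = left_creation j" if T: "left_mult_F \<gamma> f (f j) T" for T j
  proof (rule left_creationI)
    show "bounded_clinear T" using T by (simp add: left_mult_F_def)
    \<comment> \<open>Both vectors evaluate at \<open>X\<close> to \<open>f_j(X)\<close> followed on
      the right by the word \<open>\<beta>\<close> in \<open>f(X)\<close>.\<close>
    show "T (ell2_basis \<beta>) = ell2_basis (j # \<beta>)" for \<beta>
      by (rule inj) (use T in \<open>simp add: left_mult_F_def ev_sum_basis, simp add: ev_at_def\<close>)
  qed
  show ?thesis
    by (rule universal_modelI[OF mult]) (use conv creation in blast)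
qed

theorem theorem6p2:
  fixes f g :: "'n::finite \<Rightarrow> 'n ncps"
    and M :: "'n \<Rightarrow> 'n list ell2 \<Rightarrow> 'n list ell2"
  assumes "model_property f g M"
  shows
    "(\<forall>v. (v \<noteq> 0 \<and> (\<exists>\<mu> :: 'n \<Rightarrow> complex. \<forall>i. cadjoint (M i) v = \<mu> i *\<^sub>C v)) \<longleftrightarrow>
          (\<exists>z\<in>scalar_domain f g. \<exists>c. c \<noteq> 0 \<and> v = c *\<^sub>C poisson_kernel f z)) \<and>
     (\<forall>z\<in>scalar_domain f g. \<forall>i.
          cadjoint (M i) (poisson_kernel f z) = cnj (z $ i) *\<^sub>C poisson_kernel f z) \<and>
     (\<forall>z\<in>scalar_domain f g.
          continuous_map (subtopology wot (hardy_algebra M)) euclidean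
            (\<lambda>T. hardy_eval f M T z) \<and>
          (\<forall>S\<in>hardy_algebra M. \<forall>T\<in>hardy_algebra M.
             hardy_eval f M (S \<circ> T) z = hardy_eval f M S z * hardy_eval f M T z) \<and>
          (\<forall>T\<in>hardy_algebra M.
             hardy_eval f M T z = cinner (T (poisson_kernel f z)) (poisson_kernel f z) \<and>
             cadjoint T (poisson_kernel f z) =
               cnj (hardy_eval f M T z) *\<^sub>C poisson_kernel f z)) \<and>
     (\<forall>T\<in>hardy_algebra M.
          bounded (hardy_eval f M T ` scalar_domain f g) \<and>
          holomorphic_several (hardy_eval f M T) (scalar_domain f g))"
proof -
  interpret universal_model f g M
    using assms model_A_universal model_S_universal model_F_universal
    unfolding model_property_def by blast
  show ?thesis
  proof (intro conjI allI ballI)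
    fix z T assume z: "z \<in> scalar_domain f g" and "T \<in> hardy_algebra M"
    then obtain c where T: "left_multiplier c T" using hardy_algebraE by blast
    show "hardy_eval f M T z = cinner (T (poisson_kernel f z)) (poisson_kernel f z)"
      by (rule hardy_eval_poisson(3)[OF z T])
    show "cadjoint T (poisson_kernel f z) = cnj (hardy_eval f M T z) *\<^sub>C poisson_kernel f z"
      by (rule hardy_eval_poisson(1)[OF z T])
  next
    fix T assume "T \<in> hardy_algebra M"
    then obtain c where T: "left_multiplier c T" using hardy_algebraE by blast
    show "bounded (hardy_eval f M T ` scalar_domain f g)" by (rule hardy_eval_bounded[OF T])
    show "holomorphic_several (hardy_eval f M T) (scalar_domain f g)"
      by (rule hardy_eval_holomorphic[OF T])
  qed (rule eigenvector_iff model_poisson_kernel hardy_eval_wot_continuous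
      hardy_eval_multiplicative; assumption)+
qed

end
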